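(* Let $\mu_0\in\mathcal{H}_{q,n}$ be such that the homogeneous space $(G_{\mu_0}/K_{\mu_0},g_{\mu_0})$ is a semi-algebraic soliton, say with $$\operatorname{Ric}_{\mu_0}=cI+\tfrac12(D_{\mathfrak{p}}+D_{\mathfrak{p}}^t),\qquad c\in\mathbb{R},\qquad D:=\begin{bmatrix}0&\ast\\0&D_{\mathfrak{p}}\end{bmatrix}\in\operatorname{Der}(\mathfrak{g},\mu_0).$$ Let $F:\mathcal{H}_{q,n}\to\mathbb{R}$ be any differentiable function invariant under isometry and scaling such that $F(\mu_0)\neq0$. Then the normalized bracket flow solution starting at $\mu_0$ such that $F(\mu(t))\equiv F(\mu_0)$ is given by $$\mu(t)=\begin{bmatrix}I&0\\0&e^{tA}e^{-tD_{\mathfrak{p}}}\end{bmatrix}\cdot\mu_0,\qquad t\in(-\infty,\infty),$$ where $A=\tfrac12(D_{\mathfrak{p}}-D_{\mathfrak{p}}^t)$.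
   Context: Fix a real vector space $\mathfrak{g}=\mathfrak{k}\oplus\mathfrak{p}$ with $\dim\mathfrak{k}=q$, $\dim\mathfrak{p}=n$, and an inner product $\langle\cdot,\cdot\rangle$ on $\mathfrak{p}$. Block matrices are with respect to $\mathfrak{g}=\mathfrak{k}\oplus\mathfrak{p}$; transposes are with respect to $\langle\cdot,\cdot\rangle$. Let $V_{q+n}$ be the space of skew-symmetric bilinear maps $\mu:\mathfrak{g}\times\mathfrak{g}\to\mathfrak{g}$. The subset $\mathcal{H}_{q,n}\subset V_{q+n}$ consists of those $\mu$ such that: (h1) $\mu$ satisfies the Jacobi identity, $\mu(\mathfrak{k},\mathfrak{k})\subset\mathfrak{k}$, $\mu(\mathfrak{k},\mathfrak{p})\subset\mathfrak{p}$; (h2) if $G_\mu$ is the simply connected Lie group with Lie algebra $(\mathfrak{g},\mu)$ and $K_\mu$ the connected Lie subgroup with Lie algebra $\mathfrak{k}$, then $K_\mu$ is closed in $G_\mu$; (h3) $\operatorname{ad}_\mu Z|_{\mathfrak{p}}$ is skew-symmetric with respect to $\langle\cdot,\cdot\rangle$ for all $Z\in\mathfrak{k}$; (h4) $\{Z\in\mathfrak{k}:\mu(Z,\mathfrak{p})=0\}=0$. Each $\mu\in\mathcal{H}_{q,n}$ defines the simply connected homogeneous space $(G_\mu/K_\mu,g_\mu)$, where $g_\mu$ is the $G_\mu$-invariant metric with $g_\mu(o_\mu)=\langle\cdot,\cdot\rangle$ on $\mathfrak{p}\equiv T_{o_\mu}(G_\mu/K_\mu)$. Its Ricci operator at the origin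 is $\operatorname{Ric}_\mu:\mathfrak{p}\to\mathfrak{p}$. Actions: for $h\in\operatorname{GL}(\mathfrak{g})$, $h\cdot\mu=h\mu(h^{-1}\cdot,h^{-1}\cdot)$. For a scalar $a$, $a\cdot\mu$ denotes the geometric rescaling: $a\cdot\mu=\mu$ on $\mathfrak{k}\times\mathfrak{k}$ and $\mathfrak{k}\times\mathfrak{p}$, and $a\cdot\mu|_{\mathfrak{p}\times\mathfrak{p}}=a^2\mu_{\mathfrak{k}}+a\mu_{\mathfrak{p}}$, where $\mu_{\mathfrak{k}},\mu_{\mathfrak{p}}$ are the $\mathfrak{k}$- and $\mathfrak{p}$-components of $\mu|_{\mathfrak{p}\times\mathfrak{p}}$. $F:\mathcal{H}_{q,n}\to\mathbb{R}$ is invariant under isometry if $F(\mu)=F(\lambda)$ whenever $(G_\mu/K_\mu,g_\mu)$ and $(G_\lambda/K_\lambda,g_\lambda)$ are isometric; it is (invariant under scaling) scaling invariant if there exists $d\neq0$ such that $F(a\cdot\mu)=a^dF(\mu)$ for all $a>0$, $\mu\in\mathcal{H}_{q,n}$. A normalized bracket flow, for a (continuous) real function $r(t)$ which may depend on $\mu(t)$, is the ODE $$\frac{d}{dt}\mu=-\pi\left(\begin{bmatrix}0&0\\0&\operatorname{Ric}_\mu+rI\end{bmatrix}\right)\mu,\qquad\mu(0)=\mu_0,$$ where $\pi(E)\mu=E\mu(\cdot,\cdot)-\mu(E\cdot,\cdot)-\mu(\cdot,E\cdot)$ for $E\in\mathfrak{gl}(\mathfrak{g})$. It is a known fact that solutions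 starting in $\mathcal{H}_{q,n}$ stay in $\mathcal{H}_{q,n}$, and that every normalized solution has the form $\mu(t)=c(t)\cdot\nu(\tau(t))$, where $\nu$ is the solution with $r\equiv0$, $\nu(0)=\mu_0$, and $c'=rc$, $c(0)=1$, $\tau'=c^2$, $\tau(0)=0$. The solution in the claim is the one for which $r$ is chosen so that $F(\mu(t))$ is constant. A homogeneous space $(G/K,g)$ is a semi-algebraic soliton if there is a one-parameter (smooth in $t$) family $\tilde\varphi_t\in\operatorname{Aut}(G)$ with $\tilde\varphi_t(K)=K$ such that $g(t)=c(t)\varphi_t^*g$ is a solution to the Ricci flow $\frac{\partial}{\partial t}g(t)=-2\operatorname{Rc}(g(t))$, $g(0)=g$, for some scaling function $c(t)>0$, where $\varphi_t\in\operatorname{Diff}(G/K)$ is the diffeomorphism determined by $\tilde\varphi_t$. *)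

theory Defs
  imports
    "HOL-Analysis.Analysis"
    "HOL-Algebra.Left_Coset"
    "HOL-Algebra.Generated_Groups"
begin

section \<open>Smooth maps between open subsets of Euclidean spaces\<close>

text \<open>Only meaningful for open \<open>S\<close>.\<close>

primrec Ck_on :: "nat \<Rightarrow> 'a::euclidean_space set \<Rightarrow> ('a \<Rightarrow> 'b::real_normed_vector) \<Rightarrow> bool" where
  "Ck_on 0 S f \<longleftrightarrow> continuous_on S f"
| "Ck_on (Suc n) S f \<longleftrightarrow>
     (\<forall>x\<in>S. f differentiable (at x)) \<and> (\<forall>v. Ck_on n S (\<lambda>x. frechet_derivative f (at x) v))"

definition smooth_on :: "'a::euclidean_space set \<Rightarrow> ('a \<Rightarrow> 'b::real_normed_vector) \<Rightarrow> bool" where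
  "smooth_on S f \<longleftrightarrow> (\<forall>n. Ck_on n S f)"


section \<open>Smooth manifolds\<close>

text \<open>
  A chart is a pair of a domain and a coordinate map (irrelevant outside the domain). A manifold
  modelled on \<open>'e\<close> is given by an atlas, which determines the points and the topology.
\<close>

type_synonym ('m, 'e) chart = "'m set \<times> ('m \<Rightarrow> 'e)"

definition uncoord :: "('m, 'e) chart \<Rightarrow> 'e \<Rightarrow> 'm" where
  "uncoord c = inv_into (fst c) (snd c)"

definition points :: "('m, 'e) chart set \<Rightarrow> 'm set" where
  "points A = (\<Union>c\<in>A. fst c)"

definition smooth_atlas :: "('m, 'e::euclidean_space) chart set \<Rightarrow> bool" where
  "smooth_atlas A \<longleftrightarrow>
     (\<forall>c\<in>A. inj_on (snd c) (fst c) \<and> open (snd c ` fst c)) \<and>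
     (\<forall>c\<in>A. \<forall>d\<in>A. open (snd c ` (fst c \<inter> fst d)) \<and>
                  smooth_on (snd c ` (fst c \<inter> fst d)) (snd d \<circ> uncoord c))"

definition manifold_topology :: "('m, 'e::euclidean_space) chart set \<Rightarrow> 'm topology" where
  "manifold_topology A =
     topology (\<lambda>W. W \<subseteq> points A \<and> (\<forall>c\<in>A. open (snd c ` (fst c \<inter> W))))"

definition smooth_manifold :: "('m, 'e::euclidean_space) chart set \<Rightarrow> bool" where
  "smooth_manifold A \<longleftrightarrow>
     smooth_atlas A \<and> Hausdorff_space (manifold_topology A) \<and> second_countable (manifold_topology A)"

definition open_atlas :: "'e set \<Rightarrow> ('e, 'e) chart set" where
  "open_atlas S = {(S, \<lambda>x. x)}"

definition prod_atlas ::
  "('m, 'e) chart set \<Rightarrow> ('n, 'f) chart set \<Rightarrow> ('m \<times> 'n, 'e \<times> 'f) chart set" where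
  "prod_atlas A B = {(fst c \<times> fst d, \<lambda>(x, y). (snd c x, snd d y)) |c d. c \<in> A \<and> d \<in> B}"

text \<open>The openness condition expresses continuity.\<close>

definition smooth_map ::
  "('m, 'e::euclidean_space) chart set \<Rightarrow> ('n, 'f::euclidean_space) chart set \<Rightarrow> ('m \<Rightarrow> 'n) \<Rightarrow> bool" where
  "smooth_map A B f \<longleftrightarrow>
     f ` points A \<subseteq> points B \<and>
     (\<forall>c\<in>A. \<forall>d\<in>B. open (snd c ` (fst c \<inter> f -` fst d)) \<and>
                  smooth_on (snd c ` (fst c \<inter> f -` fst d)) (snd d \<circ> f \<circ> uncoord c))"

definition diffeo ::
  "('m, 'e::euclidean_space) chart set \<Rightarrow> ('n, 'f::euclidean_space) chart set \<Rightarrow> ('m \<Rightarrow> 'n) \<Rightarrow> bool" where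
  "diffeo A B f \<longleftrightarrow>
     bij_betw f (points A) (points B) \<and> smooth_map A B f \<and> smooth_map B A (inv_into (points A) f)"


subsection \<open>Tangent vectors, vector fields\<close>

text \<open>
  The tangent space at a point \<open>p\<close> is the model space \<open>'e\<close>: a tangent vector is represented by its
  components in a fixed preferred chart \<open>chart_at A p\<close> around \<open>p\<close>. A vector field is thus a function
  \<open>X :: 'm \<Rightarrow> 'e\<close>, where \<open>X p\<close> is to be read in the chart \<open>chart_at A p\<close>.
\<close>

definition chart_at :: "('m, 'e) chart set \<Rightarrow> 'm \<Rightarrow> ('m, 'e) chart" where
  "chart_at A p = (SOME c. c \<in> A \<and> p \<in> fst c)"

definition mderiv ::
  "('m, 'e::euclidean_space) chart set \<Rightarrow> ('n, 'f::euclidean_space) chart set \<Rightarrow> ('m \<Rightarrow> 'n) \<Rightarrow> 'm \<Rightarrow> 'e \<Rightarrow> 'f" where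
  "mderiv A B f p =
     frechet_derivative (snd (chart_at B (f p)) \<circ> f \<circ> uncoord (chart_at A p))
                        (at (snd (chart_at A p) p))"

text \<open>The components of a vector field with respect to an arbitrary chart \<open>c\<close>:\<close>

definition field_in ::
  "('m, 'e::euclidean_space) chart set \<Rightarrow> ('m, 'e) chart \<Rightarrow> ('m \<Rightarrow> 'e) \<Rightarrow> 'e \<Rightarrow> 'e" where
  "field_in A c X y =
     (let p = uncoord c y; d = chart_at A p
      in frechet_derivative (snd c \<circ> uncoord d) (at (snd d p)) (X p))"

definition field_bracket ::
  "('m, 'e::euclidean_space) chart set \<Rightarrow> ('m \<Rightarrow> 'e) \<Rightarrow> ('m \<Rightarrow> 'e) \<Rightarrow> 'm \<Rightarrow> 'e" where
  "field_bracket A X Y p =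
     (let c = chart_at A p; x = snd c p
      in frechet_derivative (field_in A c Y) (at x) (X p)
         - frechet_derivative (field_in A c X) (at x) (Y p))"


section \<open>Riemannian metrics and Ricci curvature\<close>

text \<open>
  A Riemannian metric is a function \<open>g\<close> such that \<open>g p\<close> is an inner product on the tangent space at
  \<open>p\<close>. Its components in a chart \<open>c\<close> are given by \<open>metric_in\<close>.
\<close>

definition metric_in ::
  "('m, 'e::euclidean_space) chart set \<Rightarrow> ('m, 'e) chart \<Rightarrow> ('m \<Rightarrow> 'e \<Rightarrow> 'e \<Rightarrow> real) \<Rightarrow> 'e \<Rightarrow> 'e \<Rightarrow> 'e \<Rightarrow> real" where
  "metric_in A c g y v w =
     (let p = uncoord c y; L = frechet_derivative (snd (chart_at A p) \<circ> uncoord c) (at y)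
      in g p (L v) (L w))"

definition riemannian_metric ::
  "('m, 'e::euclidean_space) chart set \<Rightarrow> ('m \<Rightarrow> 'e \<Rightarrow> 'e \<Rightarrow> real) \<Rightarrow> bool" where
  "riemannian_metric A g \<longleftrightarrow>
     (\<forall>p\<in>points A. bilinear (g p) \<and> (\<forall>v w. g p v w = g p w v) \<and> (\<forall>v. v \<noteq> 0 \<longrightarrow> g p v v > 0)) \<and>
     (\<forall>c\<in>A. \<forall>v w. smooth_on (snd c ` fst c) (\<lambda>y. metric_in A c g y v w))"

text \<open>
  For a metric \<open>h\<close> on an open subset of \<open>'e\<close>: the Christoffel symbols
  \<open>\<Gamma>(v, w) = \<nabla>\<^sub>v w\<close> (for constant fields \<open>v\<close>, \<open>w\<close>) of the Levi-Civita connection, the curvature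
  \<open>R(u, v)w = \<nabla>\<^sub>u \<nabla>\<^sub>v w - \<nabla>\<^sub>v \<nabla>\<^sub>u w - \<nabla>\<^bsub>[u, v]\<^esub> w\<close>, and its trace \<open>Rc(v, w) = tr (u \<mapsto> R(u, v)w)\<close>.
\<close>

definition christoffel ::
  "('e::euclidean_space \<Rightarrow> 'e \<Rightarrow> 'e \<Rightarrow> real) \<Rightarrow> 'e \<Rightarrow> 'e \<Rightarrow> 'e \<Rightarrow> 'e" where
  "christoffel h x v w =
     (THE u. \<forall>z. 2 * h x u z =
        frechet_derivative (\<lambda>y. h y w z) (at x) v
        + frechet_derivative (\<lambda>y. h y v z) (at x) w
        - frechet_derivative (\<lambda>y. h y v w) (at x) z)"

definition curvature ::
  "('e::euclidean_space \<Rightarrow> 'e \<Rightarrow> 'e \<Rightarrow> real) \<Rightarrow> 'e \<Rightarrow> 'e \<Rightarrow> 'e \<Rightarrow> 'e \<Rightarrow> 'e" where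
  "curvature h x u v w =
     frechet_derivative (\<lambda>y. christoffel h y v w) (at x) u
     - frechet_derivative (\<lambda>y. christoffel h y u w) (at x) v
     + christoffel h x u (christoffel h x v w)
     - christoffel h x v (christoffel h x u w)"

definition ricci_tensor ::
  "('m, 'e::euclidean_space) chart set \<Rightarrow> ('m \<Rightarrow> 'e \<Rightarrow> 'e \<Rightarrow> real) \<Rightarrow> 'm \<Rightarrow> 'e \<Rightarrow> 'e \<Rightarrow> real" where
  "ricci_tensor A g p v w =
     (let c = chart_at A p
      in \<Sum>b\<in>Basis. curvature (metric_in A c g) (snd c p) b v w \<bullet> b)"

definition isometry ::
  "('m, 'e::euclidean_space) chart set \<Rightarrow> ('m \<Rightarrow> 'e \<Rightarrow> 'e \<Rightarrow> real) \<Rightarrow>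
   ('n, 'f::euclidean_space) chart set \<Rightarrow> ('n \<Rightarrow> 'f \<Rightarrow> 'f \<Rightarrow> real) \<Rightarrow> ('m \<Rightarrow> 'n) \<Rightarrow> bool" where
  "isometry A g B g' f \<longleftrightarrow>
     diffeo A B f \<and>
     (\<forall>p\<in>points A. \<forall>v w. g' (f p) (mderiv A B f p v) (mderiv A B f p w) = g p v w)"


section \<open>Lie groups\<close>

definition lie_group :: "'m monoid \<Rightarrow> ('m, 'e::euclidean_space) chart set \<Rightarrow> bool" where
  "lie_group G A \<longleftrightarrow>
     group G \<and> smooth_manifold A \<and> points A = carrier G \<and>
     smooth_map (prod_atlas A A) A (\<lambda>(x, y). x \<otimes>\<^bsub>G\<^esub> y) \<and>
     smooth_map A A (m_inv G)"

definition left_invariant_field ::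
  "'m monoid \<Rightarrow> ('m, 'e::euclidean_space) chart set \<Rightarrow> 'e \<Rightarrow> 'm \<Rightarrow> 'e" where
  "left_invariant_field G A v x = mderiv A A (\<lambda>y. x \<otimes>\<^bsub>G\<^esub> y) \<one>\<^bsub>G\<^esub> v"

definition lie_bracket ::
  "'m monoid \<Rightarrow> ('m, 'e::euclidean_space) chart set \<Rightarrow> 'e \<Rightarrow> 'e \<Rightarrow> 'e" where
  "lie_bracket G A v w =
     field_bracket A (left_invariant_field G A v) (left_invariant_field G A w) \<one>\<^bsub>G\<^esub>"

text \<open>
  Version of \<^const>\<open>simply_connected\<close> for abstract topologies: any two loops are freely homotopic
  (in particular the space is path connected).
\<close>

definition simply_connected_top :: "'m topology \<Rightarrow> bool" where
  "simply_connected_top X \<longleftrightarrow>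
     (\<forall>p q. pathin X p \<and> p 0 = p 1 \<and> pathin X q \<and> q 0 = q 1 \<longrightarrow>
        homotopic_with (\<lambda>r. r 0 = r 1) (top_of_set {0..1::real}) X p q)"

definition one_parameter_subgroup ::
  "'m monoid \<Rightarrow> ('m, 'e::euclidean_space) chart set \<Rightarrow> (real \<Rightarrow> 'm) \<Rightarrow> bool" where
  "one_parameter_subgroup G A \<gamma> \<longleftrightarrow>
     smooth_map (open_atlas UNIV) A \<gamma> \<and> (\<forall>s t. \<gamma> (s + t) = \<gamma> s \<otimes>\<^bsub>G\<^esub> \<gamma> t)"

text \<open>
  The connected Lie subgroup with Lie algebra \<open>\<kk>\<close> (a Lie subalgebra of the tangent space at the
  identity), i.e. the subgroup generated by \<open>exp \<kk>\<close>; here \<open>exp v = \<gamma> 1\<close> for the one-parameter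
  subgroup \<open>\<gamma>\<close> with initial velocity \<open>v\<close>.
\<close>

definition connected_lie_subgroup ::
  "'m monoid \<Rightarrow> ('m, 'e::euclidean_space) chart set \<Rightarrow> 'e set \<Rightarrow> 'm set" where
  "connected_lie_subgroup G A \<kk> =
     generate G {\<gamma> 1 |\<gamma>. one_parameter_subgroup G A \<gamma> \<and> mderiv (open_atlas UNIV) A \<gamma> 0 1 \<in> \<kk>}"


section \<open>Brackets on \<open>\<gg> = \<kk> \<oplus> \<pp>\<close>\<close>

text \<open>
  The space \<open>\<gg>\<close> is the type \<open>'g\<close> (of whose Euclidean structure only the linear topology matters),
  \<open>\<kk>\<close> is a subspace \<open>k\<close>, possibly zero. The Euclidean space \<open>(\<pp>, \<langle>\<cdot>,\<cdot>\<rangle>)\<close> is the type \<open>'p\<close> with its inner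
  product \<open>\<bullet>\<close>, included in \<open>\<gg>\<close> by \<open>j\<close>. So \<open>q = dim k\<close> and \<open>n = DIM('p)\<close>.
\<close>

definition splitting :: "'g::euclidean_space set \<Rightarrow> ('p::euclidean_space \<Rightarrow> 'g) \<Rightarrow> bool" where
  "splitting k j \<longleftrightarrow> subspace k \<and> linear j \<and> (\<forall>x. \<exists>!X. x - j X \<in> k)"

definition p_part :: "'g::euclidean_space set \<Rightarrow> ('p::euclidean_space \<Rightarrow> 'g) \<Rightarrow> 'g \<Rightarrow> 'p" where
  "p_part k j x = (THE X. x - j X \<in> k)"

definition k_part :: "'g::euclidean_space set \<Rightarrow> ('p::euclidean_space \<Rightarrow> 'g) \<Rightarrow> 'g \<Rightarrow> 'g" where
  "k_part k j x = x - j (p_part k j x)"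

text \<open>The block matrices with rows \<open>[S, 0]\<close> and \<open>[0, E]\<close>:\<close>

definition block_diag ::
  "'g::euclidean_space set \<Rightarrow> ('p::euclidean_space \<Rightarrow> 'g) \<Rightarrow> ('g \<Rightarrow> 'g) \<Rightarrow> ('p \<Rightarrow> 'p) \<Rightarrow> 'g \<Rightarrow> 'g" where
  "block_diag k j S E x = S (k_part k j x) + j (E (p_part k j x))"

text \<open>
  Bilinear maps \<open>\<gg> \<times> \<gg> \<rightarrow> \<gg>\<close> are automatically bounded; the type of bounded bilinear maps carries the
  normed space structure needed to differentiate.
\<close>

type_synonym 'g bilin_map = "'g \<Rightarrow>\<^sub>L 'g \<Rightarrow>\<^sub>L 'g"

definition to_bilin :: "('g::euclidean_space \<Rightarrow> 'g \<Rightarrow> 'g) \<Rightarrow> 'g bilin_map" where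
  "to_bilin b = Blinfun (\<lambda>x. Blinfun (b x))"

lemma to_bilin_apply:
  assumes "bilinear b"
  shows "to_bilin b x y = b x y"
proof -
  have bb: "bounded_bilinear b"
    using assms by (simp add: bilinear_conv_bounded_bilinear)
  have b: "bounded_linear (b x)" for x
    using bb by (rule bounded_bilinear.bounded_linear_right)
  have lin: "linear (\<lambda>x. Blinfun (b x))"
    using bounded_bilinear.add_left[OF bb] bounded_bilinear.scaleR_left[OF bb]
    by (intro linearI blinfun_eqI)
       (simp_all add: bounded_linear_Blinfun_apply[OF b] blinfun.add_left blinfun.scaleR_left)
  show ?thesis
    unfolding to_bilin_def
    by (simp add: bounded_linear_Blinfun_apply[OF b]
        bounded_linear_Blinfun_apply[OF linear_conv_bounded_linear[THEN iffD1, OF lin]])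
qed

definition skew_brackets :: "'g::euclidean_space bilin_map set" where
  "skew_brackets = {\<mu> :: 'g bilin_map. \<forall>x y. \<mu> x y = - \<mu> y x}"

definition jacobi :: "'g::euclidean_space bilin_map \<Rightarrow> bool" where
  "jacobi \<mu> \<longleftrightarrow> (\<forall>x y z. \<mu> (\<mu> x y) z + \<mu> (\<mu> y z) x + \<mu> (\<mu> z x) y = 0)"

text \<open>\<open>h \<cdot> \<mu>\<close>, only meaningful for invertible linear \<open>h\<close>:\<close>

definition gl_act :: "('g::euclidean_space \<Rightarrow> 'g) \<Rightarrow> 'g bilin_map \<Rightarrow> 'g bilin_map" where
  "gl_act h \<mu> = to_bilin (\<lambda>x y. h (\<mu> (the_inv h x) (the_inv h y)))"

definition pi_rep :: "('g::euclidean_space \<Rightarrow> 'g) \<Rightarrow> 'g bilin_map \<Rightarrow> 'g bilin_map" where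
  "pi_rep E \<mu> = to_bilin (\<lambda>x y. E (\<mu> x y) - \<mu> (E x) y - \<mu> x (E y))"

definition derivations :: "'g::euclidean_space bilin_map \<Rightarrow> ('g \<Rightarrow> 'g) set" where
  "derivations \<mu> = {D. linear D \<and> (\<forall>x y. D (\<mu> x y) = \<mu> (D x) y + \<mu> x (D y))}"

definition rescale ::
  "'g::euclidean_space set \<Rightarrow> ('p::euclidean_space \<Rightarrow> 'g) \<Rightarrow> real \<Rightarrow> 'g bilin_map \<Rightarrow> 'g bilin_map" where
  "rescale k j a \<mu> = to_bilin (\<lambda>x y.
     (let x\<^sub>k = k_part k j x; x\<^sub>p = j (p_part k j x);
          y\<^sub>k = k_part k j y; y\<^sub>p = j (p_part k j y);
          m = \<mu> x\<^sub>p y\<^sub>p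
      in \<mu> x\<^sub>k y\<^sub>k + \<mu> x\<^sub>k y\<^sub>p + \<mu> x\<^sub>p y\<^sub>k
         + a\<^sup>2 *\<^sub>R k_part k j m + a *\<^sub>R j (p_part k j m)))"


section \<open>The homogeneous spaces \<open>(G\<^sub>\<mu>/K\<^sub>\<mu>, g\<^sub>\<mu>)\<close>\<close>

text \<open>
  The points of \<open>G\<^sub>\<mu>\<close> are taken from a type with the cardinality of the continuum, which is large
  enough for every connected Lie group. As \<open>G\<^sub>\<mu>\<close> is determined only up to isomorphism, notions
  depending on it are defined by means of some choice of \<open>G\<^sub>\<mu>\<close>.
\<close>

type_synonym point = "nat set"

text \<open>
  \<open>(G, A)\<close> is a simply connected Lie group with Lie algebra \<open>(\<gg>, \<mu>)\<close>; the linear isomorphism \<open>\<theta>\<close>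
  identifies \<open>\<gg>\<close> with the tangent space at the identity.
\<close>

definition is_lie_group_of ::
  "'g::euclidean_space bilin_map \<Rightarrow> point monoid \<Rightarrow> (point, 'g) chart set \<Rightarrow> ('g \<Rightarrow> 'g) \<Rightarrow> bool" where
  "is_lie_group_of \<mu> G A \<theta> \<longleftrightarrow>
     lie_group G A \<and> simply_connected_top (manifold_topology A) \<and>
     linear \<theta> \<and> bij \<theta> \<and> (\<forall>x y. \<theta> (\<mu> x y) = lie_bracket G A (\<theta> x) (\<theta> y))"

text \<open>
  The set \<open>\<H>\<^bsub>q,n\<^esub>\<close>. The Lie group in the second condition exists and is unique up to isomorphism
  because of the first one.
\<close>

definition hom_brackets ::
  "'g::euclidean_space set \<Rightarrow> ('p::euclidean_space \<Rightarrow> 'g) \<Rightarrow> 'g bilin_map set" where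
  "hom_brackets k j = {\<mu> :: 'g bilin_map. \<mu> \<in> skew_brackets \<and>
     (jacobi \<mu> \<and> (\<forall>z\<in>k. \<forall>w\<in>k. \<mu> z w \<in> k) \<and> (\<forall>z\<in>k. \<forall>X. \<mu> z (j X) \<in> range j)) \<and>
     (\<exists>G A \<theta>. is_lie_group_of \<mu> G A \<theta> \<and>
        closedin (manifold_topology A) (connected_lie_subgroup G A (\<theta> ` k))) \<and>
     (\<forall>z\<in>k. \<forall>X Y. p_part k j (\<mu> z (j X)) \<bullet> Y = - (X \<bullet> p_part k j (\<mu> z (j Y)))) \<and>
     {z \<in> k. \<forall>X. \<mu> z (j X) = 0} = {0}}"

record ('g, 'p) hom_space =
  grp :: "point monoid"
  grp_atlas :: "(point, 'g) chart set"
  alg_iso :: "'g \<Rightarrow> 'g"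
  isotropy :: "point set"
  quot_atlas :: "(point set, 'p) chart set"
  metric :: "point set \<Rightarrow> 'p \<Rightarrow> 'p \<Rightarrow> real"

definition action :: "('g, 'p) hom_space \<Rightarrow> point \<Rightarrow> point set \<Rightarrow> point set" where
  "action M x C = x <#\<^bsub>grp M\<^esub> C"

text \<open>The map \<open>\<gg> \<rightarrow> T\<^sub>o(G/K)\<close> given by the differential of the projection \<open>G \<rightarrow> G/K\<close>:\<close>

definition to_tangent ::
  "('g::euclidean_space, 'p::euclidean_space) hom_space \<Rightarrow> 'g \<Rightarrow> 'p" where
  "to_tangent M x =
     mderiv (grp_atlas M) (quot_atlas M) (\<lambda>a. action M a (isotropy M)) \<one>\<^bsub>grp M\<^esub> (alg_iso M x)"

text \<open>
  \<open>M\<close> is \<open>(G\<^sub>\<mu>/K\<^sub>\<mu>, g\<^sub>\<mu>)\<close>. The manifold structure on the set of left cosets is characterized, as usual,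
  by the smoothness of the \<open>G\<close>-action. The last condition says that \<open>g\<^sub>\<mu>\<close> is \<open>\<langle>\<cdot>,\<cdot>\<rangle>\<close> at the
  origin under the identification of \<open>T\<^sub>o(G/K)\<close> with \<open>\<gg>/\<kk> = \<pp>\<close>.
\<close>

definition is_hom_space_of ::
  "'g::euclidean_space set \<Rightarrow> ('p::euclidean_space \<Rightarrow> 'g) \<Rightarrow> 'g bilin_map \<Rightarrow> ('g, 'p) hom_space \<Rightarrow> bool" where
  "is_hom_space_of k j \<mu> M \<longleftrightarrow>
     is_lie_group_of \<mu> (grp M) (grp_atlas M) (alg_iso M) \<and>
     isotropy M = connected_lie_subgroup (grp M) (grp_atlas M) (alg_iso M ` k) \<and>
     closedin (manifold_topology (grp_atlas M)) (isotropy M) \<and>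
     smooth_manifold (quot_atlas M) \<and>
     points (quot_atlas M) = lcosets\<^bsub>grp M\<^esub> (isotropy M) \<and>
     smooth_map (prod_atlas (grp_atlas M) (quot_atlas M)) (quot_atlas M) (\<lambda>(x, C). action M x C) \<and>
     riemannian_metric (quot_atlas M) (metric M) \<and>
     (\<forall>x\<in>carrier (grp M). isometry (quot_atlas M) (metric M) (quot_atlas M) (metric M) (action M x)) \<and>
     (\<forall>x y. metric M (isotropy M) (to_tangent M x) (to_tangent M y) = p_part k j x \<bullet> p_part k j y)"

text \<open>
  \<open>R\<close> is the Ricci operator \<open>Ric\<^sub>\<mu>\<close> on \<open>\<pp> \<equiv> T\<^sub>o(G\<^sub>\<mu>/K\<^sub>\<mu>)\<close>, that is, \<open>\<langle>R X, Y\<rangle> = Rc(g\<^sub>\<mu>)(o)(X, Y)\<close>.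
  This does not depend on the choice of the model \<open>M\<close> of \<open>(G\<^sub>\<mu>/K\<^sub>\<mu>, g\<^sub>\<mu>)\<close>.
\<close>

definition is_ricci_operator ::
  "'g::euclidean_space set \<Rightarrow> ('p::euclidean_space \<Rightarrow> 'g) \<Rightarrow> 'g bilin_map \<Rightarrow> ('p \<Rightarrow> 'p) \<Rightarrow> bool" where
  "is_ricci_operator k j \<mu> R \<longleftrightarrow>
     linear R \<and>
     (\<exists>M. is_hom_space_of k j \<mu> M \<and>
        (\<forall>X Y. R X \<bullet> Y =
           ricci_tensor (quot_atlas M) (metric M) (isotropy M)
             (to_tangent M (j X)) (to_tangent M (j Y))))"

definition isometric_brackets ::
  "'g::euclidean_space set \<Rightarrow> ('p::euclidean_space \<Rightarrow> 'g) \<Rightarrow> 'g bilin_map \<Rightarrow> 'g bilin_map \<Rightarrow> bool" where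
  "isometric_brackets k j \<mu> \<nu> \<longleftrightarrow>
     (\<exists>M N f. is_hom_space_of k j \<mu> M \<and> is_hom_space_of k j \<nu> N \<and>
        isometry (quot_atlas M) (metric M) (quot_atlas N) (metric N) f)"

definition isometry_invariant ::
  "'g::euclidean_space set \<Rightarrow> ('p::euclidean_space \<Rightarrow> 'g) \<Rightarrow> ('g bilin_map \<Rightarrow> real) \<Rightarrow> bool" where
  "isometry_invariant k j F \<longleftrightarrow>
     (\<forall>\<mu>\<in>hom_brackets k j. \<forall>\<nu>\<in>hom_brackets k j. isometric_brackets k j \<mu> \<nu> \<longrightarrow> F \<mu> = F \<nu>)"

definition scaling_invariant ::
  "'g::euclidean_space set \<Rightarrow> ('p::euclidean_space \<Rightarrow> 'g) \<Rightarrow> ('g bilin_map \<Rightarrow> real) \<Rightarrow> bool" where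
  "scaling_invariant k j F \<longleftrightarrow>
     (\<exists>d::real. d \<noteq> 0 \<and> (\<forall>a>0. \<forall>\<mu>\<in>hom_brackets k j. F (rescale k j a \<mu>) = a powr d * F \<mu>))"


section \<open>Semi-algebraic solitons and the normalized bracket flow\<close>

definition lie_automorphism ::
  "'m monoid \<Rightarrow> ('m, 'e::euclidean_space) chart set \<Rightarrow> ('m \<Rightarrow> 'm) \<Rightarrow> bool" where
  "lie_automorphism G A \<phi> \<longleftrightarrow> \<phi> \<in> iso G G \<and> diffeo A A \<phi>"

definition ricci_flow_on ::
  "('m, 'e::euclidean_space) chart set \<Rightarrow> real set \<Rightarrow> (real \<Rightarrow> 'm \<Rightarrow> 'e \<Rightarrow> 'e \<Rightarrow> real) \<Rightarrow> bool" where
  "ricci_flow_on A T g \<longleftrightarrow>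
     (\<forall>t\<in>T. riemannian_metric A (g t) \<and>
        (\<forall>p\<in>points A. \<forall>v w.
           ((\<lambda>s. g s p v w) has_real_derivative - 2 * ricci_tensor A (g t) p v w) (at t)))"

text \<open>
  The automorphism \<open>\<phi> t\<close> of \<open>G\<close> induces on \<open>G/K\<close> the diffeomorphism \<open>C \<mapsto> \<phi> t ` C\<close>. The flow
  \<open>g(t) = c(t) \<phi>\<^sub>t\<^sup>* g\<close> is required on some open interval around \<open>0\<close>.
\<close>

definition semi_algebraic_soliton ::
  "('g::euclidean_space, 'p::euclidean_space) hom_space \<Rightarrow> bool" where
  "semi_algebraic_soliton M \<longleftrightarrow>
     (\<exists>T (\<phi> :: real \<Rightarrow> point \<Rightarrow> point) (c :: real \<Rightarrow> real).
        let B = quot_atlas M;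
            g = (\<lambda>t p v w. c t * metric M (\<phi> t ` p)
                   (mderiv B B (image (\<phi> t)) p v) (mderiv B B (image (\<phi> t)) p w))
        in open T \<and> is_interval T \<and> 0 \<in> T \<and>
           smooth_map (prod_atlas (open_atlas T) (grp_atlas M)) (grp_atlas M) (\<lambda>(t, x). \<phi> t x) \<and>
           (\<forall>t\<in>T. lie_automorphism (grp M) (grp_atlas M) (\<phi> t) \<and>
                  \<phi> t ` isotropy M = isotropy M \<and> c t > 0) \<and>
           (\<forall>p\<in>points B. g 0 p = metric M p) \<and>
           ricci_flow_on B T g)"

text \<open>
  \<open>\<mu>\<close> is a solution on the interval \<open>J\<close> of the normalized bracket flow starting at \<open>\<mu>\<^sub>0\<close>, the
  normalizing function being \<open>t \<mapsto> r t\<close> along the solution.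
\<close>

definition normalized_bracket_flow ::
  "'g::euclidean_space set \<Rightarrow> ('p::euclidean_space \<Rightarrow> 'g) \<Rightarrow> real set \<Rightarrow> (real \<Rightarrow> real) \<Rightarrow>
   'g bilin_map \<Rightarrow> (real \<Rightarrow> 'g bilin_map) \<Rightarrow> bool" where
  "normalized_bracket_flow k j J r \<mu>\<^sub>0 \<mu> \<longleftrightarrow>
     is_interval J \<and> 0 \<in> J \<and> continuous_on J r \<and> \<mu> 0 = \<mu>\<^sub>0 \<and>
     (\<forall>t\<in>J. \<mu> t \<in> hom_brackets k j \<and>
        (\<exists>R. is_ricci_operator k j (\<mu> t) R \<and>
           (\<mu> has_vector_derivative
              - pi_rep (block_diag k j (\<lambda>_. 0) (\<lambda>X. R X + r t *\<^sub>R X)) (\<mu> t)) (at t within J)))"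

definition lin_exp :: "('a::real_normed_vector \<Rightarrow> 'a) \<Rightarrow> 'a \<Rightarrow> 'a" where
  "lin_exp L x = (\<Sum>i. (L ^^ i) x /\<^sub>R fact i)"

end

theory Submission
  imports Defs
begin

text \<open>
  \<^bold>\<open>Existence.\<close> As \<open>e\<^bsup>-tD\<^esup>\<close> is an automorphism of \<open>\<mu>\<^sub>0\<close>, the bracket \<open>\<mu>(t)\<close> is obtained from \<open>\<mu>\<^sub>0\<close> by a map which is
  the identity on \<open>\<kk>\<close> and induces the orthogonal map \<open>e\<^bsup>tA\<^esup>\<close> on \<open>\<gg>/\<kk>\<close>. So a model of \<open>(G/K, g)\<close> for \<open>\<mu>\<^sub>0\<close> is also a
  model for \<open>\<mu>(t)\<close>, with another identification of \<open>\<gg>\<close> with the tangent space of \<open>G\<close>. Hence \<open>F(\<mu>(t))\<close> is constant,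
  \<open>Ric\<close> is conjugated by \<open>e\<^bsup>tA\<^esup>\<close>, and the flow equation holds with \<open>r = -c\<close>.

  \<^bold>\<open>Uniqueness.\<close> Koszul's formula for the Killing fields generated by \<open>G\<close> expresses the Ricci operator as a
  polynomial in the bracket, so that solutions of the flow with a given \<open>r\<close> are unique. Therefore every normalized
  solution is a rescaled and reparametrized copy of \<open>\<mu>(t)\<close>, as long as the scaling factor exists. Scaling invariance
  of \<open>F\<close> forces this factor to be \<open>1\<close>.
\<close>

section \<open>Calculus\<close>

text \<open>The Ricci operator is defined through some model and some charts, so neither its
  uniqueness nor its dependence on the bracket is visible. G/K has in general no G-invariant frame,
  but the action provides fields on all of it, and invariance turns the derivative of their inner
  products along such a field into inner products again; this makes the curvature at the origin
  algebraic.

  A competitor in the uniqueness part comes with its own \<open>r\<close>, so it cannot be compared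
  with \<mu>(t) directly. It is compared with an explicit solution having the same \<open>r\<close>:
  a rescaling of \<mu> by a factor f with f'/f = r + c f^2, run at speed f^2. For w = 1/f^2 the
  equation is linear, so w exists on the whole time interval, whereas f may blow up where w reaches
  0.

  The off-diagonal block of D makes e^(tD) move p out of itself. For this reason a change of model
  is allowed to be any map that fixes k pointwise and is orthogonal modulo k.\<close>

lemma smooth_on_differentiable:
  assumes "smooth_on S f" "x \<in> S"
  shows "f differentiable (at x)"
  using assms unfolding smooth_on_def by (metis Ck_on.simps(2))

lemma smooth_on_has_derivative:
  assumes "smooth_on S f" "x \<in> S"
  shows "(f has_derivative frechet_derivative f (at x)) (at x)"
  using smooth_on_differentiable[OF assms] by (simp add: frechet_derivative_works)

lemma smooth_on_frechet_derivative:
  assumes "smooth_on S f"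
  shows "smooth_on S (\<lambda>x. frechet_derivative f (at x) v)"
  using assms unfolding smooth_on_def by (metis Ck_on.simps(2))

lemma Ck_on_cong:
  assumes "open S" "\<And>x. x \<in> S \<Longrightarrow> f x = g x" "Ck_on n S f"
  shows "Ck_on n S g"
  using assms
proof (induction n arbitrary: f g)
  case 0
  then show ?case using continuous_on_cong[of S S f g] by simp
next
  case (Suc n)
  have d: "(g has_derivative frechet_derivative f (at x)) (at x)" if "x \<in> S" for x
    using has_derivative_transform_within_open[of f "frechet_derivative f (at x)" x UNIV S g]
      that Suc.prems by (simp add: frechet_derivative_works[symmetric])
  then have e: "frechet_derivative f (at x) = frechet_derivative g (at x)" if "x \<in> S" for x
    using that frechet_derivative_at by blast
  show ?case
    using d Suc.IH[OF Suc.prems(1), of "\<lambda>x. frechet_derivative f (at x) v"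
        "\<lambda>x. frechet_derivative g (at x) v" for v] e Suc.prems(3)
    by (auto simp: differentiable_def)
qed

lemma smooth_on_cong:
  assumes "open S" "\<And>x. x \<in> S \<Longrightarrow> f x = g x" "smooth_on S f"
  shows "smooth_on S g"
  using assms Ck_on_cong unfolding smooth_on_def by blast

text \<open>Affine substitutions cover partial maps such as y |-> f (a, y). For them the induction
  closes, since the derivative of the composite along v is the derivative of f along the fixed
  vector \<open>L v\<close>, again composed with the affine map.\<close>

lemma Ck_on_affine:
  fixes L :: "'a::euclidean_space \<Rightarrow> 'b::euclidean_space"
  assumes "open T" "linear L" "\<And>y. y \<in> T \<Longrightarrow> p + L y \<in> S" "Ck_on n S f"
  shows "Ck_on n T (\<lambda>y. f (p + L y))"
  using assms(4)
proof (induction n arbitrary: f)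
  case 0
  have "continuous_on T (\<lambda>y. p + L y)"
    using assms(2) by (intro continuous_intros linear_continuous_on) (simp add: linear_conv_bounded_linear)
  then show ?case using 0 assms(3) by (auto intro!: continuous_on_compose2[of S f])
next
  case (Suc n)
  have d: "((\<lambda>y. f (p + L y)) has_derivative (\<lambda>v. frechet_derivative f (at (p + L y)) (L v))) (at y)"
    if "y \<in> T" for y
  proof -
    have 1: "((\<lambda>y. p + L y) has_derivative L) (at y)"
      using has_derivative_add[OF has_derivative_const linear_imp_has_derivative[OF assms(2)]] by simp
    have "(f has_derivative frechet_derivative f (at (p + L y))) (at (p + L y))"
      using Suc.prems assms(3) that by (simp add: frechet_derivative_works[symmetric])
    from has_derivative_compose[OF 1 this] show ?thesis .
  qed
  have e: "frechet_derivative (\<lambda>y. f (p + L y)) (at y) v = frechet_derivative f (at (p + L y)) (L v)"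
    if "y \<in> T" for y v
    using frechet_derivative_at[OF d[OF that]] by metis
  have "Ck_on n T (\<lambda>y. frechet_derivative f (at (p + L y)) (L v))" for v
    using Suc.IH[of "\<lambda>x. frechet_derivative f (at x) (L v)"] Suc.prems by simp
  then have "Ck_on n T (\<lambda>y. frechet_derivative (\<lambda>y. f (p + L y)) (at y) v)" for v
    by (rule Ck_on_cong[OF assms(1), rotated]) (simp add: e)
  then show ?case using d by (auto simp: differentiable_def)
qed

lemma smooth_on_affine:
  fixes L :: "'a::euclidean_space \<Rightarrow> 'b::euclidean_space"
  assumes "open T" "linear L" "\<And>y. y \<in> T \<Longrightarrow> p + L y \<in> S" "smooth_on S f"
  shows "smooth_on T (\<lambda>y. f (p + L y))"
  using assms Ck_on_affine unfolding smooth_on_def by metis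

lemma smooth_on_slice_left:
  fixes f :: "'a::euclidean_space \<times> 'b::euclidean_space \<Rightarrow> 'c::real_normed_vector"
  assumes "open T" "\<And>x. x \<in> T \<Longrightarrow> (x, b) \<in> S" "smooth_on S f"
  shows "smooth_on T (\<lambda>x. f (x, b))"
proof -
  have "linear (\<lambda>x. (x, 0) :: 'a \<times> 'b)" by (auto intro!: linearI)
  from smooth_on_affine[OF assms(1) this, of "(0, b)" S f] assms show ?thesis by simp
qed

lemma smooth_on_slice_right:
  fixes f :: "'a::euclidean_space \<times> 'b::euclidean_space \<Rightarrow> 'c::real_normed_vector"
  assumes "open T" "\<And>y. y \<in> T \<Longrightarrow> (a, y) \<in> S" "smooth_on S f"
  shows "smooth_on T (\<lambda>y. f (a, y))"
proof -
  have "linear (\<lambda>y. (0, y) :: 'a \<times> 'b)" by (auto intro!: linearI)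
  from smooth_on_affine[OF assms(1) this, of "(a, 0)" S f] assms show ?thesis by simp
qed

subsection \<open>Symmetry of second derivatives\<close>

lemma smooth_on_line_derivative:
  assumes "smooth_on S f" "q + s *\<^sub>R u \<in> S"
  shows "((\<lambda>s. f (q + s *\<^sub>R u)) has_vector_derivative frechet_derivative f (at (q + s *\<^sub>R u)) u) (at s within T)"
proof -
  note f = smooth_on_has_derivative[OF assms]
  have "((\<lambda>s. q + s *\<^sub>R u) has_derivative (\<lambda>r. r *\<^sub>R u)) (at s)"
    by (auto intro!: derivative_eq_intros)
  from has_derivative_compose[OF this f] show ?thesis
    unfolding has_vector_derivative_def linear_scale[OF has_derivative_linear[OF f]]
    by (rule has_derivative_at_withinI)
qed

text \<open>Differentiation under the integral sign: the increment of f in the direction u is the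
  integral of its derivative along u. Its derivative along v at \<open>t = 0\<close> expresses the
  increment of the v-derivative as an integral of the mixed derivative, and differentiating this in
  s at 0 leaves the two mixed derivatives.\<close>

lemma smooth_on_second_derivative_symmetric:
  fixes f :: "'a::euclidean_space \<Rightarrow> 'b::euclidean_space"
  assumes S: "open S" "x \<in> S" and f: "smooth_on S f"
  shows "frechet_derivative (\<lambda>y. frechet_derivative f (at y) u) (at x) v
       = frechet_derivative (\<lambda>y. frechet_derivative f (at y) v) (at x) u"
proof -
  define F where "F w y = frechet_derivative f (at y) w" for w y
  define FF where "FF w w' y = frechet_derivative (F w) (at y) w'" for w w' y
  have sF: "smooth_on S (F w)" "smooth_on S (FF w w')" for w w'
    unfolding F_def[abs_def] FF_def[abs_def] by (intro smooth_on_frechet_derivative f)+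
  define p where "p s t = x + s *\<^sub>R u + t *\<^sub>R v" for s t
  have p: "p s t = (x + t *\<^sub>R v) + s *\<^sub>R u" for s t by (simp add: p_def)
  obtain d where d: "d > 0" "ball x d \<subseteq> S" using S open_contains_ball by blast
  \<comment> \<open>The parallelogram with sides \<epsilon> u and \<epsilon> v must stay in the ball
    of radius d; the summand 1 keeps the denominator positive when u = v = 0.\<close>
  define \<epsilon> where "\<epsilon> = d / (norm u + norm v + 1)"
  have pos: "norm u + norm v + 1 > 0" by (simp add: add_nonneg_pos)
  have \<epsilon>: "\<epsilon> > 0" using d pos by (simp add: \<epsilon>_def)
  have inS: "p s t \<in> S" if "s \<in> {0..\<epsilon>}" "t \<in> {0..\<epsilon>}" for s t
  proof -
    have "norm (s *\<^sub>R u + t *\<^sub>R v) \<le> s * norm u + t * norm v"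
      using norm_triangle_ineq[of "s *\<^sub>R u" "t *\<^sub>R v"] that by simp
    also have "\<dots> \<le> \<epsilon> * norm u + \<epsilon> * norm v" using that by (intro add_mono mult_right_mono) auto
    also have "\<dots> < \<epsilon> * (norm u + norm v + 1)" using \<epsilon> by (simp add: distrib_left)
    also have "\<dots> = d" using pos by (simp add: \<epsilon>_def)
    finally show ?thesis
      using d(2) by (auto simp: p_def subset_iff dist_norm norm_minus_commute add.assoc)
  qed
  have ds: "((\<lambda>s. g (p s t)) has_vector_derivative frechet_derivative g (at (p s t)) u) (at s within T)"
    and dt: "((\<lambda>t. g (p s t)) has_vector_derivative frechet_derivative g (at (p s t)) v) (at t within T)"
    if "smooth_on S g" "s \<in> {0..\<epsilon>}" "t \<in> {0..\<epsilon>}" for s t T and g :: "'a \<Rightarrow> 'b"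
    using smooth_on_line_derivative[OF that(1), of "x + t *\<^sub>R v" s u T]
      smooth_on_line_derivative[OF that(1), of "x + s *\<^sub>R u" t v T] inS[OF that(2,3)]
    by (simp_all add: p_def add_ac)
  have cont: "continuous_on ({0..\<epsilon>} \<times> {0..\<epsilon>}) (\<lambda>(t, s). FF u v (p s t))"
  proof -
    have "continuous_on S (FF u v)"
      using sF(2) unfolding smooth_on_def by (metis Ck_on.simps(1))
    moreover have "continuous_on ({0..\<epsilon>} \<times> {0..\<epsilon>}) (\<lambda>z. p (snd z) (fst z))"
      unfolding p_def by (intro continuous_intros)
    ultimately show ?thesis
      unfolding case_prod_unfold by (rule continuous_on_compose2) (auto simp: inS)
  qed
  have I: "F v (p s 0) - F v (p 0 0) = integral {0..s} (\<lambda>\<sigma>. FF u v (p \<sigma> 0))" if s: "s \<in> {0..\<epsilon>}" for s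
  proof -
    have FTC: "((\<lambda>\<sigma>. F u (p \<sigma> t)) has_integral f (p s t) - f (p 0 t)) {0..s}" if "t \<in> {0..\<epsilon>}" for t
      using s that ds[OF f] unfolding F_def by (intro fundamental_theorem_of_calculus) auto
    have "((\<lambda>t. integral (cbox 0 s) (\<lambda>\<sigma>. F u (p \<sigma> t))) has_vector_derivative
        integral (cbox 0 s) (\<lambda>\<sigma>. FF u v (p \<sigma> 0))) (at 0 within {0..\<epsilon>})"
    proof (rule leibniz_rule_vector_derivative)
      show "((\<lambda>t. F u (p \<sigma> t)) has_vector_derivative FF u v (p \<sigma> t)) (at t within {0..\<epsilon>})"
        if "t \<in> {0..\<epsilon>}" "\<sigma> \<in> cbox 0 s" for t \<sigma>
        unfolding FF_def using dt[OF sF(1)] that s by auto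
      show "(\<lambda>\<sigma>. F u (p \<sigma> t)) integrable_on cbox 0 s" if "t \<in> {0..\<epsilon>}" for t
        using FTC[OF that] by auto
      show "continuous_on ({0..\<epsilon>} \<times> cbox 0 s) (\<lambda>(t, \<sigma>). FF u v (p \<sigma> t))"
        using s by (intro continuous_on_subset[OF cont]) auto
    qed (use \<epsilon> in auto)
    from this[unfolded cbox_interval] have "((\<lambda>t. f (p s t) - f (p 0 t)) has_vector_derivative
        integral {0..s} (\<lambda>\<sigma>. FF u v (p \<sigma> 0))) (at 0 within {0..\<epsilon>})"
      by (rule has_vector_derivative_transform[rotated 2]) (use \<epsilon> integral_unique[OF FTC] in auto)
    moreover have "((\<lambda>t. f (p s t) - f (p 0 t)) has_vector_derivative F v (p s 0) - F v (p 0 0)) (at 0 within {0..\<epsilon>})"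
      unfolding F_def using s \<epsilon> by (intro has_vector_derivative_diff dt f) auto
    ultimately show ?thesis
      using vector_derivative_unique_within_closed_interval[of 0 \<epsilon> 0] \<epsilon> by (simp add: box_real)
  qed
  have "continuous_on {0..\<epsilon>} (\<lambda>\<sigma>. FF u v (p \<sigma> 0))"
  proof -
    have "continuous_on {0..\<epsilon>} (\<lambda>\<sigma>::real. (0::real, \<sigma>))" by (intro continuous_intros)
    moreover have "(\<lambda>\<sigma>. (0, \<sigma>)) ` {0..\<epsilon>} \<subseteq> {0..\<epsilon>} \<times> {0..\<epsilon>}" using \<epsilon> by auto
    ultimately have "continuous_on {0..\<epsilon>} (\<lambda>\<sigma>. case (0, \<sigma>) of (t, s) \<Rightarrow> FF u v (p s t))"
      by (rule continuous_on_compose2[OF cont])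
    then show ?thesis by simp
  qed
  from integral_has_vector_derivative[OF this, of 0]
  have "((\<lambda>s. F v (p s 0) - F v (p 0 0)) has_vector_derivative FF u v (p 0 0)) (at 0 within {0..\<epsilon>})"
    by (rule has_vector_derivative_transform[rotated 2]) (use \<epsilon> I in auto)
  moreover have "((\<lambda>s. F v (p s 0) - F v (p 0 0)) has_vector_derivative FF v u (p 0 0) - 0) (at 0 within {0..\<epsilon>})"
    unfolding FF_def using \<epsilon> by (intro has_vector_derivative_diff has_vector_derivative_const ds sF) auto
  ultimately have "FF u v (p 0 0) = FF v u (p 0 0)"
    using vector_derivative_unique_within_closed_interval[of 0 \<epsilon> 0] \<epsilon> by (simp add: box_real)
  then show ?thesis by (simp add: p_def FF_def F_def[abs_def])
qed

subsection \<open>Families of bilinear and linear maps\<close>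

lemma bilinear_sum_Basis:
  fixes B :: "'a::euclidean_space \<Rightarrow> 'b::euclidean_space \<Rightarrow> 'c::real_vector"
  assumes "bilinear B"
  shows "B v w = (\<Sum>a\<in>Basis. \<Sum>b\<in>Basis. ((v \<bullet> a) * (w \<bullet> b)) *\<^sub>R B a b)"
proof -
  have l1: "linear (\<lambda>v. B v w)" for w using assms by (simp add: bilinear_def)
  have l2: "linear (B v)" for v using assms by (simp add: bilinear_def)
  have "B v w = B (\<Sum>a\<in>Basis. (v \<bullet> a) *\<^sub>R a) (\<Sum>b\<in>Basis. (w \<bullet> b) *\<^sub>R b)"
    by (simp add: euclidean_representation)
  also have "\<dots> = (\<Sum>a\<in>Basis. (v \<bullet> a) *\<^sub>R B a (\<Sum>b\<in>Basis. (w \<bullet> b) *\<^sub>R b))"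
    by (simp add: linear_sum[OF l1] linear_scale[OF l1])
  also have "\<dots> = (\<Sum>a\<in>Basis. \<Sum>b\<in>Basis. ((v \<bullet> a) * (w \<bullet> b)) *\<^sub>R B a b)"
    by (simp add: linear_sum[OF l2] linear_scale[OF l2] scaleR_sum_right)
  finally show ?thesis .
qed

lemma bilinear_derivative_family:
  assumes S: "open S" "x \<in> S" "\<And>y. y \<in> S \<Longrightarrow> bilinear (B y)"
    and B: "\<And>v w. ((\<lambda>y. B y v w) has_derivative B' v w) (at x)"
  shows "bilinear (\<lambda>v w. B' v w d)"
proof -
  have tr: "f' d = g' d"
    if "(f has_derivative f') (at x)" "(g has_derivative g') (at x)" "\<And>y. y \<in> S \<Longrightarrow> f y = g y" for f g f' g'
    using has_derivative_transform_within_open[OF that(1) S(1,2) that(3)] that(2) has_derivative_unique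
    by metis
  have "B' (v1 + v2) w d = B' v1 w d + B' v2 w d" for v1 v2 w
    using tr[OF B has_derivative_add[OF B B]] S(3) by (simp add: bilinear_ladd)
  moreover have "B' v (w1 + w2) d = B' v w1 d + B' v w2 d" for v w1 w2
    using tr[OF B has_derivative_add[OF B B]] S(3) by (simp add: bilinear_radd)
  moreover have "B' (c *\<^sub>R v) w d = c *\<^sub>R B' v w d" for c v w
    using tr[OF B has_derivative_scaleR_right[OF B]] S(3) by (simp add: bilinear_lmul)
  moreover have "B' v (c *\<^sub>R w) d = c *\<^sub>R B' v w d" for c v w
    using tr[OF B has_derivative_scaleR_right[OF B]] S(3) by (simp add: bilinear_rmul)
  ultimately show ?thesis unfolding bilinear_def by (auto intro!: linearI)
qed

text \<open>The metric and the Christoffel symbols occur as families whose values at fixed vectors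
  are known to be differentiable, not as maps into a normed space of bilinear maps. Expansion in the
  standard bases reduces the product rule to finitely many products of scalars with such
  values.\<close>

lemma has_derivative_bilinear_family_within:
  fixes B :: "'x::real_normed_vector \<Rightarrow> 'a::euclidean_space \<Rightarrow> 'b::euclidean_space \<Rightarrow> 'c::real_normed_vector"
  assumes "x \<in> T"
    and ev: "\<forall>\<^sub>F y in at x within T. bilinear (B y)" and Bx: "bilinear (B x)"
    and B: "\<And>v w. ((\<lambda>y. B y v w) has_derivative B' v w) (at x within T)"
    and B': "\<And>d. bilinear (\<lambda>v w. B' v w d)"
    and Y: "(Y has_derivative Y') (at x within T)" and Z: "(Z has_derivative Z') (at x within T)"
  shows "((\<lambda>y. B y (Y y) (Z y)) has_derivative
           (\<lambda>d. B' (Y x) (Z x) d + B x (Y' d) (Z x) + B x (Y x) (Z' d))) (at x within T)"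
proof -
  have "((\<lambda>y. \<Sum>a\<in>Basis. \<Sum>b\<in>Basis. ((Y y \<bullet> a) * (Z y \<bullet> b)) *\<^sub>R B y a b) has_derivative
     (\<lambda>d. \<Sum>a\<in>Basis. \<Sum>b\<in>Basis. ((Y x \<bullet> a) * (Z x \<bullet> b)) *\<^sub>R B' a b d
        + ((Y x \<bullet> a) * (Z' d \<bullet> b) + (Y' d \<bullet> a) * (Z x \<bullet> b)) *\<^sub>R B x a b)) (at x within T)"
    by (intro has_derivative_sum has_derivative_scaleR has_derivative_mult has_derivative_inner_left Y Z B)
  also have "(\<lambda>d. \<Sum>a\<in>Basis. \<Sum>b\<in>Basis. ((Y x \<bullet> a) * (Z x \<bullet> b)) *\<^sub>R B' a b d
        + ((Y x \<bullet> a) * (Z' d \<bullet> b) + (Y' d \<bullet> a) * (Z x \<bullet> b)) *\<^sub>R B x a b)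
      = (\<lambda>d. B' (Y x) (Z x) d + B x (Y' d) (Z x) + B x (Y x) (Z' d))" (is "?l = ?r")
  proof (rule ext)
    show "?l d = ?r d" for d
      using bilinear_sum_Basis[OF B'[of d], of "Y x" "Z x"] bilinear_sum_Basis[OF Bx, of "Y' d" "Z x"]
        bilinear_sum_Basis[OF Bx, of "Y x" "Z' d"]
      by (simp add: scaleR_add_left sum.distrib)
  qed
  finally have *: "((\<lambda>y. \<Sum>a\<in>Basis. \<Sum>b\<in>Basis. ((Y y \<bullet> a) * (Z y \<bullet> b)) *\<^sub>R B y a b) has_derivative
     (\<lambda>d. B' (Y x) (Z x) d + B x (Y' d) (Z x) + B x (Y x) (Z' d))) (at x within T)" .
  have ev2: "\<forall>\<^sub>F y in at x within T. (\<Sum>a\<in>Basis. \<Sum>b\<in>Basis. ((Y y \<bullet> a) * (Z y \<bullet> b)) *\<^sub>R B y a b) = B y (Y y) (Z y)"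
    using ev by eventually_elim (simp add: bilinear_sum_Basis[symmetric])
  show ?thesis
    by (rule has_derivative_transform_eventually[OF * ev2])
       (simp_all add: bilinear_sum_Basis[OF Bx, symmetric] \<open>x \<in> T\<close>)
qed

lemma has_derivative_bilinear_family:
  fixes B :: "'x::real_normed_vector \<Rightarrow> 'a::euclidean_space \<Rightarrow> 'b::euclidean_space \<Rightarrow> 'c::real_normed_vector"
  assumes S: "open S" "x \<in> S" "\<And>y. y \<in> S \<Longrightarrow> bilinear (B y)"
    and B: "\<And>v w. ((\<lambda>y. B y v w) has_derivative B' v w) (at x)"
    and Y: "(Y has_derivative Y') (at x)" and Z: "(Z has_derivative Z') (at x)"
  shows "((\<lambda>y. B y (Y y) (Z y)) has_derivative
           (\<lambda>d. B' (Y x) (Z x) d + B x (Y' d) (Z x) + B x (Y x) (Z' d))) (at x)"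
proof -
  have "\<forall>\<^sub>F y in at x. bilinear (B y)"
    using eventually_at_topological[of "\<lambda>y. bilinear (B y)" x UNIV] S by auto
  from has_derivative_bilinear_family_within[OF UNIV_I this S(3)[OF S(2)] B bilinear_derivative_family[OF S B] Y Z]
  show ?thesis .
qed

text \<open>A linear family becomes a bilinear one by a scalar argument that is then kept at 1; the
  product rule for linear families is thus a special case.\<close>

lemma bilinear_scaleR_linear: "linear K \<Longrightarrow> bilinear (\<lambda>v (w::real). w *\<^sub>R K v)"
  unfolding bilinear_def by (auto intro!: linearI simp: linear_add linear_scale algebra_simps)

lemma has_derivative_linear_family_within:
  fixes L :: "'x::real_normed_vector \<Rightarrow> 'a::euclidean_space \<Rightarrow> 'c::real_normed_vector"
  assumes "x \<in> T"
    and lin: "\<And>y. linear (L y)"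
    and L: "\<And>v. ((\<lambda>y. L y v) has_derivative L' v) (at x within T)"
    and L': "\<And>d. linear (\<lambda>v. L' v d)"
    and Y: "(Y has_derivative Y') (at x within T)"
  shows "((\<lambda>y. L y (Y y)) has_derivative (\<lambda>d. L' (Y x) d + L x (Y' d))) (at x within T)"
proof -
  have "((\<lambda>y. (1::real) *\<^sub>R L y (Y y)) has_derivative
      (\<lambda>d. (1::real) *\<^sub>R L' (Y x) d + (1::real) *\<^sub>R L x (Y' d) + (0::real) *\<^sub>R L x (Y x))) (at x within T)"
    by (rule has_derivative_bilinear_family_within[where B="\<lambda>y v (w::real). w *\<^sub>R L y v" and Z="\<lambda>_. 1" and Z'="\<lambda>_. 0"
          and B'="\<lambda>v w d. w *\<^sub>R L' v d"])
       (auto intro!: bilinear_scaleR_linear lin L' L Y has_derivative_scaleR_right always_eventually \<open>x \<in> T\<close>)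
  then show ?thesis by simp
qed

lemma has_derivative_linear_family:
  fixes L :: "'x::real_normed_vector \<Rightarrow> 'a::euclidean_space \<Rightarrow> 'c::real_normed_vector"
  assumes S: "open S" "x \<in> S" "\<And>y. y \<in> S \<Longrightarrow> linear (L y)"
    and L: "\<And>v. ((\<lambda>y. L y v) has_derivative L' v) (at x)"
    and Y: "(Y has_derivative Y') (at x)"
  shows "((\<lambda>y. L y (Y y)) has_derivative (\<lambda>d. L' (Y x) d + L x (Y' d))) (at x)"
proof -
  have "((\<lambda>y. (1::real) *\<^sub>R L y (Y y)) has_derivative
      (\<lambda>d. (1::real) *\<^sub>R L' (Y x) d + (1::real) *\<^sub>R L x (Y' d) + (0::real) *\<^sub>R L x (Y x))) (at x)"
    by (rule has_derivative_bilinear_family[OF S(1,2), where B="\<lambda>y v (w::real). w *\<^sub>R L y v" and Z="\<lambda>_. 1"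
          and Z'="\<lambda>_. 0" and B'="\<lambda>v w d. w *\<^sub>R L' v d"])
       (auto intro!: bilinear_scaleR_linear S L Y has_derivative_scaleR_right)
  then show ?thesis by simp
qed

section \<open>Linear equations with a nondegenerate form depending on a point\<close>

definition riesz :: "('b::euclidean_space \<Rightarrow> 'b \<Rightarrow> real) \<Rightarrow> 'b \<Rightarrow> 'b" where
  "riesz B v = (\<Sum>b\<in>Basis. B v b *\<^sub>R b)"

lemma riesz_inner:
  assumes "bilinear B"
  shows "riesz B v \<bullet> z = B v z"
proof -
  have l: "linear (B v)" using assms by (simp add: bilinear_def)
  have "B v z = B v (\<Sum>b\<in>Basis. (z \<bullet> b) *\<^sub>R b)" by (simp add: euclidean_representation)
  also have "\<dots> = riesz B v \<bullet> z"
    by (simp add: riesz_def linear_sum[OF l] linear_scale[OF l] inner_sum_left inner_commute[of z] mult.commute)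
  finally show ?thesis by simp
qed

lemma linear_riesz: "bilinear B \<Longrightarrow> linear (riesz B)"
  unfolding riesz_def
  by (intro linearI) (simp_all add: bilinear_ladd bilinear_lmul sum.distrib scaleR_add_left scaleR_sum_right)

lemma inj_riesz:
  assumes "bilinear B" "\<And>u. (\<And>z. B u z = 0) \<Longrightarrow> u = 0"
  shows "inj (riesz B)"
  using assms(2) riesz_inner[OF assms(1)]
  by (subst linear_injective_0[OF linear_riesz[OF assms(1)]]) (metis inner_zero_left)

text \<open>Made for the Christoffel symbols, which are given only as the solution of a linear
  system; no continuity of \<open>u\<close> is presupposed. With \<open>T y\<close> the matrix of
  \<open>h y\<close>, the increment \<open>e y = u y - u x\<close> solves
  \<open>T y (e y) = g y\<close>, where g is differentiable and vanishes at x. A left inverse G of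
  \<open>T x\<close> suggests that e equals G g to first order. The error is G (T y - T x) e up to
  sign, which is small because \<open>T y\<close> tends to \<open>T x\<close> and \<open>e y\<close>
  turns out to be O(|y - x|).\<close>

lemma bilinear_solution_differentiable:
  fixes h :: "'x::real_normed_vector \<Rightarrow> 'b::euclidean_space \<Rightarrow> 'b \<Rightarrow> real"
  assumes S: "open S" "x \<in> S" "\<And>y. y \<in> S \<Longrightarrow> bilinear (h y)"
    and nondeg: "\<And>u. (\<And>z. h x u z = 0) \<Longrightarrow> u = 0"
    and h: "\<And>v w. (\<lambda>y. h y v w) differentiable (at x)"
    and f: "\<And>z. (\<lambda>y. f y z) differentiable (at x)"
    and u: "\<And>y z. y \<in> S \<Longrightarrow> h y (u y) z = f y z"
  shows "u differentiable (at x)"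
proof -
  define T where "T y = riesz (h y)" for y
  have linT: "linear (T y)" if "y \<in> S" for y unfolding T_def by (rule linear_riesz[OF S(3)[OF that]])
  have "inj (T x)" unfolding T_def by (rule inj_riesz[OF S(3)[OF S(2)] nondeg])
  then obtain G where G: "linear G" "G \<circ> T x = id"
    using linear_injective_left_inverse[OF linT[OF S(2)]] by blast
  obtain K where K: "K > 0" "\<And>v. norm (G v) \<le> norm v * K"
    using G(1) bounded_linear.pos_bounded by (auto simp: linear_conv_bounded_linear)
  define e where "e y = u y - u x" for y
  define g where "g y = (\<Sum>b\<in>Basis. (f y b - h y (u x) b) *\<^sub>R b)" for y
  have Te: "T y (e y) = g y" if "y \<in> S" for y
    using u[OF that] S(3)[OF that] by (simp add: T_def riesz_def g_def e_def bilinear_lsub)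
  have gx: "g x = 0" using Te[OF S(2)] linT[OF S(2)] by (simp add: e_def linear_0)
  have "g differentiable (at x)"
    unfolding g_def
  proof (intro differentiable_sum ballI)
    fix b :: 'b
    have "(\<lambda>y. f y b - h y (u x) b) differentiable (at x)" by (intro differentiable_diff f h)
    then show "(\<lambda>y. (f y b - h y (u x) b) *\<^sub>R b) differentiable (at x)"
      unfolding differentiable_def using has_derivative_scaleR_left by blast
  qed simp
  then obtain g' where g': "(g has_derivative g') (at x)" unfolding differentiable_def by blast
  \<comment> \<open>Entrywise bound for the norm of \<open>T y - T x\<close>; it tends to 0 at x
    because every entry of \<open>h\<close> is continuous there.\<close>
  define E where "E y = (\<Sum>a\<in>Basis. \<Sum>b\<in>Basis. \<bar>h y a b - h x a b\<bar>)" for y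
  have E: "norm (T y v - T x v) \<le> E y * norm v" if "y \<in> S" for y v
  proof -
    have 1: "h y v b - h x v b = (\<Sum>a\<in>Basis. (v \<bullet> a) * (h y a b - h x a b))" for b
    proof -
      have "h z v b = (\<Sum>a\<in>Basis. (v \<bullet> a) * h z a b)" if "z \<in> S" for z
      proof -
        have l: "linear (\<lambda>v. h z v b)" using S(3)[OF that] by (simp add: bilinear_def)
        have "h z v b = h z (\<Sum>b\<in>Basis. (v \<bullet> b) *\<^sub>R b) b" by (simp add: euclidean_representation)
        then show ?thesis by (simp add: linear_sum[OF l] linear_scale[OF l])
      qed
      then show ?thesis using that S(2) by (simp add: sum_subtractf algebra_simps)
    qed
    have "norm (T y v - T x v) = norm (\<Sum>b\<in>Basis. (h y v b - h x v b) *\<^sub>R b)"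
      by (simp add: T_def riesz_def sum_subtractf algebra_simps)
    also have "\<dots> \<le> (\<Sum>b\<in>Basis. \<bar>h y v b - h x v b\<bar>)"
      by (rule order_trans[OF norm_sum]) simp
    also have "\<dots> \<le> (\<Sum>b\<in>Basis. \<Sum>a\<in>Basis. \<bar>h y a b - h x a b\<bar> * norm v)"
    proof (rule sum_mono)
      fix b :: 'b assume "b \<in> Basis"
      show "\<bar>h y v b - h x v b\<bar> \<le> (\<Sum>a\<in>Basis. \<bar>h y a b - h x a b\<bar> * norm v)"
        unfolding 1
        by (rule order_trans[OF sum_abs], rule sum_mono)
           (metis abs_ge_zero abs_mult Basis_le_norm mult.commute mult_left_mono)
    qed
    also have "\<dots> = E y * norm v"
      unfolding E_def by (subst sum.swap) (simp add: sum_distrib_right)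
    finally show ?thesis .
  qed
  have "isCont E x"
    unfolding E_def using h differentiable_imp_continuous_within by (intro continuous_intros) blast+
  then have Elim: "(E \<longlongrightarrow> 0) (at x)" by (simp add: isCont_def E_def)
  have e_eq: "e y - G (g y) = - G (T y (e y) - T x (e y))" if "y \<in> S" for y
  proof -
    have "G (T x (e y)) = e y" using G(2) by (metis comp_apply id_apply)
    then show ?thesis by (simp add: linear_diff[OF G(1)] Te[OF that])
  qed
  have rho: "norm (e y - G (g y)) \<le> K * E y * norm (e y)" if "y \<in> S" for y
  proof -
    have "norm (e y - G (g y)) \<le> norm (T y (e y) - T x (e y)) * K"
      using K(2) by (simp add: e_eq[OF that])
    also have "\<dots> \<le> E y * norm (e y) * K" using E[OF that] K(1) by (intro mult_right_mono) auto
    finally show ?thesis by (simp add: algebra_simps)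
  qed
  obtain C where C: "C > 0" "\<And>v. norm (g' v) \<le> norm v * C"
    using has_derivative_bounded_linear[OF g'] bounded_linear.pos_bounded by blast
  have ev1: "\<forall>\<^sub>F y in at x. y \<in> S"
    using S(1,2) eventually_at_topological by blast
  have ev2: "\<forall>\<^sub>F y in at x. E y < 1 / (2 * K)"
    using order_tendstoD(2)[OF Elim, of "1 / (2 * K)"] K(1) by simp
  have "((\<lambda>y. norm (g y - g x - g' (y - x)) / norm (y - x)) \<longlongrightarrow> 0) (at x)"
    using g' has_derivative_iff_norm by blast
  then have ev3: "\<forall>\<^sub>F y in at x. norm (g y - g x - g' (y - x)) / norm (y - x) < 1"
    using order_tendstoD(2) zero_less_one by blast
  have ev4: "\<forall>\<^sub>F y in at x. y \<noteq> x" by (simp add: eventually_at_filter)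
  have ev5: "\<forall>\<^sub>F y in at x. norm (norm (e y - G (g y)) / norm (y - x)) \<le> norm (E y) * (2 * K\<^sup>2 * (1 + C))"
    using ev1 ev2 ev3 ev4
  proof eventually_elim
    case (elim y)
    have gy: "norm (g y) \<le> (1 + C) * norm (y - x)"
    proof -
      have "norm (g y) \<le> norm (g y - g x - g' (y - x)) + norm (g' (y - x))"
        using norm_triangle_sub[of "g y" "g' (y - x)"] by (simp add: gx)
      also have "\<dots> \<le> norm (y - x) + norm (y - x) * C"
        using elim(3,4) C(2)[of "y - x"] by (simp add: divide_less_eq)
      finally show ?thesis by (simp add: algebra_simps)
    qed
    have E0: "E y \<ge> 0" by (simp add: E_def sum_nonneg)
    have "norm (e y) \<le> norm (G (g y)) + K * E y * norm (e y)"
      using norm_triangle_sub[of "e y" "G (g y)"] rho[OF elim(1)] by linarith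
    \<comment> \<open>Near x the factor \<open>K * E y\<close> is below 1/2, so the unknown
      \<open>norm (e y)\<close> on the right is absorbed into the left-hand side. This gives the a
      priori bound linear in \<open>norm (y - x)\<close>.\<close>
    moreover have "K * E y * norm (e y) \<le> 1/2 * norm (e y)"
      using elim(2) K(1) by (intro mult_right_mono) (auto simp: field_simps)
    ultimately have "norm (e y) \<le> 2 * norm (G (g y))" by linarith
    also have "\<dots> \<le> 2 * (norm (g y) * K)" using K(2)[of "g y"] by simp
    also have "\<dots> \<le> 2 * ((1 + C) * norm (y - x) * K)" using gy K(1) by simp
    finally have ey: "norm (e y) \<le> 2 * (1 + C) * K * norm (y - x)" by (simp add: algebra_simps)
    have "norm (e y - G (g y)) \<le> K * E y * (2 * (1 + C) * K * norm (y - x))"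
      using rho[OF elim(1)] ey K(1) E0 by (smt (verit) mult_left_mono mult_nonneg_nonneg)
    then have "norm (e y - G (g y)) / norm (y - x) \<le> K * E y * (2 * (1 + C) * K)"
      using elim(4) by (simp add: divide_le_eq algebra_simps)
    also have "\<dots> = E y * (2 * K\<^sup>2 * (1 + C))" by (simp add: algebra_simps power2_eq_square)
    finally show ?case using E0 by simp
  qed
  have "((\<lambda>y. norm (e y - G (g y)) / norm (y - x)) \<longlongrightarrow> 0) (at x)"
    using Elim ev5 by (rule tendsto_0_le)
  then have "((\<lambda>y. e y - G (g y)) has_derivative (\<lambda>_. 0)) (at x)"
    by (simp add: has_derivative_iff_norm e_def gx linear_0[OF G(1)])
  moreover have "((\<lambda>y. G (g y)) has_derivative (\<lambda>d. G (g' d))) (at x)"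
    using G(1) g' bounded_linear.has_derivative linear_conv_bounded_linear by blast
  ultimately have "((\<lambda>y. (e y - G (g y)) + G (g y) + u x) has_derivative (\<lambda>d. 0 + G (g' d) + 0)) (at x)"
    by (intro has_derivative_add has_derivative_const)
  then have "(u has_derivative (\<lambda>d. G (g' d))) (at x)" by (simp add: e_def)
  then show ?thesis unfolding differentiable_def by blast
qed

section \<open>Killing fields on an open subset of a Euclidean space\<close>

locale local_metric =
  fixes S :: "'p::euclidean_space set" and h :: "'p \<Rightarrow> 'p \<Rightarrow> 'p \<Rightarrow> real"
  assumes open_S: "open S"
    and smooth_h: "smooth_on S (\<lambda>y. h y v w)"
    and bilinear_h: "y \<in> S \<Longrightarrow> bilinear (h y)"
    and h_commute: "y \<in> S \<Longrightarrow> h y v w = h y w v"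
    and h_pos: "\<lbrakk>y \<in> S; v \<noteq> 0\<rbrakk> \<Longrightarrow> h y v v > 0"
begin

lemmas h_simps =
  bilinear_ladd[OF bilinear_h] bilinear_radd[OF bilinear_h] bilinear_lsub[OF bilinear_h]
  bilinear_rsub[OF bilinear_h] bilinear_lneg[OF bilinear_h] bilinear_rneg[OF bilinear_h]
  bilinear_lmul[OF bilinear_h] bilinear_rmul[OF bilinear_h] bilinear_lzero[OF bilinear_h]
  bilinear_rzero[OF bilinear_h]

lemma h_eqI:
  assumes "y \<in> S" "\<And>z. h y u z = h y v z"
  shows "u = v"
proof (rule ccontr)
  assume "u \<noteq> v"
  then have "h y (u - v) (u - v) > 0" using h_pos[OF assms(1)] by simp
  then show False using assms by (simp add: h_simps)
qed

lemma h_representation: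
  assumes "y \<in> S" "linear f"
  shows "\<exists>u. \<forall>z. h y u z = f z"
proof -
  note h = bilinear_h[OF assms(1)]
  have "inj (riesz (h y))"
    using h_eqI[OF assms(1), of _ 0] by (intro inj_riesz[OF h]) (simp add: h_simps assms(1))
  then have "surj (riesz (h y))" using linear_injective_imp_surjective[OF linear_riesz[OF h]] by simp
  then obtain u where "riesz (h y) u = adjoint f 1" by (metis surjD)
  then have "h y u z = f z" for z
    using riesz_inner[OF h, of u z] adjoint_works[OF assms(2), of z 1] by (simp add: inner_commute)
  then show ?thesis by blast
qed

section \<open>The Levi-Civita connection in a chart\<close>

definition dh :: "'p \<Rightarrow> 'p \<Rightarrow> 'p \<Rightarrow> 'p \<Rightarrow> real" where
  "dh y v w d = frechet_derivative (\<lambda>y. h y v w) (at y) d"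

lemma has_derivative_h: "y \<in> S \<Longrightarrow> ((\<lambda>y. h y v w) has_derivative dh y v w) (at y)"
  unfolding dh_def[abs_def] by (rule smooth_on_has_derivative[OF smooth_h])

lemma smooth_dh: "smooth_on S (\<lambda>y. dh y v w d)"
  unfolding dh_def by (rule smooth_on_frechet_derivative[OF smooth_h])

lemma linear_dh: "y \<in> S \<Longrightarrow> linear (dh y v w)"
  by (rule has_derivative_linear[OF has_derivative_h])

lemma bilinear_dh: "y \<in> S \<Longrightarrow> bilinear (\<lambda>v w. dh y v w d)"
  by (rule bilinear_derivative_family[where S=S and B=h and B'="dh y" and x=y])
     (auto intro: open_S bilinear_h has_derivative_h)

lemmas dh_simps =
  bilinear_ladd[OF bilinear_dh] bilinear_radd[OF bilinear_dh]
  bilinear_lmul[OF bilinear_dh] bilinear_rmul[OF bilinear_dh]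
  linear_add[OF linear_dh] linear_scale[OF linear_dh]

lemma dh_commute:
  assumes "y \<in> S"
  shows "dh y v w d = dh y w v d"
proof -
  have "((\<lambda>y. h y w v) has_derivative dh y v w) (at y)"
    by (rule has_derivative_transform_within_open[OF has_derivative_h[OF assms] open_S assms])
       (rule h_commute)
  then show ?thesis using has_derivative_h[OF assms] has_derivative_unique by metis
qed

abbreviation "\<Gamma> \<equiv> christoffel h"

text \<open>Justifies the definite description in \<open>christoffel\<close>: the right-hand side is
  linear in z, so nondegeneracy of \<open>h y\<close> gives exactly one representing vector.\<close>

lemma christoffel_eq:
  assumes "y \<in> S"
  shows "2 * h y (\<Gamma> y v w) z = dh y w z v + dh y v z w - dh y v w z"
proof -
  let ?f = "\<lambda>z. dh y w z v + dh y v z w - dh y v w z"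
  have "linear ?f"
    using assms by (intro linearI) (simp_all add: dh_simps algebra_simps)
  then have "linear (\<lambda>z. ?f z / 2)"
    by (simp add: linear_iff add_divide_distrib)
  from h_representation[OF assms this] obtain u where u: "\<And>z. h y u z = ?f z / 2" by blast
  have "\<exists>!u. \<forall>z. 2 * h y u z = ?f z"
  proof (rule ex1I[of _ u])
    show "\<forall>z. 2 * h y u z = ?f z" by (simp add: u)
  next
    fix u' assume "\<forall>z. 2 * h y u' z = ?f z"
    then have "2 * h y u' z = ?f z" for z by blast
    then have "h y u' z = h y u z" for z using u[of z] by (metis nonzero_mult_div_cancel_left zero_neq_numeral)
    then show "u' = u" by (rule h_eqI[OF assms])
  qed
  from theI'[OF this] show ?thesis unfolding christoffel_def dh_def by blast
qed

lemma bilinear_christoffel: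
  assumes "y \<in> S"
  shows "bilinear (\<Gamma> y)"
proof -
  have c: "h y (\<Gamma> y v w) z = (dh y w z v + dh y v z w - dh y v w z) / 2" for v w z
    using christoffel_eq[OF assms, of v w z] by simp
  show ?thesis
    unfolding bilinear_def
  proof (intro conjI allI linearI)
    show "\<Gamma> y x (v + w) = \<Gamma> y x v + \<Gamma> y x w" for x v w
      by (rule h_eqI[OF assms]) (simp add: assms h_simps c dh_simps field_simps)
    show "\<Gamma> y x (r *\<^sub>R v) = r *\<^sub>R \<Gamma> y x v" for x r v
      by (rule h_eqI[OF assms]) (simp add: assms h_simps c dh_simps field_simps)
    show "\<Gamma> y (v + w) x = \<Gamma> y v x + \<Gamma> y w x" for x v w
      by (rule h_eqI[OF assms]) (simp add: assms h_simps c dh_simps field_simps)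
    show "\<Gamma> y (r *\<^sub>R v) x = r *\<^sub>R \<Gamma> y v x" for x r v
      by (rule h_eqI[OF assms]) (simp add: assms h_simps c dh_simps field_simps)
  qed
qed

text \<open>Metric compatibility: when the equation for (u, v) tested on w and the one for (u, w)
  tested on v are added, everything cancels except twice the left-hand side.\<close>

lemma dh_eq_christoffel:
  assumes "y \<in> S"
  shows "dh y v w u = h y (\<Gamma> y u v) w + h y v (\<Gamma> y u w)"
  using christoffel_eq[OF assms, of u v w] christoffel_eq[OF assms, of u w v]
    h_commute[OF assms, of v "\<Gamma> y u w"] dh_commute[OF assms, of v w u]
    dh_commute[OF assms, of u w v] dh_commute[OF assms, of u v w] by linarith

lemma differentiable_christoffel:
  assumes "y \<in> S"
  shows "(\<lambda>y. \<Gamma> y v w) differentiable (at y)"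
proof (rule bilinear_solution_differentiable[OF open_S assms, where h=h and
      f="\<lambda>y z. (dh y w z v + dh y v z w - dh y v w z) / 2"])
  show "bilinear (h y)" if "y \<in> S" for y using that by (rule bilinear_h)
  show "u = 0" if "\<And>z. h y u z = 0" for u
    using that by (intro h_eqI[OF assms]) (simp add: h_simps assms)
  show "(\<lambda>y. h y v w) differentiable (at y)" for v w
    using smooth_on_differentiable[OF smooth_h assms] .
  show "(\<lambda>y. (dh y w z v + dh y v z w - dh y v w z) / 2) differentiable (at y)" for z
    using assms by (intro differentiable_divide differentiable_diff differentiable_add
        smooth_on_differentiable[OF smooth_dh]) auto
  show "h y (\<Gamma> y v w) z = (dh y w z v + dh y v z w - dh y v w z) / 2" if "y \<in> S" for y z
    using christoffel_eq[OF that, of v w z] by simp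
qed

definition dG :: "'p \<Rightarrow> 'p \<Rightarrow> 'p \<Rightarrow> 'p \<Rightarrow> 'p" where
  "dG y v w d = frechet_derivative (\<lambda>y. \<Gamma> y v w) (at y) d"

lemma has_derivative_christoffel:
  "y \<in> S \<Longrightarrow> ((\<lambda>y. \<Gamma> y v w) has_derivative dG y v w) (at y)"
  unfolding dG_def[abs_def]
  by (rule frechet_derivative_works[THEN iffD1, OF differentiable_christoffel])

lemma curvature_eq:
  "curvature h y u v w = dG y v w u - dG y u w v + \<Gamma> y u (\<Gamma> y v w) - \<Gamma> y v (\<Gamma> y u w)"
  by (simp add: curvature_def dG_def)

lemma linear_curvature:
  assumes "y \<in> S"
  shows "linear (\<lambda>u. curvature h y u v w)"
proof -
  note b = bilinear_christoffel[OF assms]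
  have 1: "linear (dG y v w)" by (rule has_derivative_linear[OF has_derivative_christoffel[OF assms]])
  have 2: "bilinear (\<lambda>u w. dG y u w v)"
    by (rule bilinear_derivative_family[where S=S and B=\<Gamma> and B'="dG y" and x=y])
       (auto intro: open_S assms bilinear_christoffel has_derivative_christoffel)
  show ?thesis
    unfolding curvature_eq
    by (intro linearI)
       (simp_all add: linear_add[OF 1] linear_scale[OF 1] bilinear_ladd[OF 2] bilinear_lmul[OF 2]
         bilinear_ladd[OF b] bilinear_radd[OF b] bilinear_lmul[OF b] bilinear_rmul[OF b] algebra_simps)
qed

text \<open>The Ricci tensor is a trace over the standard basis of the chart, whereas the Killing
  fields supply a frame that is orthonormal for \<open>h y\<close>. Being indexed by the same
  \<open>Basis\<close>, the frame has as many independent vectors as the dimension and therefore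
  spans.\<close>

lemma trace_orthonormal:
  fixes E :: "'p \<Rightarrow> 'p"
  assumes "y \<in> S" "linear F"
    and E: "\<And>b c. \<lbrakk>b \<in> Basis; c \<in> Basis\<rbrakk> \<Longrightarrow> h y (E b) (E c) = (if b = c then 1 else 0)"
  shows "h y v w = (\<Sum>b\<in>Basis. h y v (E b) * h y w (E b))"
    and "(\<Sum>b\<in>Basis. F b \<bullet> b) = (\<Sum>b\<in>Basis. h y (F (E b)) (E b))"
proof -
  define P where "P c = (\<Sum>b\<in>Basis. (c \<bullet> b) *\<^sub>R E b)" for c :: 'p
  have lhl: "linear (h y v)" "linear (\<lambda>w. h y w v)" for v
    using bilinear_h[OF assms(1)] by (simp_all add: bilinear_def)
  have P: "linear P"
    unfolding P_def by (intro linearI) (simp_all add: inner_add_left sum.distrib scaleR_add_left scaleR_sum_right)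
  have PE: "h y (P c) (E b) = c \<bullet> b" if "b \<in> Basis" for b c
    using that by (simp add: P_def linear_sum[OF lhl(2)] linear_scale[OF lhl(2)] E if_distrib cong: if_cong)
  have "inj P"
  proof (subst linear_injective_0[OF P], intro allI impI)
    fix c assume "P c = 0"
    then have "c \<bullet> b = 0" if "b \<in> Basis" for b
      by (subst PE[OF that, symmetric]) (simp add: h_simps assms(1))
    then show "c = 0" using euclidean_eqI[of c 0] by simp
  qed
  then have "surj P" using linear_injective_imp_surjective[OF P] by simp
  have rep: "v = (\<Sum>b\<in>Basis. h y v (E b) *\<^sub>R E b)" for v
  proof -
    obtain c where c: "v = P c" using \<open>surj P\<close> by (metis surjD)
    show ?thesis unfolding c using PE[of _ c] by (simp add: P_def cong: sum.cong)
  qed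
  show H: "h y v w = (\<Sum>b\<in>Basis. h y v (E b) * h y w (E b))" for v w
  proof -
    have "h y v w = h y v (\<Sum>b\<in>Basis. h y w (E b) *\<^sub>R E b)" using rep[of w] by simp
    then show ?thesis by (simp add: linear_sum[OF lhl(1)] linear_scale[OF lhl(1)] mult.commute)
  qed
  have "F b \<bullet> b = (\<Sum>c\<in>Basis. h y b (E c) * (F (E c) \<bullet> b))" for b
    using arg_cong[OF rep[of b], of "\<lambda>v. F v \<bullet> b"]
    by (simp add: linear_sum[OF assms(2)] linear_scale[OF assms(2)] inner_sum_left)
  then have "(\<Sum>b\<in>Basis. F b \<bullet> b) = (\<Sum>c\<in>Basis. \<Sum>b\<in>Basis. h y b (E c) * (F (E c) \<bullet> b))"
    using sum.swap[of "\<lambda>b c. h y b (E c) * (F (E c) \<bullet> b)" Basis Basis] by simp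
  also have "\<dots> = (\<Sum>c\<in>Basis. h y (\<Sum>b\<in>Basis. (F (E c) \<bullet> b) *\<^sub>R b) (E c))"
    by (simp add: linear_sum[OF lhl(2)] linear_scale[OF lhl(2)] mult.commute)
  finally show "(\<Sum>b\<in>Basis. F b \<bullet> b) = (\<Sum>b\<in>Basis. h y (F (E b)) (E b))"
    by (simp add: euclidean_representation)
qed

end

text \<open>
  For Killing fields \<open>\<xi>\<^sub>a\<close> with \<open>[\<xi>\<^sub>a, \<xi>\<^sub>b] = -\<xi>\<^bsub>[a, b]\<^esub>\<close> and \<open>Q(a, b) = \<langle>\<xi>\<^sub>a, \<xi>\<^sub>b\<rangle>\<close>, Koszul's formula reads
  \<open>\<langle>\<nabla>\<^bsub>\<xi>\<^sub>a\<^esub> \<xi>\<^sub>b, \<xi>\<^sub>c\<rangle> = koszul Q [\<cdot>,\<cdot>] a b c\<close>, and \<open>koszul_deriv\<close> is the derivative of this function along \<open>\<xi>\<^sub>w\<close>.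
\<close>

definition koszul :: "('v \<Rightarrow> 'v \<Rightarrow> real) \<Rightarrow> ('v \<Rightarrow> 'v \<Rightarrow> 'v) \<Rightarrow> 'v \<Rightarrow> 'v \<Rightarrow> 'v \<Rightarrow> real" where
  "koszul Q br a b c = - (Q (br a b) c + Q (br a c) b + Q a (br b c)) / 2"

definition koszul_deriv ::
  "('v \<Rightarrow> 'v \<Rightarrow> real) \<Rightarrow> ('v \<Rightarrow> 'v \<Rightarrow> 'v) \<Rightarrow> 'v \<Rightarrow> 'v \<Rightarrow> 'v \<Rightarrow> 'v \<Rightarrow> real" where
  "koszul_deriv Q br w a b c =
     (Q (br w (br a b)) c + Q (br a b) (br w c) + Q (br w (br a c)) b + Q (br a c) (br w b)
      + Q (br w a) (br b c) + Q a (br w (br b c))) / 2"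

text \<open>For an orthonormal frame e the summand is <R(e_b, x) y, e_b>. The bracket term has a
  plus sign because of the minus sign in the brackets of Killing fields. The sums over c are the
  products <nabla_x y, nabla_b e_b> and <nabla_b y, nabla_x e_b>, expanded in the frame, which arise
  when an inner product is differentiated.\<close>

definition ricci_form ::
  "('v \<Rightarrow> 'v \<Rightarrow> real) \<Rightarrow> ('v \<Rightarrow> 'v \<Rightarrow> 'v) \<Rightarrow> ('p::euclidean_space \<Rightarrow> 'v) \<Rightarrow> 'v \<Rightarrow> 'v \<Rightarrow> real" where
  "ricci_form Q br e x y = (\<Sum>b\<in>Basis.
     koszul_deriv Q br (e b) x y (e b) - koszul_deriv Q br x (e b) y (e b)
     + koszul Q br (br (e b) x) y (e b)
     - (\<Sum>c\<in>Basis. koszul Q br x y (e c) * koszul Q br (e b) (e b) (e c))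
     + (\<Sum>c\<in>Basis. koszul Q br (e b) y (e c) * koszul Q br x (e b) (e c)))"

text \<open>The first condition is the vanishing of the Lie derivative of h. The minus sign in the
  second is that of a left action, which sends Lie algebra elements to fields antihomomorphically.
  The index type carries no structure, so the fields can be relabelled along any map compatible with
  the brackets.\<close>

locale killing_fields = local_metric S h
  for S :: "'p::euclidean_space set" and h +
  fixes \<xi> :: "'v \<Rightarrow> 'p \<Rightarrow> 'p" and br :: "'v \<Rightarrow> 'v \<Rightarrow> 'v"
  assumes smooth_xi: "smooth_on S (\<xi> a)"
    and killing: "y \<in> S \<Longrightarrow>
      frechet_derivative (\<lambda>y. h y u w) (at y) (\<xi> a y)
      + h y (frechet_derivative (\<xi> a) (at y) u) w + h y u (frechet_derivative (\<xi> a) (at y) w) = 0"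
    and bracket: "y \<in> S \<Longrightarrow>
      frechet_derivative (\<xi> b) (at y) (\<xi> a y) - frechet_derivative (\<xi> a) (at y) (\<xi> b y) = - \<xi> (br a b) y"
begin

definition dx :: "'v \<Rightarrow> 'p \<Rightarrow> 'p \<Rightarrow> 'p" where
  "dx a y d = frechet_derivative (\<xi> a) (at y) d"

definition ddx :: "'v \<Rightarrow> 'p \<Rightarrow> 'p \<Rightarrow> 'p \<Rightarrow> 'p" where
  "ddx a y v d = frechet_derivative (\<lambda>y. dx a y v) (at y) d"

lemma has_derivative_xi: "y \<in> S \<Longrightarrow> (\<xi> a has_derivative dx a y) (at y)"
  unfolding dx_def[abs_def] by (rule smooth_on_has_derivative[OF smooth_xi])

lemma has_derivative_dx: "y \<in> S \<Longrightarrow> ((\<lambda>y. dx a y v) has_derivative ddx a y v) (at y)"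
  unfolding dx_def ddx_def[abs_def]
  by (rule smooth_on_has_derivative[OF smooth_on_frechet_derivative[OF smooth_xi]])

lemma ddx_commute: "y \<in> S \<Longrightarrow> ddx a y v d = ddx a y d v"
  unfolding ddx_def dx_def by (rule smooth_on_second_derivative_symmetric[OF open_S _ smooth_xi])

lemma linear_dx: "y \<in> S \<Longrightarrow> linear (dx a y)"
  by (rule has_derivative_linear[OF has_derivative_xi])

lemma killing': "y \<in> S \<Longrightarrow> dh y u w (\<xi> a y) = - h y (dx a y u) w - h y u (dx a y w)"
  using killing[of y u w a] by (simp add: dh_def dx_def)

lemma bracket': "y \<in> S \<Longrightarrow> dx b y (\<xi> a y) - dx a y (\<xi> b y) = - \<xi> (br a b) y"
  using bracket[of y b a] by (simp add: dx_def)

definition Q :: "'p \<Rightarrow> 'v \<Rightarrow> 'v \<Rightarrow> real" where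
  "Q y a b = h y (\<xi> a y) (\<xi> b y)"

lemma has_derivative_h_fields:
  assumes "y \<in> S" "(Y has_derivative Y') (at y)" "(Z has_derivative Z') (at y)"
  shows "((\<lambda>y. h y (Y y) (Z y)) has_derivative
     (\<lambda>d. dh y (Y y) (Z y) d + h y (Y' d) (Z y) + h y (Y y) (Z' d))) (at y)"
  by (rule has_derivative_bilinear_family[OF open_S assms(1) bilinear_h has_derivative_h assms(2,3)])
     (use assms in auto)

text \<open>The closure property on which the computation rests: along a Killing field, Q changes
  only through brackets of its arguments, since the Lie derivative of h vanishes. The existential
  form records the value of the derivative at \<open>\<xi> w y\<close> alone, the direction in which
  it is algebraic.\<close>

lemma has_derivative_Q:
  assumes "y \<in> S"
  shows "\<exists>Q'. ((\<lambda>y. Q y a b) has_derivative Q') (at y) \<and>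
           Q' (\<xi> w y) = - (Q y (br w a) b + Q y a (br w b))"
proof (intro exI conjI)
  show "((\<lambda>y. Q y a b) has_derivative
      (\<lambda>d. dh y (\<xi> a y) (\<xi> b y) d + h y (dx a y d) (\<xi> b y) + h y (\<xi> a y) (dx b y d))) (at y)"
    unfolding Q_def using assms by (intro has_derivative_h_fields has_derivative_xi)
  show "dh y (\<xi> a y) (\<xi> b y) (\<xi> w y) + h y (dx a y (\<xi> w y)) (\<xi> b y) + h y (\<xi> a y) (dx b y (\<xi> w y))
      = - (Q y (br w a) b + Q y a (br w b))"
  proof -
    have 1: "\<xi> (br w a) y = dx w y (\<xi> a y) - dx a y (\<xi> w y)" for a
      using bracket'[OF assms, of a w] by (simp add: algebra_simps eq_neg_iff_add_eq_0)
    show ?thesis using assms by (simp add: killing' Q_def 1 h_simps)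
  qed
qed

definition nabla :: "'v \<Rightarrow> 'v \<Rightarrow> 'p \<Rightarrow> 'p" where
  "nabla a b y = dx b y (\<xi> a y) + \<Gamma> y (\<xi> a y) (\<xi> b y)"

text \<open>Koszul's formula also contains derivatives of inner products; for Killing fields these
  are brackets as well, and only three terms in Q survive.\<close>

lemma h_nabla:
  assumes "y \<in> S"
  shows "h y (nabla a b y) (\<xi> c y) = koszul (Q y) br a b c"
proof -
  have 1: "\<xi> (br a b) y = dx a y (\<xi> b y) - dx b y (\<xi> a y)" for a b
    using bracket'[OF assms, of b a] by (simp add: algebra_simps eq_neg_iff_add_eq_0)
  have 2: "2 * h y (\<Gamma> y (\<xi> a y) (\<xi> b y)) (\<xi> c y)
      = dh y (\<xi> b y) (\<xi> c y) (\<xi> a y) + dh y (\<xi> a y) (\<xi> c y) (\<xi> b y) - dh y (\<xi> a y) (\<xi> b y) (\<xi> c y)"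
    by (rule christoffel_eq[OF assms])
  show ?thesis
    using 2 h_commute[OF assms, of "\<xi> b y" "dx a y (\<xi> c y)"]
    by (simp add: assms nabla_def koszul_def Q_def 1 h_simps killing' field_simps)
qed

definition dnabla :: "'v \<Rightarrow> 'v \<Rightarrow> 'p \<Rightarrow> 'p \<Rightarrow> 'p" where
  "dnabla a b y d = ddx b y (\<xi> a y) d + dx b y (dx a y d)
     + (dG y (\<xi> a y) (\<xi> b y) d + \<Gamma> y (dx a y d) (\<xi> b y) + \<Gamma> y (\<xi> a y) (dx b y d))"

lemma has_derivative_nabla:
  assumes "y \<in> S"
  shows "(nabla a b has_derivative dnabla a b y) (at y)"
proof -
  have "((\<lambda>y. dx b y (\<xi> a y)) has_derivative (\<lambda>d. ddx b y (\<xi> a y) d + dx b y (dx a y d))) (at y)"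
    by (rule has_derivative_linear_family[OF open_S assms linear_dx])
       (auto intro!: has_derivative_dx has_derivative_xi assms)
  moreover have "((\<lambda>y. \<Gamma> y (\<xi> a y) (\<xi> b y)) has_derivative
      (\<lambda>d. dG y (\<xi> a y) (\<xi> b y) d + \<Gamma> y (dx a y d) (\<xi> b y) + \<Gamma> y (\<xi> a y) (dx b y d))) (at y)"
    by (rule has_derivative_bilinear_family[OF open_S assms bilinear_christoffel])
       (auto intro!: has_derivative_christoffel has_derivative_xi assms)
  ultimately show ?thesis
    unfolding nabla_def[abs_def] dnabla_def[abs_def] by (rule has_derivative_add)
qed

definition nabla2 :: "'v \<Rightarrow> 'v \<Rightarrow> 'v \<Rightarrow> 'p \<Rightarrow> 'p" where
  "nabla2 w a b y = dnabla a b y (\<xi> w y) + \<Gamma> y (\<xi> w y) (nabla a b y)"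

text \<open>The function <nabla_a b, \<xi>_c> is differentiated along \<xi>_w in two ways:
  algebraically by \<open>has_derivative_Q\<close>, and by the product rule with metric
  compatibility. The second way yields the wanted term plus a product of first covariant
  derivatives.\<close>

lemma h_nabla2:
  assumes "y \<in> S"
  shows "h y (nabla2 w a b y) (\<xi> c y) = koszul_deriv (Q y) br w a b c - h y (nabla a b y) (nabla w c y)"
proof -
  obtain Q1 where Q1: "((\<lambda>y. Q y (br a b) c) has_derivative Q1) (at y)"
    "Q1 (\<xi> w y) = - (Q y (br w (br a b)) c + Q y (br a b) (br w c))"
    using has_derivative_Q[OF assms] by blast
  obtain Q2 where Q2: "((\<lambda>y. Q y (br a c) b) has_derivative Q2) (at y)"
    "Q2 (\<xi> w y) = - (Q y (br w (br a c)) b + Q y (br a c) (br w b))"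
    using has_derivative_Q[OF assms] by blast
  obtain Q3 where Q3: "((\<lambda>y. Q y a (br b c)) has_derivative Q3) (at y)"
    "Q3 (\<xi> w y) = - (Q y (br w a) (br b c) + Q y a (br w (br b c)))"
    using has_derivative_Q[OF assms] by blast
  have "((\<lambda>y. (-1/2) * (Q y (br a b) c + Q y (br a c) b + Q y a (br b c))) has_derivative
      (\<lambda>d. (-1/2) * (Q1 d + Q2 d + Q3 d))) (at y)"
    by (intro has_derivative_mult_right has_derivative_add Q1 Q2 Q3)
  then have d1: "((\<lambda>y. h y (nabla a b y) (\<xi> c y)) has_derivative
      (\<lambda>d. (-1/2) * (Q1 d + Q2 d + Q3 d))) (at y)"
    by (rule has_derivative_transform_within_open[OF _ open_S assms]) (simp add: h_nabla koszul_def algebra_simps)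
  have d2: "((\<lambda>y. h y (nabla a b y) (\<xi> c y)) has_derivative
      (\<lambda>d. dh y (nabla a b y) (\<xi> c y) d + h y (dnabla a b y d) (\<xi> c y) + h y (nabla a b y) (dx c y d))) (at y)"
    using assms by (intro has_derivative_h_fields has_derivative_nabla has_derivative_xi)
  have "(-1/2) * (Q1 (\<xi> w y) + Q2 (\<xi> w y) + Q3 (\<xi> w y)) =
      dh y (nabla a b y) (\<xi> c y) (\<xi> w y) + h y (dnabla a b y (\<xi> w y)) (\<xi> c y)
      + h y (nabla a b y) (dx c y (\<xi> w y))"
    using fun_cong[OF has_derivative_unique[OF d1 d2], of "\<xi> w y"] by simp
  then show ?thesis
    using assms
    by (simp add: Q1 Q2 Q3 dh_eq_christoffel koszul_deriv_def nabla2_def nabla_def[of w c] h_simps field_simps)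
qed

text \<open>Computed with the fields themselves, the second derivatives of \<open>\<xi> b\<close>
  cancel by symmetry. The remaining first-order terms form the covariant derivative along the
  bracket of the two fields, whose sign is reversed in terms of \<open>br\<close>.\<close>

lemma curvature_fields:
  assumes "y \<in> S"
  shows "curvature h y (\<xi> w y) (\<xi> a y) (\<xi> b y)
       = nabla2 w a b y - nabla2 a w b y + nabla (br w a) b y"
proof -
  note b = bilinear_christoffel[OF assms]
  have 1: "\<xi> (br w a) y = dx w y (\<xi> a y) - dx a y (\<xi> w y)"
    using bracket'[OF assms, of a w] by (simp add: algebra_simps eq_neg_iff_add_eq_0)
  have 2: "dx b y (\<xi> (br w a) y) = dx b y (dx w y (\<xi> a y)) - dx b y (dx a y (\<xi> w y))"
    by (simp add: 1 linear_diff[OF linear_dx[OF assms]])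
  have 3: "\<Gamma> y (\<xi> (br w a) y) (\<xi> b y) = \<Gamma> y (dx w y (\<xi> a y)) (\<xi> b y) - \<Gamma> y (dx a y (\<xi> w y)) (\<xi> b y)"
    by (simp add: 1 bilinear_lsub[OF b])
  show ?thesis
    unfolding curvature_eq nabla2_def dnabla_def nabla_def 2 3 bilinear_radd[OF b]
    using ddx_commute[OF assms, of b "\<xi> a y" "\<xi> w y"] by simp
qed

text \<open>Orthonormality is asked only at the single point y: the trace is taken there, and all
  derivatives have already become algebraic.\<close>

theorem ricci_killing_fields:
  fixes e :: "'p \<Rightarrow> 'v"
  assumes "y \<in> S"
    and e: "\<And>b c. \<lbrakk>b \<in> Basis; c \<in> Basis\<rbrakk> \<Longrightarrow> h y (\<xi> (e b) y) (\<xi> (e c) y) = (if b = c then 1 else 0)"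
  shows "(\<Sum>b\<in>Basis. curvature h y b (\<xi> x y) (\<xi> z y) \<bullet> b) = ricci_form (Q y) br e x z"
proof -
  have lc: "linear (\<lambda>u. curvature h y u (\<xi> x y) (\<xi> z y))" by (rule linear_curvature[OF assms(1)])
  have "(\<Sum>b\<in>Basis. curvature h y b (\<xi> x y) (\<xi> z y) \<bullet> b)
      = (\<Sum>b\<in>Basis. h y (curvature h y (\<xi> (e b) y) (\<xi> x y) (\<xi> z y)) (\<xi> (e b) y))"
    by (rule trace_orthonormal(2)[OF assms(1) lc e])
  also have "\<dots> = ricci_form (Q y) br e x z"
    unfolding ricci_form_def
  proof (rule sum.cong[OF refl])
    fix b :: 'p assume "b \<in> Basis"
    have H: "h y (nabla a1 a2 y) (nabla a3 a4 y)
        = (\<Sum>c\<in>Basis. koszul (Q y) br a1 a2 (e c) * koszul (Q y) br a3 a4 (e c))" for a1 a2 a3 a4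
      using trace_orthonormal(1)[OF assms(1) linear_id, where E="\<lambda>c. \<xi> (e c) y" and v="nabla a1 a2 y" and w="nabla a3 a4 y"] e
      by (simp add: h_nabla[OF assms(1)])
    show "h y (curvature h y (\<xi> (e b) y) (\<xi> x y) (\<xi> z y)) (\<xi> (e b) y) =
        koszul_deriv (Q y) br (e b) x z (e b) - koszul_deriv (Q y) br x (e b) z (e b)
        + koszul (Q y) br (br (e b) x) z (e b)
        - (\<Sum>c\<in>Basis. koszul (Q y) br x z (e c) * koszul (Q y) br (e b) (e b) (e c))
        + (\<Sum>c\<in>Basis. koszul (Q y) br (e b) z (e c) * koszul (Q y) br x (e b) (e c))"
      by (simp add: curvature_fields h_simps h_nabla2 assms(1) h_nabla H)
  qed
  finally show ?thesis .
qed

end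

lemma has_derivative_slices:
  fixes f :: "'b::real_normed_vector \<times> 'c::real_normed_vector \<Rightarrow> 'd::real_normed_vector"
  assumes "(f has_derivative f') (at (a, b))"
  shows "((\<lambda>x. f (x, b)) has_derivative (\<lambda>d. f' (d, 0))) (at a)"
    and "((\<lambda>y. f (a, y)) has_derivative (\<lambda>d. f' (0, d))) (at b)"
proof -
  have 1: "((\<lambda>x. (x, b)) has_derivative (\<lambda>d. (d, 0))) (at a)"
    by (intro has_derivative_Pair has_derivative_ident has_derivative_const)
  from has_derivative_compose[OF 1] assms
  show "((\<lambda>x. f (x, b)) has_derivative (\<lambda>d. f' (d, 0))) (at a)" by blast
  have 2: "((\<lambda>y. (a, y)) has_derivative (\<lambda>d. (0, d))) (at b)"
    by (intro has_derivative_Pair has_derivative_ident has_derivative_const)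
  from has_derivative_compose[OF 2] assms
  show "((\<lambda>y. f (a, y)) has_derivative (\<lambda>d. f' (0, d))) (at b)" by blast
qed

lemma open_slice:
  fixes W :: "('b::topological_space \<times> 'c::topological_space) set"
  assumes "open W"
  shows "open {x. (x, b) \<in> W}" "open {y. (a, y) \<in> W}"
proof -
  have "continuous_on UNIV (\<lambda>x. (x, b))" by (intro continuous_intros)
  from open_vimage[OF assms this] show "open {x. (x, b) \<in> W}" by (simp add: vimage_def)
  have "continuous_on UNIV (\<lambda>y. (a, y))" by (intro continuous_intros)
  from open_vimage[OF assms this] show "open {y. (a, y) \<in> W}" by (simp add: vimage_def)
qed

section \<open>Local isometric actions\<close>

text \<open>The action of G on G/K and the product of G, read in one chart around the identity and
  one around the origin. The maps are meaningful only where results stay in these charts, which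
  explains the two domains and the four membership conditions in the action law. What remains is
  calculus on open subsets of Euclidean spaces.\<close>

locale local_action = local_metric S h
  for S :: "'p::euclidean_space set" and h +
  fixes \<Omega> :: "('a::euclidean_space \<times> 'p) set" and \<Phi> :: "'a \<times> 'p \<Rightarrow> 'p"
    and \<Omega>m :: "('a \<times> 'a) set" and m :: "'a \<times> 'a \<Rightarrow> 'a" and e :: 'a
  assumes open_Omega: "open \<Omega>" and smooth_act: "smooth_on \<Omega> \<Phi>"
    and act_S: "(a, y) \<in> \<Omega> \<Longrightarrow> \<Phi> (a, y) \<in> S"
    and Omega_e: "y \<in> S \<Longrightarrow> (e, y) \<in> \<Omega>" and act_e: "y \<in> S \<Longrightarrow> \<Phi> (e, y) = y"
    and isometric: "(a, y) \<in> \<Omega> \<Longrightarrow>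
      h (\<Phi> (a, y)) (frechet_derivative \<Phi> (at (a, y)) (0, u)) (frechet_derivative \<Phi> (at (a, y)) (0, w)) = h y u w"
    and open_Omega_m: "open \<Omega>m" and smooth_m: "smooth_on \<Omega>m m"
    and Omega_m_e: "(e, e) \<in> \<Omega>m"
    and m_left: "(e, b) \<in> \<Omega>m \<Longrightarrow> m (e, b) = b" and m_right: "(a, e) \<in> \<Omega>m \<Longrightarrow> m (a, e) = a"
    and act_m: "\<lbrakk>(a, b) \<in> \<Omega>m; (m (a, b), y) \<in> \<Omega>; (b, y) \<in> \<Omega>; (a, \<Phi> (b, y)) \<in> \<Omega>\<rbrakk> \<Longrightarrow>
      \<Phi> (m (a, b), y) = \<Phi> (a, \<Phi> (b, y))"
begin

definition D :: "'a \<times> 'p \<Rightarrow> 'a \<times> 'p \<Rightarrow> 'p" where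
  "D z v = frechet_derivative \<Phi> (at z) v"

definition DD :: "'a \<times> 'p \<Rightarrow> 'a \<times> 'p \<Rightarrow> 'a \<times> 'p \<Rightarrow> 'p" where
  "DD z v d = frechet_derivative (\<lambda>z. D z v) (at z) d"

text \<open>In coordinates, the left-invariant field with value w at the identity.\<close>

definition L :: "'a \<Rightarrow> 'a \<Rightarrow> 'a" where
  "L w a = frechet_derivative m (at (a, e)) (0, w)"

definition fundamental_field :: "'a \<Rightarrow> 'p \<Rightarrow> 'p" where
  "fundamental_field v y = D (e, y) (v, 0)"

definition local_bracket :: "'a \<Rightarrow> 'a \<Rightarrow> 'a" where
  "local_bracket v w = frechet_derivative (L w) (at e) v - frechet_derivative (L v) (at e) w"

lemma has_derivative_act: "z \<in> \<Omega> \<Longrightarrow> (\<Phi> has_derivative D z) (at z)"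
  unfolding D_def[abs_def] by (rule smooth_on_has_derivative[OF smooth_act])

lemma smooth_D: "smooth_on \<Omega> (\<lambda>z. D z v)"
  unfolding D_def by (rule smooth_on_frechet_derivative[OF smooth_act])

lemma has_derivative_D: "z \<in> \<Omega> \<Longrightarrow> ((\<lambda>z. D z v) has_derivative DD z v) (at z)"
  unfolding DD_def[abs_def] by (rule smooth_on_has_derivative[OF smooth_D])

lemma DD_commute: "z \<in> \<Omega> \<Longrightarrow> DD z v d = DD z d v"
  unfolding DD_def D_def by (rule smooth_on_second_derivative_symmetric[OF open_Omega _ smooth_act])

lemma linear_D: "z \<in> \<Omega> \<Longrightarrow> linear (D z)"
  by (rule has_derivative_linear[OF has_derivative_act])

lemma D_e:
  assumes "y \<in> S"
  shows "D (e, y) (0, u) = u"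
proof -
  have "((\<lambda>y. \<Phi> (e, y)) has_derivative (\<lambda>d. d)) (at y)"
    by (rule has_derivative_transform_within_open[OF has_derivative_ident open_S assms]) (simp add: act_e)
  from has_derivative_unique[OF this has_derivative_slices(2)[OF has_derivative_act[OF Omega_e[OF assms]]]]
  show ?thesis by metis
qed

lemma smooth_fundamental_field: "smooth_on S (fundamental_field v)"
  unfolding fundamental_field_def[abs_def]
  by (rule smooth_on_slice_right[OF open_S Omega_e smooth_D])

lemma has_derivative_fundamental_field:
  assumes "y \<in> S"
  shows "(fundamental_field v has_derivative (\<lambda>d. DD (e, y) (v, 0) (0, d))) (at y)"
  unfolding fundamental_field_def[abs_def]
  by (rule has_derivative_slices(2)[OF has_derivative_D[OF Omega_e[OF assms]]])

text \<open>Derivative at \<open>a = e\<close> of the identity saying that a acts isometrically. At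
  e the differential of the action in y is the identity, and symmetry of second derivatives turns
  the a-derivative of this differential into the y-derivative of the fundamental field.\<close>

lemma killing_equation:
  assumes "y \<in> S"
  shows "dh y u w (fundamental_field v y) + h y (DD (e, y) (v, 0) (0, u)) w + h y u (DD (e, y) (v, 0) (0, w)) = 0"
proof -
  define U where "U = {a. (a, y) \<in> \<Omega>}"
  have U: "open U" "e \<in> U" unfolding U_def using open_slice(1)[OF open_Omega] Omega_e[OF assms] by auto
  have h': "((\<lambda>a. h (\<Phi> (a, y)) v w) has_derivative (\<lambda>d. dh y v w (D (e, y) (d, 0)))) (at e)" for v w
  proof -
    have "((\<lambda>a. \<Phi> (a, y)) has_derivative (\<lambda>d. D (e, y) (d, 0))) (at e)"
      by (rule has_derivative_slices(1)[OF has_derivative_act[OF Omega_e[OF assms]]])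
    from has_derivative_compose[OF this, of "\<lambda>y. h y v w" "dh y v w"] has_derivative_h[OF assms]
    show ?thesis by (simp add: act_e[OF assms])
  qed
  have Y: "((\<lambda>a. D (a, y) (0, u)) has_derivative (\<lambda>d. DD (e, y) (0, u) (d, 0))) (at e)" for u
    by (rule has_derivative_slices(1)[OF has_derivative_D[OF Omega_e[OF assms]]])
  have "((\<lambda>a. h (\<Phi> (a, y)) (D (a, y) (0, u)) (D (a, y) (0, w))) has_derivative
      (\<lambda>d. dh y (D (e, y) (0, u)) (D (e, y) (0, w)) (D (e, y) (d, 0))
        + h (\<Phi> (e, y)) (DD (e, y) (0, u) (d, 0)) (D (e, y) (0, w))
        + h (\<Phi> (e, y)) (D (e, y) (0, u)) (DD (e, y) (0, w) (d, 0)))) (at e)"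
    by (rule has_derivative_bilinear_family[OF U _ h' Y Y])
       (auto simp: U_def intro: bilinear_h act_S)
  moreover have "((\<lambda>a. h (\<Phi> (a, y)) (D (a, y) (0, u)) (D (a, y) (0, w))) has_derivative (\<lambda>d. 0)) (at e)"
    by (rule has_derivative_transform_within_open[OF has_derivative_const[of "h y u w"] U])
       (simp add: U_def D_def isometric)
  ultimately have "(\<lambda>d. dh y (D (e, y) (0, u)) (D (e, y) (0, w)) (D (e, y) (d, 0))
        + h (\<Phi> (e, y)) (DD (e, y) (0, u) (d, 0)) (D (e, y) (0, w))
        + h (\<Phi> (e, y)) (D (e, y) (0, u)) (DD (e, y) (0, w) (d, 0))) = (\<lambda>d. 0)"
    by (rule has_derivative_unique)
  from fun_cong[OF this, of v] show ?thesis
    using assms Omega_e[OF assms]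
    by (simp add: D_e act_e fundamental_field_def DD_commute[of "(e, y)" "(v, 0)"])
qed

lemma smooth_L: "\<exists>U. open U \<and> e \<in> U \<and> (\<forall>a\<in>U. (a, e) \<in> \<Omega>m) \<and> (\<forall>w. smooth_on U (L w))"
proof (intro exI conjI ballI allI)
  show "open {a. (a, e) \<in> \<Omega>m}" by (rule open_slice[OF open_Omega_m])
  show "smooth_on {a. (a, e) \<in> \<Omega>m} (L w)" for w
    unfolding L_def[abs_def]
    by (rule smooth_on_slice_left[OF open_slice(1)[OF open_Omega_m] _ smooth_on_frechet_derivative[OF smooth_m]]) simp
qed (use Omega_m_e in auto)

lemma has_derivative_m: "z \<in> \<Omega>m \<Longrightarrow> (m has_derivative frechet_derivative m (at z)) (at z)"
  by (rule smooth_on_has_derivative[OF smooth_m])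

lemma L_e: "L w e = w"
proof -
  define U where "U = {b. (e, b) \<in> \<Omega>m}"
  have U: "open U" "e \<in> U" unfolding U_def using open_slice(2)[OF open_Omega_m] Omega_m_e by auto
  have "((\<lambda>b. m (e, b)) has_derivative (\<lambda>d. d)) (at e)"
    by (rule has_derivative_transform_within_open[OF has_derivative_ident U]) (simp add: U_def m_left)
  from has_derivative_unique[OF this has_derivative_slices(2)[OF has_derivative_m[OF Omega_m_e]]]
  show ?thesis unfolding L_def by metis
qed

text \<open>Derivative of \<open>\<Phi> (m (a, b), y) = \<Phi> (a, \<Phi> (b, y))\<close> in b at e.
  The action law is available only on its domains, and continuity shows that it holds for all b near
  e.\<close>

lemma D_L:
  assumes "y \<in> S" "(a, e) \<in> \<Omega>m" "(a, y) \<in> \<Omega>"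
  shows "D (a, y) (L w a, 0) = D (a, y) (0, fundamental_field w y)"
proof -
  have c1: "\<forall>\<^sub>F b in nhds e. (a, b) \<in> \<Omega>m"
    using eventually_nhds_in_open[OF open_slice(2)[OF open_Omega_m]] assms(2) by auto
  have dm: "((\<lambda>b. m (a, b)) has_derivative (\<lambda>d. frechet_derivative m (at (a, e)) (0, d))) (at e)"
    by (rule has_derivative_slices(2)[OF has_derivative_m[OF assms(2)]])
  have dPhi: "((\<lambda>b. \<Phi> (b, y)) has_derivative (\<lambda>d. D (e, y) (d, 0))) (at e)"
    by (rule has_derivative_slices(1)[OF has_derivative_act[OF Omega_e[OF assms(1)]]])
  have nh: "\<forall>\<^sub>F b in nhds e. P (f b)"
    if "isCont f e" "open W" "f e \<in> W" "\<And>x. x \<in> W \<Longrightarrow> P x" for f :: "'a \<Rightarrow> 'q::topological_space" and W P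
    using that by (auto simp: continuous_within tendsto_at_iff_tendsto_nhds dest!: topological_tendstoD
        elim!: eventually_mono)
  have c2: "\<forall>\<^sub>F b in nhds e. (m (a, b), y) \<in> \<Omega>"
    by (rule nh[OF has_derivative_continuous[OF dm] open_slice(1)[OF open_Omega], of y])
       (auto simp: m_right assms)
  have c3: "\<forall>\<^sub>F b in nhds e. (b, y) \<in> \<Omega>"
    using eventually_nhds_in_open[OF open_slice(1)[OF open_Omega]] Omega_e[OF assms(1)] by auto
  have c4: "\<forall>\<^sub>F b in nhds e. (a, \<Phi> (b, y)) \<in> \<Omega>"
    by (rule nh[OF has_derivative_continuous[OF dPhi] open_slice(2)[OF open_Omega], of a])
       (auto simp: act_e assms)
  have ev: "\<forall>\<^sub>F b in nhds e. \<Phi> (a, \<Phi> (b, y)) = \<Phi> (m (a, b), y)"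
    using c1 c2 c3 c4 by eventually_elim (simp add: act_m)
  have "(\<Phi> has_derivative D (a, y)) (at (m (a, e), y))"
    using has_derivative_act[OF assms(3)] by (simp add: m_right assms)
  from has_derivative_compose[OF dm has_derivative_slices(1)[OF this]]
  have 1: "((\<lambda>b. \<Phi> (m (a, b), y)) has_derivative
      (\<lambda>d. D (a, y) (frechet_derivative m (at (a, e)) (0, d), 0))) (at e)" .
  have "(\<Phi> has_derivative D (a, y)) (at (a, \<Phi> (e, y)))"
    using has_derivative_act[OF assms(3)] by (simp add: act_e assms)
  from has_derivative_compose[OF dPhi has_derivative_slices(2)[OF this]]
  have 2: "((\<lambda>b. \<Phi> (a, \<Phi> (b, y))) has_derivative (\<lambda>d. D (a, y) (0, D (e, y) (d, 0)))) (at e)" .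
  obtain U where U: "open U" "e \<in> U" "\<And>b. b \<in> U \<Longrightarrow> \<Phi> (a, \<Phi> (b, y)) = \<Phi> (m (a, b), y)"
    using ev unfolding eventually_nhds by blast
  from has_derivative_unique[OF has_derivative_transform_within_open[OF 2 U] 1]
  show ?thesis unfolding L_def fundamental_field_def by metis
qed

text \<open>Derivative of \<open>D_L\<close> in a at e. The second-derivative term on the right is
  symmetric in v and w, so it drops out of the commutator of two fundamental fields.\<close>

lemma fundamental_field_derivative:
  assumes "y \<in> S"
  shows "DD (e, y) (v, 0) (0, fundamental_field w y)
    = DD (e, y) (w, 0) (v, 0) + fundamental_field (frechet_derivative (L w) (at e) v) y"
proof -
  obtain U where U: "open U" "e \<in> U" "\<And>a. a \<in> U \<Longrightarrow> (a, e) \<in> \<Omega>m" "smooth_on U (L w)"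
    using smooth_L by blast
  define V where "V = U \<inter> {a. (a, y) \<in> \<Omega>}"
  have V: "open V" "e \<in> V"
    unfolding V_def using U open_slice(1)[OF open_Omega] Omega_e[OF assms] by (auto intro: open_Int)
  have dL: "(L w has_derivative frechet_derivative (L w) (at e)) (at e)"
    by (rule smooth_on_has_derivative[OF U(4,2)])
  have dA: "((\<lambda>a. D (a, y) v) has_derivative (\<lambda>d. DD (e, y) v (d, 0))) (at e)" for v
    by (rule has_derivative_slices(1)[OF has_derivative_D[OF Omega_e[OF assms]]])
  have "((\<lambda>a. D (a, y) (L w a, 0)) has_derivative
      (\<lambda>d. DD (e, y) (L w e, 0) (d, 0) + D (e, y) (frechet_derivative (L w) (at e) d, 0))) (at e)"
  proof (rule has_derivative_linear_family[OF V _ dA])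
    show "linear (D (a, y))" if "a \<in> V" for a using that by (auto simp: V_def intro: linear_D)
    show "((\<lambda>a. (L w a, 0)) has_derivative (\<lambda>d. (frechet_derivative (L w) (at e) d, 0))) (at e)"
      by (intro has_derivative_Pair dL has_derivative_const)
  qed
  then have "((\<lambda>a. D (a, y) (0, fundamental_field w y)) has_derivative
      (\<lambda>d. DD (e, y) (L w e, 0) (d, 0) + D (e, y) (frechet_derivative (L w) (at e) d, 0))) (at e)"
    by (rule has_derivative_transform_within_open[OF _ V]) (auto simp: V_def U(3) D_L assms)
  from fun_cong[OF has_derivative_unique[OF this dA], of v]
  have "DD (e, y) (w, 0) (v, 0) + D (e, y) (frechet_derivative (L w) (at e) v, 0)
      = DD (e, y) (0, fundamental_field w y) (v, 0)" by (simp only: L_e)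
  then show ?thesis
    using DD_commute[OF Omega_e[OF assms], of "(v, 0)"] by (simp add: fundamental_field_def)
qed

lemma fundamental_field_diff:
  assumes "y \<in> S"
  shows "fundamental_field (v - w) y = fundamental_field v y - fundamental_field w y"
  using linear_diff[OF linear_D[OF Omega_e[OF assms]], of "(v, 0)" "(w, 0)"]
  by (simp add: fundamental_field_def)

lemma killing_fields: "killing_fields S h fundamental_field local_bracket"
proof
  show "smooth_on S (fundamental_field v)" for v by (rule smooth_fundamental_field)
next
  fix y v u w assume y: "y \<in> S"
  have d: "frechet_derivative (fundamental_field v) (at y) = (\<lambda>d. DD (e, y) (v, 0) (0, d))" for v
    using frechet_derivative_at[OF has_derivative_fundamental_field[OF y]] by simp
  show "frechet_derivative (\<lambda>y. h y u w) (at y) (fundamental_field v y)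
      + h y (frechet_derivative (fundamental_field v) (at y) u) w
      + h y u (frechet_derivative (fundamental_field v) (at y) w) = 0"
    using killing_equation[OF y] by (simp add: d dh_def)
  show "frechet_derivative (fundamental_field w) (at y) (fundamental_field v y)
      - frechet_derivative (fundamental_field v) (at y) (fundamental_field w y)
      = - fundamental_field (local_bracket v w) y" for v w
    using fundamental_field_derivative[OF y, of v w] fundamental_field_derivative[OF y, of w v]
      DD_commute[OF Omega_e[OF y], of "(v, 0)" "(w, 0)"]
    by (simp add: d local_bracket_def fundamental_field_diff[OF y])
qed

end

section \<open>Coordinate representations of maps between manifolds\<close>

definition rep :: "('m, 'e) chart \<Rightarrow> ('n, 'f) chart \<Rightarrow> ('m \<Rightarrow> 'n) \<Rightarrow> 'e \<Rightarrow> 'f" where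
  "rep c d f y = snd d (f (uncoord c y))"

text \<open>\<open>mderiv\<close> is tied to the preferred charts of both points. With free charts,
  one chart can be kept while the point moves, and changes of coordinates become instances of the
  chain rule for the identity map.\<close>

definition drep ::
  "('m, 'e::euclidean_space) chart \<Rightarrow> ('n, 'f::euclidean_space) chart \<Rightarrow> ('m \<Rightarrow> 'n) \<Rightarrow> 'm \<Rightarrow> 'e \<Rightarrow> 'f" where
  "drep c d f p = frechet_derivative (rep c d f) (at (snd c p))"

lemma comp_eq_rep: "snd d \<circ> f \<circ> uncoord c = rep c d f"
  by (simp add: fun_eq_iff rep_def)

lemma comp_eq_rep_id: "snd d \<circ> uncoord c = rep c d (\<lambda>p. p)"
  by (simp add: fun_eq_iff rep_def)

lemma mderiv_eq_drep: "mderiv A B f p = drep (chart_at A p) (chart_at B (f p)) f p"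
  by (simp add: mderiv_def drep_def comp_eq_rep)

lemma chart_at_in:
  assumes "p \<in> points A"
  shows "chart_at A p \<in> A" "p \<in> fst (chart_at A p)"
proof -
  have "\<exists>c. c \<in> A \<and> p \<in> fst c" using assms unfolding points_def by blast
  from someI_ex[OF this] show "chart_at A p \<in> A" "p \<in> fst (chart_at A p)"
    unfolding chart_at_def by blast+
qed

lemma uncoord_coord:
  assumes "smooth_atlas A" "c \<in> A" "p \<in> fst c"
  shows "uncoord c (snd c p) = p"
  using assms unfolding uncoord_def smooth_atlas_def by (simp add: inv_into_f_f)

lemma uncoord_in:
  assumes "y \<in> snd c ` fst c"
  shows "uncoord c y \<in> fst c" "snd c (uncoord c y) = y"
  using assms unfolding uncoord_def by (simp_all add: inv_into_into f_inv_into_f)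

lemma coord_image_iff:
  assumes "smooth_atlas A" "c \<in> A"
  shows "y \<in> snd c ` (fst c \<inter> W) \<longleftrightarrow> y \<in> snd c ` fst c \<and> uncoord c y \<in> W"
  using uncoord_coord[OF assms] uncoord_in[of y c] by (auto simp: image_iff)

lemma open_coord_image: "\<lbrakk>smooth_atlas A; c \<in> A\<rbrakk> \<Longrightarrow> open (snd c ` fst c)"
  by (simp add: smooth_atlas_def)

lemma smooth_map_id: "smooth_atlas A \<Longrightarrow> smooth_map A A (\<lambda>p. p)"
  unfolding smooth_map_def smooth_atlas_def by (auto simp: comp_def)

lemma smooth_map_rep:
  assumes "smooth_map A B f" "c \<in> A" "d \<in> B"
  shows "open (snd c ` (fst c \<inter> f -` fst d))" "smooth_on (snd c ` (fst c \<inter> f -` fst d)) (rep c d f)"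
  using assms unfolding smooth_map_def comp_eq_rep by blast+

lemma has_derivative_rep:
  assumes "smooth_map A B f" "c \<in> A" "d \<in> B" "p \<in> fst c" "f p \<in> fst d"
  shows "(rep c d f has_derivative drep c d f p) (at (snd c p))"
  unfolding drep_def
  by (rule smooth_on_has_derivative[OF smooth_map_rep(2)[OF assms(1-3)]]) (use assms in auto)

lemma drep_comp:
  assumes "smooth_atlas A" "smooth_atlas B" "smooth_map A B f" "smooth_map B C g"
    and "c \<in> A" "d \<in> B" "d' \<in> C" "p \<in> fst c" "f p \<in> fst d" "g (f p) \<in> fst d'"
  shows "drep c d' (\<lambda>p. g (f p)) p v = drep d d' g (f p) (drep c d f p v)"
proof -
  let ?W = "snd c ` (fst c \<inter> f -` fst d)"
  have f: "(rep c d f has_derivative drep c d f p) (at (snd c p))"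
    by (rule has_derivative_rep[OF assms(3,5,6,8,9)])
  have "rep c d f (snd c p) = snd d (f p)"
    by (simp add: rep_def uncoord_coord[OF assms(1,5,8)])
  then have g: "(rep d d' g has_derivative drep d d' g (f p)) (at (rep c d f (snd c p)))"
    using has_derivative_rep[OF assms(4,6,7,9,10)] by simp
  have "(rep c d' (\<lambda>p. g (f p)) has_derivative (\<lambda>v. drep d d' g (f p) (drep c d f p v))) (at (snd c p))"
  proof (rule has_derivative_transform_within_open[OF has_derivative_compose[OF f g]])
    show "open ?W" by (rule smooth_map_rep(1)[OF assms(3,5,6)])
    show "snd c p \<in> ?W" using assms by auto
    show "rep d d' g (rep c d f y) = rep c d' (\<lambda>p. g (f p)) y" if "y \<in> ?W" for y
      using that uncoord_coord[OF assms(2,6)] coord_image_iff[OF assms(1,5)] by (auto simp: rep_def)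
  qed
  from frechet_derivative_at[OF this] show ?thesis unfolding drep_def by metis
qed

lemma drep_id_same:
  assumes "smooth_atlas A" "c \<in> A" "p \<in> fst c"
  shows "drep c c (\<lambda>p. p) p v = v"
proof -
  have "(rep c c (\<lambda>p. p) has_derivative (\<lambda>v. v)) (at (snd c p))"
    by (rule has_derivative_transform_within_open[OF has_derivative_ident open_coord_image[OF assms(1,2)]])
       (use assms in \<open>auto simp: rep_def uncoord_in\<close>)
  from frechet_derivative_at[OF this] show ?thesis unfolding drep_def by metis
qed

lemma smooth_map_prod_rep:
  fixes A :: "('m, 'a::euclidean_space) chart set" and B :: "('n, 'b::euclidean_space) chart set"
    and C :: "('k, 'c::euclidean_space) chart set"
  assumes "smooth_atlas A" "smooth_atlas B" "c \<in> A" "d \<in> B" "e \<in> C"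
    and f: "smooth_map (prod_atlas A B) C (\<lambda>(x, y). f x y)"
  defines "W \<equiv> {(x, y). x \<in> snd c ` fst c \<and> y \<in> snd d ` fst d \<and> f (uncoord c x) (uncoord d y) \<in> fst e}"
  shows "open W" "smooth_on W (\<lambda>(x, y). snd e (f (uncoord c x) (uncoord d y)))"
proof -
  let ?c = "(fst c \<times> fst d, \<lambda>(x, y). (snd c x, snd d y))"
  have c: "?c \<in> prod_atlas A B" using assms(3,4) unfolding prod_atlas_def by blast
  have inj: "inj_on (snd ?c) (fst ?c)"
    using assms(1-4) unfolding smooth_atlas_def inj_on_def by auto
  have unc: "uncoord ?c (x, y) = (uncoord c x, uncoord d y)"
    if "x \<in> snd c ` fst c" "y \<in> snd d ` fst d" for x y
    unfolding uncoord_def[of ?c]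
    by (rule inv_into_f_eq[OF inj]) (use that in \<open>auto simp: uncoord_in\<close>)
  have W: "snd ?c ` (fst ?c \<inter> (\<lambda>(x, y). f x y) -` fst e) = W"
  proof (rule equalityI; rule subsetI)
    fix z assume "z \<in> snd ?c ` (fst ?c \<inter> (\<lambda>(x, y). f x y) -` fst e)"
    then show "z \<in> W" using uncoord_coord[OF assms(1,3)] uncoord_coord[OF assms(2,4)] by (auto simp: W_def)
  next
    fix z assume "z \<in> W"
    then have "z = snd ?c (uncoord c (fst z), uncoord d (snd z))"
      "(uncoord c (fst z), uncoord d (snd z)) \<in> fst ?c \<inter> (\<lambda>(x, y). f x y) -` fst e"
      by (auto simp: W_def uncoord_in)
    then show "z \<in> snd ?c ` (fst ?c \<inter> (\<lambda>(x, y). f x y) -` fst e)" by (rule image_eqI)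
  qed
  note r = smooth_map_rep[OF f c assms(5), unfolded W]
  show "open W" by (rule r(1))
  show "smooth_on W (\<lambda>(x, y). snd e (f (uncoord c x) (uncoord d y)))"
    by (rule smooth_on_cong[OF r(1) _ r(2)]) (auto simp: rep_def unc W_def)
qed

text \<open>Provides the smoothness of left translations from that of the group product: in charts,
  fixing the first argument is a slice.\<close>

lemma smooth_map_partial:
  assumes "smooth_atlas A" "smooth_atlas B" "smooth_map (prod_atlas A B) C (\<lambda>(x, y). f x y)"
    and "x \<in> points A" "\<And>y. y \<in> points B \<Longrightarrow> f x y \<in> points C"
  shows "smooth_map B C (f x)"
  unfolding smooth_map_def
proof (intro conjI ballI)
  show "f x ` points B \<subseteq> points C" using assms(5) by auto
next
  fix c d assume c: "c \<in> B" and d: "d \<in> C"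
  let ?a = "chart_at A x"
  note a = chart_at_in[OF assms(4)]
  define W where "W = {(x, y). x \<in> snd ?a ` fst ?a \<and> y \<in> snd c ` fst c \<and> f (uncoord ?a x) (uncoord c y) \<in> fst d}"
  note W = smooth_map_prod_rep[OF assms(1,2) a(1) c d assms(3), folded W_def]
  let ?T = "snd c ` (fst c \<inter> f x -` fst d)"
  have T: "?T = {y. (snd ?a x, y) \<in> W}"
    unfolding W_def
    using coord_image_iff[OF assms(2) c] uncoord_coord[OF assms(1) a] uncoord_coord[OF assms(2) c] a(2) by auto
  show o: "open ?T" unfolding T by (rule open_slice(2)[OF W(1)])
  have "smooth_on ?T (\<lambda>y. (\<lambda>(x, y). snd d (f (uncoord ?a x) (uncoord c y))) (snd ?a x, y))"
    by (rule smooth_on_slice_right[OF o _ W(2)]) (use T in blast)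
  then show "smooth_on ?T (snd d \<circ> f x \<circ> uncoord c)"
    by (simp add: comp_def uncoord_coord[OF assms(1) a])
qed

section \<open>The Ricci curvature of a homogeneous space\<close>

locale split_space =
  fixes k :: "'g::euclidean_space set" and j :: "'p::euclidean_space \<Rightarrow> 'g"
  assumes splitting: "splitting k j"
begin

abbreviation "pp \<equiv> p_part k j"
abbreviation "kp \<equiv> k_part k j"

lemma subspace_k: "subspace k" and linear_j: "linear j"
  using splitting by (simp_all add: splitting_def)

lemma k_part_in: "kp x \<in> k"
proof -
  have "\<exists>!X. x - j X \<in> k" using splitting by (simp add: splitting_def)
  from theI'[OF this] show ?thesis by (simp add: k_part_def p_part_def)
qed

lemma decompose: "x = kp x + j (pp x)"
  by (simp add: k_part_def)

lemma p_part_eqI: "x - j X \<in> k \<Longrightarrow> pp x = X"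
  using splitting unfolding p_part_def splitting_def by (intro the1_equality) auto

lemma linear_p_part: "linear pp"
proof (rule linearI)
  fix x y :: 'g and c :: real
  have "(x + y) - j (pp x + pp y) = kp x + kp y"
    by (simp add: k_part_def linear_add[OF linear_j])
  then show "pp (x + y) = pp x + pp y"
    using subspace_add[OF subspace_k k_part_in k_part_in] by (intro p_part_eqI) metis
  have "c *\<^sub>R x - j (c *\<^sub>R pp x) = c *\<^sub>R kp x"
    by (simp add: k_part_def linear_scale[OF linear_j] scaleR_diff_right)
  then show "pp (c *\<^sub>R x) = c *\<^sub>R pp x"
    using subspace_scale[OF subspace_k k_part_in] by (intro p_part_eqI) metis
qed

lemma linear_k_part: "linear kp"
  using linear_compose_sub[OF linear_ident linear_compose[OF linear_p_part linear_j]]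
  by (simp add: k_part_def[abs_def] comp_def)

lemma p_part_j [simp]: "pp (j X) = X"
  using subspace_0[OF subspace_k] by (intro p_part_eqI) simp

lemma p_part_k: "z \<in> k \<Longrightarrow> pp z = 0"
  by (intro p_part_eqI) (simp add: linear_0[OF linear_j])

lemma k_part_k: "z \<in> k \<Longrightarrow> kp z = z"
  by (simp add: k_part_def p_part_k linear_0[OF linear_j])

lemma k_part_j [simp]: "kp (j X) = 0"
  by (simp add: k_part_def)

lemma k_part_k_part [simp]: "kp (kp x) = kp x" and p_part_k_part [simp]: "pp (kp x) = 0"
  by (simp_all add: k_part_k p_part_k k_part_in)

lemmas split_simps =
  linear_add[OF linear_p_part] linear_scale[OF linear_p_part] linear_add[OF linear_k_part]
  linear_scale[OF linear_k_part] linear_add[OF linear_j] linear_scale[OF linear_j]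
  linear_diff[OF linear_p_part] linear_diff[OF linear_k_part] linear_diff[OF linear_j]
  linear_0[OF linear_p_part] linear_0[OF linear_k_part] linear_0[OF linear_j]

end

section \<open>A model of G/K in the charts at the identity and the origin\<close>

locale homogeneous_space = split_space k j
  for k :: "'g::euclidean_space set" and j :: "'p::euclidean_space \<Rightarrow> 'g" +
  fixes \<mu> :: "'g bilin_map" and M :: "('g, 'p) hom_space"
  assumes hom_space: "is_hom_space_of k j \<mu> M"
begin

abbreviation "G \<equiv> grp M"
abbreviation "A \<equiv> grp_atlas M"
abbreviation "B \<equiv> quot_atlas M"
abbreviation "o\<^sub>M \<equiv> isotropy M"
abbreviation "\<theta> \<equiv> alg_iso M"
abbreviation "cG \<equiv> chart_at A \<one>\<^bsub>G\<^esub>"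
abbreviation "cB \<equiv> chart_at B o\<^sub>M"

lemma lie_group: "lie_group G A"
  using hom_space by (simp add: is_hom_space_of_def is_lie_group_of_def)

sublocale grp: group G using lie_group by (simp add: lie_group_def)

lemma atlas: "smooth_atlas A" "smooth_atlas B"
  using hom_space lie_group by (simp_all add: is_hom_space_of_def lie_group_def smooth_manifold_def)

lemma points_A: "points A = carrier G"
  using lie_group by (simp add: lie_group_def)

lemma points_B: "points B = lcosets\<^bsub>G\<^esub> o\<^sub>M"
  using hom_space by (simp add: is_hom_space_of_def)

lemma subgroup_isotropy: "subgroup o\<^sub>M G"
proof -
  have "\<gamma> 1 \<in> carrier G" if "one_parameter_subgroup G A \<gamma>" for \<gamma>
  proof -
    have "\<gamma> ` points (open_atlas UNIV) \<subseteq> points A"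
      using that by (simp add: one_parameter_subgroup_def smooth_map_def)
    moreover have "points (open_atlas UNIV) = (UNIV :: real set)" by (simp add: points_def open_atlas_def)
    ultimately show ?thesis by (auto simp: points_A)
  qed
  then have "{\<gamma> 1 |\<gamma>. one_parameter_subgroup G A \<gamma> \<and> mderiv (open_atlas UNIV) A \<gamma> 0 1 \<in> \<theta> ` k} \<subseteq> carrier G"
    by blast
  from grp.generate_is_subgroup[OF this] show ?thesis
    using hom_space by (simp add: is_hom_space_of_def connected_lie_subgroup_def)
qed

lemma coset_subset: "P \<in> points B \<Longrightarrow> P \<subseteq> carrier G"
  unfolding points_B by (rule subgroup.lcosets_carrier[OF subgroup_isotropy grp.is_group])

lemma action_one: "P \<in> points B \<Longrightarrow> action M \<one>\<^bsub>G\<^esub> P = P"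
  unfolding action_def by (rule grp.lcos_mult_one[OF coset_subset])

lemma action_mult:
  "\<lbrakk>x \<in> carrier G; y \<in> carrier G; P \<in> points B\<rbrakk> \<Longrightarrow> action M (x \<otimes>\<^bsub>G\<^esub> y) P = action M x (action M y P)"
  unfolding action_def by (rule grp.lcos_m_assoc[OF coset_subset, symmetric])

lemma isotropy_point: "o\<^sub>M \<in> points B"
  using grp.lcos_mult_one[OF subgroup.subset[OF subgroup_isotropy]]
  unfolding points_B LCOSETS_def by (auto intro!: bexI[of _ "\<one>\<^bsub>G\<^esub>"])

lemma action_isometry: "x \<in> carrier G \<Longrightarrow> isometry B (metric M) B (metric M) (action M x)"
  using hom_space by (simp add: is_hom_space_of_def)

lemma action_smooth: "x \<in> carrier G \<Longrightarrow> smooth_map B B (action M x)"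
  using action_isometry by (simp add: isometry_def diffeo_def)

lemma cG: "cG \<in> A" "\<one>\<^bsub>G\<^esub> \<in> fst cG"
  using chart_at_in[of "\<one>\<^bsub>G\<^esub>" A] by (simp_all add: points_A)

lemma cB: "cB \<in> B" "o\<^sub>M \<in> fst cB"
  using chart_at_in[OF isotropy_point] by simp_all

lemma in_points: "c \<in> C \<Longrightarrow> p \<in> fst c \<Longrightarrow> p \<in> points C"
  unfolding points_def by blast

lemma mult_smooth: "smooth_map (prod_atlas A A) A (\<lambda>(x, y). x \<otimes>\<^bsub>G\<^esub> y)"
  using lie_group by (simp add: lie_group_def)

lemma left_mult_smooth: "x \<in> carrier G \<Longrightarrow> smooth_map A A (\<lambda>y. x \<otimes>\<^bsub>G\<^esub> y)"
  by (rule smooth_map_partial[OF atlas(1,1) mult_smooth]) (simp_all add: points_A)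

definition S :: "'p set" where "S = snd cB ` fst cB"

definition h :: "'p \<Rightarrow> 'p \<Rightarrow> 'p \<Rightarrow> real" where "h = metric_in B cB (metric M)"

definition \<Omega> :: "('g \<times> 'p) set" where
  "\<Omega> = {(a, y). a \<in> snd cG ` fst cG \<and> y \<in> S \<and> action M (uncoord cG a) (uncoord cB y) \<in> fst cB}"

definition \<Phi> :: "'g \<times> 'p \<Rightarrow> 'p" where
  "\<Phi> = (\<lambda>(a, y). snd cB (action M (uncoord cG a) (uncoord cB y)))"

definition \<Omega>m :: "('g \<times> 'g) set" where
  "\<Omega>m = {(a, b). a \<in> snd cG ` fst cG \<and> b \<in> snd cG ` fst cG \<and> uncoord cG a \<otimes>\<^bsub>G\<^esub> uncoord cG b \<in> fst cG}"

definition m :: "'g \<times> 'g \<Rightarrow> 'g" where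
  "m = (\<lambda>(a, b). snd cG (uncoord cG a \<otimes>\<^bsub>G\<^esub> uncoord cG b))"

lemma S_point: "y \<in> S \<Longrightarrow> uncoord cB y \<in> fst cB" "y \<in> S \<Longrightarrow> uncoord cB y \<in> points B"
  using uncoord_in(1)[of y cB] in_points[OF cB(1)] by (auto simp: S_def)

lemma h_eq:
  assumes "y \<in> S"
  shows "h y v w = metric M (uncoord cB y)
     (drep cB (chart_at B (uncoord cB y)) (\<lambda>p. p) (uncoord cB y) v)
     (drep cB (chart_at B (uncoord cB y)) (\<lambda>p. p) (uncoord cB y) w)"
  using assms uncoord_in(2)[of y cB] by (simp add: h_def metric_in_def drep_def comp_eq_rep_id S_def Let_def)

lemma metric_props:
  assumes "p \<in> points B"
  shows "bilinear (metric M p)" "metric M p v w = metric M p w v" "v \<noteq> 0 \<Longrightarrow> metric M p v v > 0"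
  using assms hom_space by (auto simp: is_hom_space_of_def riemannian_metric_def)

text \<open>The metric is stored in the preferred chart of each point and pulled back to
  \<open>cB\<close> by the coordinate change. The reverse coordinate change is a linear left
  inverse, so that definiteness survives.\<close>

lemma local_metric: "local_metric S h"
proof
  show "open S" unfolding S_def by (rule open_coord_image[OF atlas(2) cB(1)])
  show "smooth_on S (\<lambda>y. h y v w)" for v w
    using hom_space cB(1) by (simp add: is_hom_space_of_def riemannian_metric_def h_def S_def)
next
  fix y assume y: "y \<in> S"
  define p where "p = uncoord cB y"
  let ?d = "chart_at B p"
  have p: "p \<in> fst cB" "p \<in> points B" using S_point[OF y] by (simp_all add: p_def)
  note d = chart_at_in[OF p(2)]
  have lin: "linear (drep cB ?d (\<lambda>p. p) p)"
    by (rule has_derivative_linear[OF has_derivative_rep[OF smooth_map_id[OF atlas(2)] cB(1) d(1)]])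
       (use p d in auto)
  have inj: "v = 0" if "drep cB ?d (\<lambda>p. p) p v = 0" for v
  proof -
    have "drep ?d cB (\<lambda>p. p) p (drep cB ?d (\<lambda>p. p) p v) = v"
      using drep_comp[OF atlas(2,2) smooth_map_id[OF atlas(2)] smooth_map_id[OF atlas(2)] cB(1) d(1) cB(1) p(1) d(2) p(1)]
        drep_id_same[OF atlas(2) cB(1) p(1)] by simp
    moreover have "linear (drep ?d cB (\<lambda>p. p) p)"
      by (rule has_derivative_linear[OF has_derivative_rep[OF smooth_map_id[OF atlas(2)] d(1) cB(1)]])
         (use p d in auto)
    ultimately show ?thesis using that linear_0 by fastforce
  qed
  note mb = metric_props(1)[OF p(2)]
  note he = h_eq[OF y, folded p_def]
  show "bilinear (h y)"
    unfolding bilinear_def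
    by (auto intro!: linearI simp: he linear_add[OF lin] linear_scale[OF lin] bilinear_ladd[OF mb]
        bilinear_radd[OF mb] bilinear_lmul[OF mb] bilinear_rmul[OF mb])
  show "h y v w = h y w v" for v w unfolding he by (rule metric_props(2)[OF p(2)])
  show "0 < h y v v" if "v \<noteq> 0" for v
    unfolding he using inj that by (intro metric_props(3)[OF p(2)]) blast
qed

lemma Omega_smooth: "open \<Omega>" "smooth_on \<Omega> \<Phi>"
proof -
  have "smooth_map (prod_atlas A B) B (\<lambda>(x, P). action M x P)"
    using hom_space by (simp add: is_hom_space_of_def)
  from smooth_map_prod_rep[OF atlas cG(1) cB(1) cB(1) this]
  show "open \<Omega>" "smooth_on \<Omega> \<Phi>" unfolding \<Omega>_def \<Phi>_def S_def by simp_all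
qed

lemma Omega_m_smooth: "open \<Omega>m" "smooth_on \<Omega>m m"
  using smooth_map_prod_rep[OF atlas(1,1) cG(1) cG(1) cG(1) mult_smooth]
  unfolding \<Omega>m_def m_def by simp_all

lemma uncoord_e: "uncoord cG (snd cG \<one>\<^bsub>G\<^esub>) = \<one>\<^bsub>G\<^esub>"
  by (rule uncoord_coord[OF atlas(1) cG])

lemma cG_carrier: "a \<in> snd cG ` fst cG \<Longrightarrow> uncoord cG a \<in> carrier G"
  using uncoord_in(1)[of a cG] in_points[OF cG(1)] by (simp add: points_A)

lemma frechet_act:
  assumes "(a, y) \<in> \<Omega>"
  shows "frechet_derivative \<Phi> (at (a, y)) (0, u)
       = drep cB cB (action M (uncoord cG a)) (uncoord cB y) u"
proof -
  have "((\<lambda>y. \<Phi> (a, y)) has_derivative (\<lambda>d. frechet_derivative \<Phi> (at (a, y)) (0, d))) (at y)"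
    by (rule has_derivative_slices(2)[OF smooth_on_has_derivative[OF Omega_smooth(2) assms]])
  moreover have "(\<lambda>y. \<Phi> (a, y)) = rep cB cB (action M (uncoord cG a))"
    by (simp add: fun_eq_iff rep_def \<Phi>_def)
  moreover have "snd cB (uncoord cB y) = y" using assms by (auto simp: \<Omega>_def S_def uncoord_in)
  ultimately show ?thesis unfolding drep_def using frechet_derivative_at by metis
qed

sublocale act: local_action S h \<Omega> \<Phi> \<Omega>m m "snd cG \<one>\<^bsub>G\<^esub>"
proof (intro local_action.intro local_metric local_action_axioms.intro)
  show "open \<Omega>" "smooth_on \<Omega> \<Phi>" "open \<Omega>m" "smooth_on \<Omega>m m"
    by (rule Omega_smooth Omega_m_smooth)+
  show "\<Phi> (a, y) \<in> S" if "(a, y) \<in> \<Omega>" for a y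
    using that by (auto simp: \<Omega>_def \<Phi>_def S_def)
  show "(snd cG \<one>\<^bsub>G\<^esub>, y) \<in> \<Omega>" if "y \<in> S" for y
    using that S_point[OF that] cG by (auto simp: \<Omega>_def uncoord_e action_one)
  show "\<Phi> (snd cG \<one>\<^bsub>G\<^esub>, y) = y" if "y \<in> S" for y
    using that S_point[OF that] by (auto simp: \<Phi>_def uncoord_e action_one S_def uncoord_in)
  show "(snd cG \<one>\<^bsub>G\<^esub>, snd cG \<one>\<^bsub>G\<^esub>) \<in> \<Omega>m"
    using cG by (auto simp: \<Omega>m_def uncoord_e)
  show "m (snd cG \<one>\<^bsub>G\<^esub>, b) = b" if "(snd cG \<one>\<^bsub>G\<^esub>, b) \<in> \<Omega>m" for b
    using that by (auto simp: \<Omega>m_def m_def uncoord_e cG_carrier uncoord_in)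
  show "m (a, snd cG \<one>\<^bsub>G\<^esub>) = a" if "(a, snd cG \<one>\<^bsub>G\<^esub>) \<in> \<Omega>m" for a
    using that by (auto simp: \<Omega>m_def m_def uncoord_e cG_carrier uncoord_in)
next
  fix a b y
  assume *: "(a, b) \<in> \<Omega>m" "(m (a, b), y) \<in> \<Omega>" "(b, y) \<in> \<Omega>" "(a, \<Phi> (b, y)) \<in> \<Omega>"
  let ?x = "uncoord cG a" and ?x' = "uncoord cG b" and ?P = "uncoord cB y"
  have x: "?x \<in> carrier G" "?x' \<in> carrier G" using * by (auto simp: \<Omega>_def \<Omega>m_def cG_carrier)
  have P: "?P \<in> points B" using * S_point by (auto simp: \<Omega>_def)
  have "uncoord cG (m (a, b)) = ?x \<otimes>\<^bsub>G\<^esub> ?x'"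
    using * uncoord_coord[OF atlas(1) cG(1)] by (auto simp: \<Omega>m_def m_def)
  moreover have "uncoord cB (\<Phi> (b, y)) = action M ?x' ?P"
    using * uncoord_coord[OF atlas(2) cB(1)] by (auto simp: \<Omega>_def \<Phi>_def)
  ultimately show "\<Phi> (m (a, b), y) = \<Phi> (a, \<Phi> (b, y))"
    by (simp add: \<Phi>_def action_mult[OF x P])
next
  fix a y u w assume *: "(a, y) \<in> \<Omega>"
  define f where "f = action M (uncoord cG a)"
  define p where "p = uncoord cB y"
  define q where "q = f p"
  let ?dp = "chart_at B p" and ?dq = "chart_at B q"
  have y: "y \<in> S" using * by (auto simp: \<Omega>_def)
  have p: "p \<in> fst cB" "p \<in> points B" using S_point[OF y] by (simp_all add: p_def)
  have q: "q \<in> fst cB" using * by (auto simp: \<Omega>_def q_def f_def p_def)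
  then have qB: "q \<in> points B" using in_points[OF cB(1)] by simp
  have fs: "smooth_map B B f" unfolding f_def using * by (intro action_smooth) (auto simp: \<Omega>_def cG_carrier)
  note dp = chart_at_in[OF p(2)] and dq = chart_at_in[OF qB]
  have Phi: "\<Phi> (a, y) \<in> S" "uncoord cB (\<Phi> (a, y)) = q"
    using * q uncoord_coord[OF atlas(2) cB(1) q] by (auto simp: \<Phi>_def S_def q_def p_def f_def)
  \<comment> \<open>\<open>isometry\<close> speaks of \<open>mderiv\<close>, hence of the preferred
    charts at p and q, while the local action uses \<open>cB\<close> for both points. The chain rule
    for f with a coordinate change on either side translates one into the other.\<close>
  have chain: "drep cB ?dq (\<lambda>p. p) q (drep cB cB f p u) = mderiv B B f p (drep cB ?dp (\<lambda>p. p) p u)" for u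
  proof -
    have "drep cB ?dq f p u = drep cB ?dq (\<lambda>p. p) q (drep cB cB f p u)"
      using drep_comp[OF atlas(2,2) fs smooth_map_id[OF atlas(2)] cB(1) cB(1) dq(1) p(1)] q dq(2)
      by (simp add: q_def)
    moreover have "drep cB ?dq f p u = drep ?dp ?dq f p (drep cB ?dp (\<lambda>p. p) p u)"
      using drep_comp[OF atlas(2,2) smooth_map_id[OF atlas(2)] fs cB(1) dp(1) dq(1) p(1) dp(2)] dq(2)
      by (simp add: q_def)
    ultimately show ?thesis by (simp add: mderiv_eq_drep q_def)
  qed
  have iso: "metric M q (mderiv B B f p v) (mderiv B B f p w) = metric M p v w" for v w
    using action_isometry[of "uncoord cG a"] * p(2) unfolding isometry_def q_def f_def
    by (auto simp: \<Omega>_def cG_carrier)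
  show "h (\<Phi> (a, y)) (frechet_derivative \<Phi> (at (a, y)) (0, u)) (frechet_derivative \<Phi> (at (a, y)) (0, w)) = h y u w"
    unfolding frechet_act[OF *] h_eq[OF Phi(1)] h_eq[OF y] Phi(2)
    by (simp add: chain iso flip: f_def p_def)
qed

lemma lie_bracket_eq: "lie_bracket G A v w = act.local_bracket v w"
proof -
  let ?e = "snd cG \<one>\<^bsub>G\<^esub>"
  obtain U where U: "open U" "?e \<in> U" "\<And>a. a \<in> U \<Longrightarrow> (a, ?e) \<in> \<Omega>m" "\<And>w. smooth_on U (act.L w)"
    using act.smooth_L by blast
  \<comment> \<open>The left-invariant field is stored at each p in the preferred chart there, and
    \<open>field_in\<close> converts it to \<open>cG\<close>. Together this is the derivative of
    left translation in the single chart \<open>cG\<close>.\<close>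
  have field: "field_in A cG (left_invariant_field G A w) a = act.L w a" if "(a, ?e) \<in> \<Omega>m" for w a
  proof -
    define p where "p = uncoord cG a"
    let ?d = "chart_at A p"
    have a: "a \<in> snd cG ` fst cG" using that by (auto simp: \<Omega>m_def)
    have p: "p \<in> carrier G" "p \<in> fst cG" using a by (auto simp: p_def cG_carrier uncoord_in)
    have d: "?d \<in> A" "p \<in> fst ?d" using chart_at_in[of p A] p by (auto simp: points_A)
    have "field_in A cG (left_invariant_field G A w) a
        = drep ?d cG (\<lambda>p. p) p (drep cG ?d (\<lambda>y. p \<otimes>\<^bsub>G\<^esub> y) \<one>\<^bsub>G\<^esub> w)"
      using p by (simp add: field_in_def left_invariant_field_def mderiv_eq_drep Let_def comp_eq_rep_id drep_def
          flip: p_def)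
    also have "\<dots> = drep cG cG (\<lambda>y. p \<otimes>\<^bsub>G\<^esub> y) \<one>\<^bsub>G\<^esub> w"
      using drep_comp[OF atlas(1,1) left_mult_smooth[OF p(1)] smooth_map_id[OF atlas(1)] cG(1) d(1) cG(1) cG(2)] p d
      by simp
    also have "\<dots> = act.L w a"
    proof -
      have "((\<lambda>b. m (a, b)) has_derivative (\<lambda>d. frechet_derivative m (at (a, ?e)) (0, d))) (at ?e)"
        by (rule has_derivative_slices(2)[OF act.has_derivative_m[OF that]])
      moreover have "(\<lambda>b. m (a, b)) = rep cG cG (\<lambda>y. p \<otimes>\<^bsub>G\<^esub> y)"
        by (simp add: fun_eq_iff rep_def m_def p_def)
      ultimately show ?thesis unfolding drep_def act.L_def using frechet_derivative_at by metis
    qed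
    finally show ?thesis .
  qed
  have fd: "frechet_derivative (field_in A cG (left_invariant_field G A w)) (at ?e)
      = frechet_derivative (act.L w) (at ?e)" for w
  proof -
    have "(field_in A cG (left_invariant_field G A w) has_derivative frechet_derivative (act.L w) (at ?e)) (at ?e)"
      by (rule has_derivative_transform_within_open[OF smooth_on_has_derivative[OF U(4,2)] U(1,2)])
         (simp add: field U(3))
    then show ?thesis using frechet_derivative_at by metis
  qed
  have "left_invariant_field G A v \<one>\<^bsub>G\<^esub> = v" for v
  proof -
    have "drep cG cG (\<lambda>y. \<one>\<^bsub>G\<^esub> \<otimes>\<^bsub>G\<^esub> y) \<one>\<^bsub>G\<^esub> v = v"
    proof -
      have "(rep cG cG (\<lambda>y. \<one>\<^bsub>G\<^esub> \<otimes>\<^bsub>G\<^esub> y) has_derivative (\<lambda>v. v)) (at ?e)"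
        by (rule has_derivative_transform_within_open[OF has_derivative_ident open_coord_image[OF atlas(1) cG(1)]])
           (use cG in \<open>auto simp: rep_def uncoord_in cG_carrier uncoord_coord[OF atlas(1) cG(1)] in_points[OF cG(1), unfolded points_A]\<close>)
      from frechet_derivative_at[OF this] show ?thesis unfolding drep_def by metis
    qed
    then show ?thesis by (simp add: left_invariant_field_def mderiv_eq_drep)
  qed
  then show ?thesis
    by (simp add: lie_bracket_def field_bracket_def Let_def fd act.local_bracket_def)
qed

lemma isotropy_S: "snd cB o\<^sub>M \<in> S" "uncoord cB (snd cB o\<^sub>M) = o\<^sub>M"
  using cB uncoord_coord[OF atlas(2) cB] by (auto simp: S_def)

text \<open>The projection from G to G/K is the orbit map of the origin, so its differential at the
  unit gives the values of the fundamental fields there.\<close>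

lemma to_tangent_eq: "to_tangent M x = act.fundamental_field (\<theta> x) (snd cB o\<^sub>M)"
proof -
  have "((\<lambda>a. \<Phi> (a, snd cB o\<^sub>M)) has_derivative (\<lambda>d. act.D (snd cG \<one>\<^bsub>G\<^esub>, snd cB o\<^sub>M) (d, 0))) (at (snd cG \<one>\<^bsub>G\<^esub>))"
    by (rule has_derivative_slices(1)[OF act.has_derivative_act[OF act.Omega_e[OF isotropy_S(1)]]])
  moreover have "(\<lambda>a. \<Phi> (a, snd cB o\<^sub>M)) = rep cG cB (\<lambda>x. action M x o\<^sub>M)"
    by (simp add: fun_eq_iff rep_def \<Phi>_def isotropy_S)
  ultimately have "drep cG cB (\<lambda>x. action M x o\<^sub>M) \<one>\<^bsub>G\<^esub> v = act.D (snd cG \<one>\<^bsub>G\<^esub>, snd cB o\<^sub>M) (v, 0)" for v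
    unfolding drep_def using frechet_derivative_at by metis
  then show ?thesis
    by (simp add: to_tangent_def mderiv_eq_drep act.fundamental_field_def action_one[OF isotropy_point])
qed

lemma metric_to_tangent:
  "metric M o\<^sub>M (to_tangent M x) (to_tangent M y) = p_part k j x \<bullet> p_part k j y"
  using hom_space unfolding is_hom_space_of_def by blast

text \<open>Everything that depends on the model disappears: \<open>\<theta>\<close> carries the
  bracket to that of G, and the metric condition at the origin turns inner products of fundamental
  fields into those of the p-parts. In particular j supplies the orthonormal frame for the
  trace.\<close>

theorem ricci_tensor_isotropy:
  "ricci_tensor B (metric M) o\<^sub>M (to_tangent M x) (to_tangent M z)
   = ricci_form (\<lambda>a b. p_part k j a \<bullet> p_part k j b) (\<lambda>a b. \<mu> a b) j x z"
proof -
  let ?y = "snd cB o\<^sub>M"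
  interpret K: killing_fields S h act.fundamental_field act.local_bracket by (rule act.killing_fields)
  have \<theta>: "\<theta> (\<mu> a b) = act.local_bracket (\<theta> a) (\<theta> b)" for a b
    using hom_space by (simp add: is_hom_space_of_def is_lie_group_of_def lie_bracket_eq)
  interpret K': killing_fields S h "\<lambda>a. act.fundamental_field (\<theta> a)" "\<lambda>a b. \<mu> a b"
    by unfold_locales (auto simp: \<theta> K.smooth_xi K.killing K.bracket)
  have h: "h ?y v w = metric M o\<^sub>M v w" for v w
    unfolding h_eq[OF isotropy_S(1)] isotropy_S(2) by (simp add: drep_id_same[OF atlas(2) cB])
  have "K'.Q ?y = (\<lambda>a b. p_part k j a \<bullet> p_part k j b)"
    by (intro ext) (simp add: K'.Q_def h metric_to_tangent flip: to_tangent_eq)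
  moreover have "(\<Sum>b\<in>Basis. curvature h ?y b (act.fundamental_field (\<theta> x) ?y) (act.fundamental_field (\<theta> z) ?y) \<bullet> b)
      = ricci_form (K'.Q ?y) (\<lambda>a b. \<mu> a b) j x z"
    by (rule K'.ricci_killing_fields[OF isotropy_S(1)])
       (simp add: h metric_to_tangent p_part_j inner_Basis flip: to_tangent_eq)
  ultimately show ?thesis
    by (simp add: ricci_tensor_def Let_def h_def to_tangent_eq)
qed

end

section \<open>Brackets on \<open>\<gg> = \<kk> \<oplus> \<pp>\<close>\<close>

context split_space
begin

abbreviation "diag_id \<equiv> block_diag k j id"

lemma diag_id_eq: "diag_id E x = kp x + j (E (pp x))"
  by (simp add: block_diag_def)

lemma p_part_diag_id [simp]: "pp (diag_id E x) = E (pp x)"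
  by (simp add: diag_id_eq split_simps)

lemma k_part_diag_id [simp]: "kp (diag_id E x) = kp x"
  by (simp add: diag_id_eq split_simps)

lemma diag_id_k: "linear E \<Longrightarrow> z \<in> k \<Longrightarrow> diag_id E z = z"
  by (simp add: diag_id_eq p_part_k k_part_k linear_0 split_simps)

lemma diag_id_j [simp]: "diag_id E (j X) = j (E X)"
  by (simp add: diag_id_eq)

lemma linear_diag_id: "linear E \<Longrightarrow> linear (diag_id E)"
  by (rule linearI) (simp_all add: diag_id_eq split_simps linear_add linear_scale algebra_simps)

lemma diag_id_inverse:
  assumes "\<And>X. E (E' X) = X"
  shows "diag_id E (diag_id E' x) = x"
  using decompose[of x] by (simp add: diag_id_eq[of E] assms)

lemma bij_diag_id:
  assumes "\<And>X. E (E' X) = X" "\<And>X. E' (E X) = X"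
  shows "bij (diag_id E)" "the_inv (diag_id E) = diag_id E'"
proof -
  note i = diag_id_inverse[of E E', OF assms(1)] diag_id_inverse[of E' E, OF assms(2)]
  show b: "bij (diag_id E)" by (rule bijI'[where f="diag_id E"]) (metis i)+
  show "the_inv (diag_id E) = diag_id E'"
    by (rule ext) (metis b bij_is_inj i(1) the_inv_f_f)
qed

lemma gl_act_diag_id:
  assumes "linear E" "linear E'" "\<And>X. E (E' X) = X" "\<And>X. E' (E X) = X"
  shows "gl_act (diag_id E) \<mu> x y = diag_id E (\<mu> (diag_id E' x) (diag_id E' y))"
proof -
  note l = linear_diag_id[OF assms(1)] linear_diag_id[OF assms(2)]
  have "bilinear (\<lambda>x y. diag_id E (\<mu> (diag_id E' x) (diag_id E' y)))"
    unfolding bilinear_def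
    by (auto intro!: linearI simp: linear_add[OF l(1)] linear_add[OF l(2)] linear_scale[OF l(1)]
        linear_scale[OF l(2)] blinfun.add_left blinfun.add_right blinfun.scaleR_left blinfun.scaleR_right)
  then show ?thesis
    unfolding gl_act_def bij_diag_id(2)[of E E', OF assms(3,4)] by (rule to_bilin_apply)
qed

lemma pi_rep_apply:
  assumes "linear E"
  shows "pi_rep E \<mu> x y = E (\<mu> x y) - \<mu> (E x) y - \<mu> x (E y)"
proof -
  have "bilinear (\<lambda>x y. E (\<mu> x y) - \<mu> (E x) y - \<mu> x (E y))"
    unfolding bilinear_def
    by (auto intro!: linearI simp: linear_add[OF assms] linear_scale[OF assms] algebra_simps
        blinfun.add_left blinfun.add_right blinfun.scaleR_left blinfun.scaleR_right)
  then show ?thesis unfolding pi_rep_def by (rule to_bilin_apply)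
qed

lemma linear_diag_zero: "linear E \<Longrightarrow> linear (block_diag k j (\<lambda>_. 0) E)"
  by (rule linearI) (simp_all add: block_diag_def split_simps linear_add linear_scale)

subsection \<open>Invariance of \<open>\<H>\<^bsub>q,n\<^esub>\<close>\<close>

definition isotropy_rep :: "'g bilin_map \<Rightarrow> 'g \<Rightarrow> 'p \<Rightarrow> 'p" where
  "isotropy_rep \<mu> z X = pp (\<mu> z (j X))"

lemma hom_bracketsD:
  assumes "\<mu> \<in> hom_brackets k j"
  shows "\<mu> x y = - \<mu> y x" "jacobi \<mu>" "\<lbrakk>z \<in> k; w \<in> k\<rbrakk> \<Longrightarrow> \<mu> z w \<in> k"
    "z \<in> k \<Longrightarrow> \<mu> z (j X) = j (isotropy_rep \<mu> z X)"
    "z \<in> k \<Longrightarrow> isotropy_rep \<mu> z X \<bullet> Y = - (X \<bullet> isotropy_rep \<mu> z Y)"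
    "\<lbrakk>z \<in> k; \<And>X. \<mu> z (j X) = 0\<rbrakk> \<Longrightarrow> z = 0"
    "\<exists>G A \<theta>. is_lie_group_of \<mu> G A \<theta> \<and> closedin (manifold_topology A) (connected_lie_subgroup G A (\<theta> ` k))"
proof -
  note * = assms[unfolded hom_brackets_def mem_Collect_eq]
  have "\<forall>x y. \<mu> x y = - \<mu> y x" using * unfolding skew_brackets_def mem_Collect_eq by (elim conjE)
  then show "\<mu> x y = - \<mu> y x" by (drule_tac x=x in spec, drule_tac x=y in spec)
  show "jacobi \<mu>" using * by (elim conjE)
  show "\<mu> z w \<in> k" if "z \<in> k" "w \<in> k" using * that by (elim conjE) (drule (1) bspec, drule (1) bspec)
  show "\<mu> z (j X) = j (isotropy_rep \<mu> z X)" if "z \<in> k"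
  proof -
    have "\<forall>z\<in>k. \<forall>X. \<mu> z (j X) \<in> range j" using * by (elim conjE)
    from spec[OF bspec[OF this that]] obtain Y where "\<mu> z (j X) = j Y" by (rule rangeE)
    then show ?thesis by (simp add: isotropy_rep_def)
  qed
  show "isotropy_rep \<mu> z X \<bullet> Y = - (X \<bullet> isotropy_rep \<mu> z Y)" if "z \<in> k"
    using * that unfolding isotropy_rep_def by (elim conjE) (drule (1) bspec, elim allE)
  show "z = 0" if "z \<in> k" "\<And>X. \<mu> z (j X) = 0"
  proof -
    have "z \<in> {z \<in> k. \<forall>X. \<mu> z (j X) = 0}" using that by simp
    also have "\<dots> = {0}" using * by (elim conjE)
    finally show ?thesis by simp
  qed
  show "\<exists>G A \<theta>. is_lie_group_of \<mu> G A \<theta> \<and> closedin (manifold_topology A) (connected_lie_subgroup G A (\<theta> ` k))"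
    using * by (elim conjE)
qed

lemma is_lie_group_of_transport:
  fixes \<mu> \<nu> :: "'g bilin_map"
  assumes "is_lie_group_of \<mu> G A \<theta>" "linear P'"
    and P: "\<And>x. P (P' x) = x" "\<And>x. P' (P x) = x"
    and hom: "\<And>x y. P (\<mu> x y) = \<nu> (P x) (P y)"
  shows "is_lie_group_of \<nu> G A (\<theta> \<circ> P')"
proof -
  have "bij P'" by (rule bijI'[where f=P']) (metis P)+
  moreover have "P' (\<nu> x y) = \<mu> (P' x) (P' y)" for x y
    using hom[of "P' x" "P' y"] P by metis
  ultimately show ?thesis
    using assms(1,2) unfolding is_lie_group_of_def
    by (auto intro: linear_compose bij_comp)
qed

text \<open>K is determined by the image of k in the tangent space of G. Fixing k pointwise
  therefore leaves the very same subgroup, and with it the coset space.\<close>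

lemma image_transport:
  assumes "\<And>x. P' (P x) = x" "\<And>z. z \<in> k \<Longrightarrow> P z = z"
  shows "(\<theta> \<circ> P') ` k = \<theta> ` k"
proof -
  have "P' z = z" if "z \<in> k" for z using assms(1)[of z] assms(2)[OF that] by simp
  then show ?thesis by (simp add: image_image cong: image_cong)
qed

text \<open>Commutation with the isotropy representation keeps the brackets of k with k and with p
  unchanged, which settles the algebraic conditions involving k. For the closedness of K, the same
  group serves with a new identification.\<close>

lemma gl_act_in_hom_brackets:
  assumes \<mu>: "\<mu> \<in> hom_brackets k j"
    and E: "linear E" "linear E'" "\<And>X. E (E' X) = X" "\<And>X. E' (E X) = X"
    and comm: "\<And>z X. z \<in> k \<Longrightarrow> isotropy_rep \<mu> z (E X) = E (isotropy_rep \<mu> z X)"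
  shows "gl_act (diag_id E) \<mu> \<in> hom_brackets k j"
proof -
  let ?\<nu> = "gl_act (diag_id E) \<mu>" and ?H = "diag_id E" and ?H' = "diag_id E'"
  note nu = gl_act_diag_id[OF E, of \<mu>]
  note hd = hom_bracketsD[OF \<mu>]
  note inv = diag_id_inverse[of E E', OF E(3)] diag_id_inverse[of E' E, OF E(4)]
  note lin = linear_diag_id[OF E(1)] linear_diag_id[OF E(2)]
  have kk: "?\<nu> z w = \<mu> z w" if "z \<in> k" "w \<in> k" for z w
    using that hd(3)[OF that] by (simp add: nu diag_id_k E)
  have kp: "?\<nu> z (j X) = \<mu> z (j X)" if "z \<in> k" for z X
    using that hd(4)[OF that] comm[OF that, of "E' X"] E(3)
    by (simp add: nu diag_id_k E)
  have "?\<nu> \<in> skew_brackets"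
  proof -
    have "?\<nu> x y = - ?\<nu> y x" for x y
      using hd(1)[of "?H' x" "?H' y"] by (simp add: nu linear_neg[OF lin(1)])
    then show ?thesis unfolding skew_brackets_def mem_Collect_eq by (intro allI)
  qed
  moreover have "jacobi ?\<nu>"
  proof -
    have "?\<nu> (?\<nu> x y) z + ?\<nu> (?\<nu> y z) x + ?\<nu> (?\<nu> z x) y
        = ?H (\<mu> (\<mu> (?H' x) (?H' y)) (?H' z) + \<mu> (\<mu> (?H' y) (?H' z)) (?H' x) + \<mu> (\<mu> (?H' z) (?H' x)) (?H' y))"
      for x y z by (simp only: nu inv linear_add[OF lin(1)])
    then show ?thesis using hd(2) by (simp add: jacobi_def linear_0[OF lin(1)])
  qed
  moreover have "\<forall>z\<in>k. \<forall>w\<in>k. ?\<nu> z w \<in> k" using kk hd(3) by simp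
  moreover have "\<forall>z\<in>k. \<forall>X. ?\<nu> z (j X) \<in> range j" using kp hd(4) by simp
  moreover have "\<exists>G A \<theta>. is_lie_group_of ?\<nu> G A \<theta> \<and>
      closedin (manifold_topology A) (connected_lie_subgroup G A (\<theta> ` k))"
  proof -
    obtain G A \<theta> where G: "is_lie_group_of \<mu> G A \<theta>"
      "closedin (manifold_topology A) (connected_lie_subgroup G A (\<theta> ` k))" using hd(7) by blast
    have "is_lie_group_of ?\<nu> G A (\<theta> \<circ> ?H')"
      by (rule is_lie_group_of_transport[OF G(1) lin(2) inv]) (simp add: nu inv)
    moreover have "(\<theta> \<circ> ?H') ` k = \<theta> ` k"
      by (rule image_transport[where P="?H"]) (auto simp: inv diag_id_k E)
    ultimately show ?thesis using G(2) by (metis (no_types))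
  qed
  moreover have "\<forall>z\<in>k. \<forall>X Y. pp (?\<nu> z (j X)) \<bullet> Y = - (X \<bullet> pp (?\<nu> z (j Y)))"
    using hd(5) by (simp add: kp isotropy_rep_def)
  moreover have "{z \<in> k. \<forall>X. ?\<nu> z (j X) = 0} = {0}"
    using hd(6) subspace_0[OF subspace_k] by (auto simp: kp)
  ultimately show ?thesis unfolding hom_brackets_def by blast
qed

subsection \<open>Change of model\<close>

text \<open>The map P may move p: it fixes k pointwise and is orthogonal only modulo k, which is
  what a block diagonal map composed with e^(tD) can offer. The isometry is the identity of G/K,
  written as the action of the unit because a model already provides isometries in this
  form.\<close>

lemma is_hom_space_of_transport:
  fixes \<mu> \<nu> :: "'g bilin_map"
  assumes M: "is_hom_space_of k j \<mu> M"
    and P: "linear P'" "\<And>x. P (P' x) = x" "\<And>x. P' (P x) = x" "\<And>z. z \<in> k \<Longrightarrow> P z = z"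
    and hom: "\<And>x y. P (\<mu> x y) = \<nu> (P x) (P y)"
    and orth: "\<And>x y. pp (P x) \<bullet> pp (P y) = pp x \<bullet> pp y"
  defines "N \<equiv> M\<lparr>alg_iso := alg_iso M \<circ> P'\<rparr>"
  shows "is_hom_space_of k j \<nu> N" "to_tangent N x = to_tangent M (P' x)"
    "isometry (quot_atlas M) (metric M) (quot_atlas N) (metric N) (action M \<one>\<^bsub>grp M\<^esub>)"
proof -
  interpret M: homogeneous_space k j \<mu> M by unfold_locales (rule M)
  have act: "action N = action M" by (simp add: fun_eq_iff action_def N_def)
  show tt: "to_tangent N x = to_tangent M (P' x)" for x
    unfolding to_tangent_def act by (simp add: N_def)
  have "metric N (isotropy N) (to_tangent N x) (to_tangent N y) = pp x \<bullet> pp y" for x y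
    unfolding tt using M.metric_to_tangent[of "P' x" "P' y"] orth[of "P' x" "P' y"]
    by (simp add: N_def P)
  moreover have "is_lie_group_of \<nu> (grp M) (grp_atlas M) (alg_iso M \<circ> P')"
  proof (rule is_lie_group_of_transport[OF _ P(1-3) hom])
    show "is_lie_group_of \<mu> (grp M) (grp_atlas M) (alg_iso M)"
      using M unfolding is_hom_space_of_def by blast
  qed
  moreover have im: "(alg_iso M \<circ> P') ` k = alg_iso M ` k"
    by (rule image_transport[where P=P, OF P(3,4)])
  moreover have N: "grp N = grp M" "grp_atlas N = grp_atlas M" "alg_iso N = alg_iso M \<circ> P'"
    "isotropy N = isotropy M" "quot_atlas N = quot_atlas M" "metric N = metric M"
    by (simp_all add: N_def)
  ultimately show "is_hom_space_of k j \<nu> N"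
    using M unfolding is_hom_space_of_def act N im by blast
  show "isometry (quot_atlas M) (metric M) (quot_atlas N) (metric N) (action M \<one>\<^bsub>grp M\<^esub>)"
    using M.action_isometry[OF M.grp.one_closed] by (simp add: N_def)
qed

section \<open>The Ricci operator as a function of the bracket\<close>

definition rform :: "'g bilin_map \<Rightarrow> 'p \<Rightarrow> 'p \<Rightarrow> real" where
  "rform \<mu> X Y = ricci_form (\<lambda>a b. pp a \<bullet> pp b) (\<lambda>a b. \<mu> a b) j (j X) (j Y)"

text \<open>Removes the model hidden in \<open>is_ricci_operator\<close> and so determines R
  uniquely; along a flow, the operator and its model are chosen anew at each time.\<close>

lemma is_ricci_operator_rform:
  assumes "is_ricci_operator k j \<mu> R"
  shows "R X \<bullet> Y = rform \<mu> X Y"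
proof -
  obtain M where M: "is_hom_space_of k j \<mu> M"
    "\<And>X Y. R X \<bullet> Y = ricci_tensor (quot_atlas M) (metric M) (isotropy M) (to_tangent M (j X)) (to_tangent M (j Y))"
    using assms unfolding is_ricci_operator_def by blast
  interpret M: homogeneous_space k j \<mu> M by unfold_locales (rule M)
  show ?thesis by (simp add: M(2) M.ricci_tensor_isotropy rform_def)
qed

lemma ricci_operator_transport:
  fixes \<mu> \<nu> :: "'g bilin_map"
  assumes R: "is_ricci_operator k j \<mu> R"
    and P: "linear P'" "\<And>x. P (P' x) = x" "\<And>x. P' (P x) = x" "\<And>z. z \<in> k \<Longrightarrow> P z = z"
    and hom: "\<And>x y. P (\<mu> x y) = \<nu> (P x) (P y)"
    and pP: "\<And>x. pp (P x) = U (pp x)" and U: "linear U" "linear U'" "\<And>X. U (U' X) = X" "\<And>X. U' (U X) = X"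
      "\<And>X Y. U X \<bullet> U Y = X \<bullet> Y"
  shows "is_ricci_operator k j \<nu> (\<lambda>X. U (R (U' X)))" "isometric_brackets k j \<mu> \<nu>"
proof -
  obtain M where M: "is_hom_space_of k j \<mu> M"
    "\<And>X Y. R X \<bullet> Y = ricci_tensor (quot_atlas M) (metric M) (isotropy M) (to_tangent M (j X)) (to_tangent M (j Y))"
    using R unfolding is_ricci_operator_def by blast
  interpret M: homogeneous_space k j \<mu> M by unfold_locales (rule M)
  define N where "N = M\<lparr>alg_iso := alg_iso M \<circ> P'\<rparr>"
  have orth: "pp (P x) \<bullet> pp (P y) = pp x \<bullet> pp y" for x y by (simp add: pP U)
  note tr = is_hom_space_of_transport[OF M(1) P hom orth, folded N_def]
  \<comment> \<open>P' maps \<open>j X\<close> to \<open>j (U' X)\<close> only modulo k. The two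
    have the same p-part, so the difference of their images has length 0 at the origin, and
    definiteness of the metric makes the tangent vectors equal.\<close>
  have tt: "to_tangent N (j X) = to_tangent M (j (U' X))" for X
  proof -
    have "pp (P' (j X)) = U' X" using pP[of "P' (j X)"] U(4) P(2) by (metis p_part_j)
    then have pz: "pp (P' (j X)) = pp (j (U' X))" by simp
    let ?a = "to_tangent M (P' (j X))" and ?b = "to_tangent M (j (U' X))"
    note mb = M.metric_props(1)[OF M.isotropy_point]
    have "metric M (isotropy M) (?a - ?b) (?a - ?b) = 0"
      by (simp add: bilinear_lsub[OF mb] bilinear_rsub[OF mb] M.metric_to_tangent pz)
    then have "?a = ?b"
      using M.metric_props(3)[OF M.isotropy_point, of "?a - ?b"] by force
    then show ?thesis by (simp add: tr(2))
  qed
  have "U (R (U' X)) \<bullet> Y = ricci_tensor (quot_atlas N) (metric N) (isotropy N) (to_tangent N (j X)) (to_tangent N (j Y))" for X Y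
  proof -
    have "U (R (U' X)) \<bullet> Y = R (U' X) \<bullet> U' Y" using U(5)[of "R (U' X)" "U' Y"] by (simp add: U)
    then show ?thesis unfolding tt M(2) by (simp add: N_def)
  qed
  moreover have "linear (\<lambda>X. U (R (U' X)))"
    using R U linear_compose[OF linear_compose[OF U(2)] U(1), of R] by (simp add: is_ricci_operator_def comp_def)
  ultimately show "is_ricci_operator k j \<nu> (\<lambda>X. U (R (U' X)))"
    unfolding is_ricci_operator_def using tr(1) by blast
  show "isometric_brackets k j \<mu> \<nu>"
    unfolding isometric_brackets_def using M(1) tr(1,3) by blast
qed

subsection \<open>Rescaling\<close>

lemma rescale_apply:
  "rescale k j a \<mu> x y = \<mu> (kp x) (kp y) + \<mu> (kp x) (j (pp y)) + \<mu> (j (pp x)) (kp y)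
     + a\<^sup>2 *\<^sub>R kp (\<mu> (j (pp x)) (j (pp y))) + a *\<^sub>R j (pp (\<mu> (j (pp x)) (j (pp y))))"
proof -
  have "bilinear (\<lambda>x y. let x\<^sub>k = kp x; x\<^sub>p = j (pp x); y\<^sub>k = kp y; y\<^sub>p = j (pp y); m = \<mu> x\<^sub>p y\<^sub>p
      in \<mu> x\<^sub>k y\<^sub>k + \<mu> x\<^sub>k y\<^sub>p + \<mu> x\<^sub>p y\<^sub>k + a\<^sup>2 *\<^sub>R kp m + a *\<^sub>R j (pp m))"
    unfolding bilinear_def Let_def
    by (auto intro!: linearI simp: split_simps algebra_simps
        blinfun.add_left blinfun.add_right blinfun.scaleR_left blinfun.scaleR_right)
  from to_bilin_apply[OF this] show ?thesis unfolding rescale_def Let_def .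
qed

lemma gl_act_scale:
  assumes E: "linear E" "linear E'" "\<And>X. E (E' X) = X" "\<And>X. E' (E X) = X" and "a > 0"
  shows "gl_act (diag_id (\<lambda>X. (1 / a) *\<^sub>R E X)) \<mu> x y
    = diag_id (\<lambda>X. (1 / a) *\<^sub>R X) (gl_act (diag_id E) \<mu> (diag_id (\<lambda>X. a *\<^sub>R X) x) (diag_id (\<lambda>X. a *\<^sub>R X) y))"
proof -
  have E1: "linear (\<lambda>X. (1 / a) *\<^sub>R E X)" "linear (\<lambda>X. E' (a *\<^sub>R X))"
    using E by (auto intro!: linearI simp: linear_add linear_scale algebra_simps)
  have E2: "(1 / a) *\<^sub>R E (E' (a *\<^sub>R X)) = X" "E' (a *\<^sub>R ((1 / a) *\<^sub>R E X)) = X" for X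
    using E \<open>a > 0\<close> by simp_all
  have "gl_act (diag_id (\<lambda>X. (1 / a) *\<^sub>R E X)) \<mu> x y
      = diag_id (\<lambda>X. (1 / a) *\<^sub>R E X) (\<mu> (diag_id (\<lambda>X. E' (a *\<^sub>R X)) x) (diag_id (\<lambda>X. E' (a *\<^sub>R X)) y))"
    by (rule gl_act_diag_id[OF E1 E2])
  then show ?thesis
    unfolding gl_act_diag_id[OF E] by (simp add: diag_id_eq split_simps)
qed

text \<open>Geometric rescaling by a is the action of the block matrix that divides p by a: each
  argument in p contributes a factor a, and a result in p contributes 1/a. For k with p the factors
  cancel because this bracket stays in p.\<close>

lemma rescale_gl_act:
  assumes \<mu>: "\<mu> \<in> hom_brackets k j"
    and E: "linear E" "linear E'" "\<And>X. E (E' X) = X" "\<And>X. E' (E X) = X"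
    and comm: "\<And>z X. z \<in> k \<Longrightarrow> isotropy_rep \<mu> z (E X) = E (isotropy_rep \<mu> z X)"
    and "a > 0"
  shows "gl_act (diag_id (\<lambda>X. (1 / a) *\<^sub>R E X)) \<mu> = rescale k j a (gl_act (diag_id E) \<mu>)"
proof (intro blinfun_eqI)
  fix x y
  define \<nu> where "\<nu> = gl_act (diag_id E) \<mu>"
  have \<nu>: "\<nu> \<in> hom_brackets k j" unfolding \<nu>_def by (rule gl_act_in_hom_brackets[OF \<mu> E comm])
  note hd = hom_bracketsD[OF \<nu>]
  define C where "C = diag_id (\<lambda>X. (1 / a) *\<^sub>R X)"
  define C' where "C' = diag_id (\<lambda>X. a *\<^sub>R X)"
  have "gl_act (diag_id (\<lambda>X. (1 / a) *\<^sub>R E X)) \<mu> x y = C (\<nu> (C' x) (C' y))"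
    unfolding \<nu>_def C_def C'_def by (rule gl_act_scale[OF E \<open>a > 0\<close>])
  also have "\<nu> (C' x) (C' y) = \<nu> (kp x) (kp y) + a *\<^sub>R \<nu> (kp x) (j (pp y)) + a *\<^sub>R \<nu> (j (pp x)) (kp y)
      + a\<^sup>2 *\<^sub>R \<nu> (j (pp x)) (j (pp y))"
    by (simp add: C'_def diag_id_eq split_simps blinfun.add_left blinfun.add_right blinfun.scaleR_left
        blinfun.scaleR_right algebra_simps power2_eq_square)
  also have "C \<dots> = \<nu> (kp x) (kp y) + \<nu> (kp x) (j (pp y)) + \<nu> (j (pp x)) (kp y)
      + (a\<^sup>2 *\<^sub>R kp (\<nu> (j (pp x)) (j (pp y))) + a *\<^sub>R j (pp (\<nu> (j (pp x)) (j (pp y)))))"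
  proof -
    have lC: "linear C" unfolding C_def by (rule linear_diag_id) (simp add: linear_scale_self)
    have 1: "C (\<nu> (kp x) (kp y)) = \<nu> (kp x) (kp y)"
      unfolding C_def by (rule diag_id_k) (auto simp: linear_scale_self intro: hd k_part_in)
    have 2: "C (\<nu> (kp x) (j (pp y))) = (1 / a) *\<^sub>R \<nu> (kp x) (j (pp y))"
      unfolding hd(4)[OF k_part_in] C_def by (simp add: split_simps)
    have 3: "C (\<nu> (j (pp x)) (kp y)) = (1 / a) *\<^sub>R \<nu> (j (pp x)) (kp y)"
    proof -
      have "\<nu> (j (pp x)) (kp y) = j (- isotropy_rep \<nu> (kp y) (pp x))"
        using hd(1)[of "j (pp x)" "kp y"] hd(4)[OF k_part_in, of y "pp x"] by (simp add: linear_neg[OF linear_j])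
      moreover have "C (j X) = (1 / a) *\<^sub>R j X" for X unfolding C_def by (simp add: linear_scale[OF linear_j])
      ultimately show ?thesis by simp
    qed
    have 4: "C v = kp v + (1 / a) *\<^sub>R j (pp v)" for v
      by (simp add: C_def diag_id_eq split_simps)
    have "a\<^sup>2 * (1 / a) = a" using \<open>a > 0\<close> by (simp add: power2_eq_square)
    then show ?thesis
      using \<open>a > 0\<close> by (simp add: linear_add[OF lC] linear_scale[OF lC] 1 2 3 4[of "\<nu> (j (pp x)) (j (pp y))"] scaleR_add_right)
  qed
  finally show "gl_act (diag_id (\<lambda>X. (1 / a) *\<^sub>R E X)) \<mu> x y = rescale k j a (gl_act (diag_id E) \<mu>) x y"
    by (simp only: rescale_apply \<nu>_def add.assoc)
qed

text \<open>Division by a on p intertwines the two brackets and multiplies Q by 1/a^2. Since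
  \<open>j X\<close> is its value at \<open>a *\<^sub>R j X\<close>, an expression in three vectors
  of p scales by a^3/a^2 and one in four by a^4/a^2. Each term of the Ricci form is a product of two
  of the first kind or one of the second, hence scales by a^2.\<close>

lemma rform_scale:
  fixes \<nu> \<nu>' :: "'g bilin_map"
  assumes "a > 0" and \<nu>': "\<And>x y. \<nu>' x y = diag_id (\<lambda>X. (1 / a) *\<^sub>R X) (\<nu> (diag_id (\<lambda>X. a *\<^sub>R X) x) (diag_id (\<lambda>X. a *\<^sub>R X) y))"
  shows "rform \<nu>' X Y = a\<^sup>2 * rform \<nu> X Y"
proof -
  let ?C = "diag_id (\<lambda>X. (1 / a) *\<^sub>R X)" and ?C' = "diag_id (\<lambda>X. a *\<^sub>R X)"
  have CC: "?C' (?C x) = x" for x by (rule diag_id_inverse) (use assms in simp)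
  have br: "\<nu>' (?C x) (?C y) = ?C (\<nu> x y)" for x y by (simp add: \<nu>' CC)
  have e: "j X = ?C (a *\<^sub>R j X)" for X using assms by (simp add: split_simps diag_id_eq)
  have ppC: "pp (?C x) \<bullet> pp (?C y) = (1 / a\<^sup>2) * (pp x \<bullet> pp y)" for x y
    by (simp add: power2_eq_square)
  let ?Q = "\<lambda>a b. pp a \<bullet> pp b"
  have K: "koszul ?Q (\<lambda>a b. \<nu>' a b) (?C x) (?C y) (?C z) = (1 / a\<^sup>2) * koszul ?Q (\<lambda>a b. \<nu> a b) x y z" for x y z
    unfolding koszul_def br ppC by (simp add: algebra_simps)
  have KD: "koszul_deriv ?Q (\<lambda>a b. \<nu>' a b) (?C w) (?C x) (?C y) (?C z)
      = (1 / a\<^sup>2) * koszul_deriv ?Q (\<lambda>a b. \<nu> a b) w x y z" for w x y z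
    unfolding koszul_deriv_def br ppC by (simp add: algebra_simps)
  note sc = blinfun.scaleR_left blinfun.scaleR_right split_simps
  have K3: "koszul ?Q (\<lambda>a b. \<nu> a b) (a *\<^sub>R x) (a *\<^sub>R y) (a *\<^sub>R z) = a^3 * koszul ?Q (\<lambda>a b. \<nu> a b) x y z" for x y z
    by (simp add: koszul_def sc algebra_simps power3_eq_cube)
  have K4: "koszul ?Q (\<lambda>a b. \<nu> a b) (\<nu> (a *\<^sub>R w) (a *\<^sub>R x)) (a *\<^sub>R y) (a *\<^sub>R z)
      = a^4 * koszul ?Q (\<lambda>a b. \<nu> a b) (\<nu> w x) y z" for w x y z
    by (simp add: koszul_def sc algebra_simps power4_eq_xxxx)
  have KD4: "koszul_deriv ?Q (\<lambda>a b. \<nu> a b) (a *\<^sub>R w) (a *\<^sub>R x) (a *\<^sub>R y) (a *\<^sub>R z)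
      = a^4 * koszul_deriv ?Q (\<lambda>a b. \<nu> a b) w x y z" for w x y z
    by (simp add: koszul_deriv_def sc algebra_simps power4_eq_xxxx)
  have a4: "1 / a\<^sup>2 * (a^4 * t) = a\<^sup>2 * t" "1 / a\<^sup>2 * (a^3 * t) = a * t" for t
    using assms(1) by (simp_all add: power2_eq_square power4_eq_xxxx power3_eq_cube)
  have F3: "koszul ?Q (\<lambda>a b. \<nu>' a b) (j x) (j y) (j z) = a * koszul ?Q (\<lambda>a b. \<nu> a b) (j x) (j y) (j z)" for x y z
    unfolding a4(2)[symmetric] K3[symmetric] K[symmetric] e[symmetric] ..
  have F4: "koszul ?Q (\<lambda>a b. \<nu>' a b) (\<nu>' (j w) (j x)) (j y) (j z)
      = a\<^sup>2 * koszul ?Q (\<lambda>a b. \<nu> a b) (\<nu> (j w) (j x)) (j y) (j z)" for w x y z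
    unfolding a4(1)[symmetric] K4[symmetric] K[symmetric] br[symmetric] e[symmetric] ..
  have FD: "koszul_deriv ?Q (\<lambda>a b. \<nu>' a b) (j w) (j x) (j y) (j z)
      = a\<^sup>2 * koszul_deriv ?Q (\<lambda>a b. \<nu> a b) (j w) (j x) (j y) (j z)" for w x y z
    unfolding a4(1)[symmetric] KD4[symmetric] KD[symmetric] e[symmetric] ..
  show ?thesis
    unfolding rform_def ricci_form_def F3 F4 FD
    by (simp add: sum_distrib_left algebra_simps power2_eq_square)
qed

end

section \<open>Exponentials of linear maps\<close>

lemma lin_exp_pow_bound:
  fixes L :: "'a::euclidean_space \<Rightarrow> 'a"
  assumes "linear L"
  shows "\<exists>K\<ge>0. \<forall>i x. norm ((L ^^ i) x) \<le> K ^ i * norm x"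
proof -
  obtain K where K: "K > 0" "\<And>x. norm (L x) \<le> norm x * K"
    using assms bounded_linear.pos_bounded by (auto simp: linear_conv_bounded_linear)
  have "norm ((L ^^ i) x) \<le> K ^ i * norm x" for i x
  proof (induction i)
    case (Suc i)
    have "norm ((L ^^ Suc i) x) \<le> norm ((L ^^ i) x) * K" using K(2) by simp
    also have "\<dots> \<le> K ^ i * norm x * K" using Suc K(1) by (intro mult_right_mono) auto
    finally show ?case by (simp add: algebra_simps)
  qed simp
  then show ?thesis using K(1) by (intro exI[of _ K]) auto
qed

lemma lin_exp_summable:
  fixes L :: "'a::euclidean_space \<Rightarrow> 'a"
  assumes "linear L"
  shows "summable (\<lambda>i. (L ^^ i) x /\<^sub>R fact i)"
proof -
  obtain K where K: "K \<ge> 0" "\<And>i x. norm ((L ^^ i) x) \<le> K ^ i * norm x"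
    using lin_exp_pow_bound[OF assms] by blast
  have "summable (\<lambda>i. norm x * (inverse (fact i) * K ^ i))"
    by (intro summable_mult summable_exp)
  then show ?thesis
    by (rule summable_comparison_test'[where N=0])
       (use K(2)[of _ x] in \<open>simp add: field_simps\<close>)
qed

lemma funpow_scaleR:
  fixes L :: "'a::real_vector \<Rightarrow> 'a"
  assumes "linear L"
  shows "((\<lambda>x. t *\<^sub>R L x) ^^ i) x = t ^ i *\<^sub>R (L ^^ i) x"
  by (induction i) (simp_all add: linear_scale[OF assms])

lemma linear_scaled: "linear L \<Longrightarrow> linear (\<lambda>x. t *\<^sub>R L x)"
  by (rule linear_compose_scale_right)

lemma lin_exp_zero:
  fixes L :: "'a::real_normed_vector \<Rightarrow> 'a"
  assumes "linear L"
  shows "lin_exp (\<lambda>x. 0 *\<^sub>R L x) x = x"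
proof -
  have "(\<lambda>i. (0 ^ i *\<^sub>R (L ^^ i) x) /\<^sub>R fact i) = (\<lambda>i. if i = 0 then x else 0)"
    by (simp add: fun_eq_iff)
  then show ?thesis
    unfolding lin_exp_def funpow_scaleR[OF assms] using sums_single[of 0 "\<lambda>_. x"] by (simp add: sums_iff)
qed

text \<open>Serves four times: L commutes with its exponential, exponentials pass to the quotient p
  and to the isotropy representation, and vectors killed by D are fixed by e^(tD).\<close>

lemma lin_exp_intertwine:
  fixes L :: "'a::euclidean_space \<Rightarrow> 'a" and f :: "'a \<Rightarrow> 'b::euclidean_space"
  assumes "linear L" "linear f" "\<And>x. f (L x) = L' (f x)"
  shows "f (lin_exp L x) = lin_exp L' (f x)"
proof -
  have p: "f ((L ^^ i) x) = (L' ^^ i) (f x)" for i by (induction i) (simp_all add: assms(3))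
  have bl: "bounded_linear f" using assms(2) by (simp add: linear_conv_bounded_linear)
  have "f (lin_exp L x) = (\<Sum>i. f ((L ^^ i) x /\<^sub>R fact i))"
    unfolding lin_exp_def by (rule bounded_linear.suminf[OF bl lin_exp_summable[OF assms(1)]])
  also have "\<dots> = lin_exp L' (f x)"
    by (simp add: lin_exp_def linear_scale[OF assms(2)] p)
  finally show ?thesis .
qed

lemma linear_lin_exp:
  fixes L :: "'a::euclidean_space \<Rightarrow> 'a"
  assumes "linear L"
  shows "linear (lin_exp L)"
proof (rule linearI)
  have lp: "linear (L ^^ i)" for i
    by (induction i) (simp_all add: linear_compose[OF _ assms, unfolded comp_def] linear_id[unfolded id_def] comp_def id_def)
  note s = lin_exp_summable[OF assms]
  show "lin_exp L (x + y) = lin_exp L x + lin_exp L y" for x y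
    unfolding lin_exp_def by (simp add: linear_add[OF lp] scaleR_add_right suminf_add[OF s s])
  show "lin_exp L (c *\<^sub>R x) = c *\<^sub>R lin_exp L x" for c x
    using bounded_linear.suminf[OF bounded_linear_scaleR_right s, of c x]
    by (simp add: lin_exp_def linear_scale[OF lp] mult.commute)
qed

text \<open>In each component the exponential is a scalar power series in t converging everywhere,
  so that it may be differentiated termwise.\<close>

lemma lin_exp_has_vector_derivative:
  fixes L :: "'a::euclidean_space \<Rightarrow> 'a"
  assumes "linear L"
  shows "((\<lambda>t. lin_exp (\<lambda>x. t *\<^sub>R L x) x) has_vector_derivative L (lin_exp (\<lambda>x. t *\<^sub>R L x) x)) (at t)"
proof -
  have coord: "lin_exp (\<lambda>x. t *\<^sub>R L x) x \<bullet> b = (\<Sum>i. ((L ^^ i) x \<bullet> b / fact i) * t ^ i)"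
    "summable (\<lambda>i. ((L ^^ i) x \<bullet> b / fact i) * t ^ i)" for t b x
  proof -
    note s = lin_exp_summable[OF linear_scaled[OF assms], of t x]
    have e: "(((\<lambda>x. t *\<^sub>R L x) ^^ i) x /\<^sub>R fact i) \<bullet> b = ((L ^^ i) x \<bullet> b / fact i) * t ^ i" for i
      by (simp add: funpow_scaleR[OF assms] field_simps)
    show "lin_exp (\<lambda>x. t *\<^sub>R L x) x \<bullet> b = (\<Sum>i. ((L ^^ i) x \<bullet> b / fact i) * t ^ i)"
      unfolding lin_exp_def bounded_linear.suminf[OF bounded_linear_inner_left s] e ..
    show "summable (\<lambda>i. ((L ^^ i) x \<bullet> b / fact i) * t ^ i)"
      using bounded_linear.summable[OF bounded_linear_inner_left s, of b] unfolding e .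
  qed
  have L: "L (lin_exp (\<lambda>x. t *\<^sub>R L x) x) = lin_exp (\<lambda>x. t *\<^sub>R L x) (L x)"
    by (rule lin_exp_intertwine[OF linear_scaled[OF assms] assms]) (simp add: linear_scale[OF assms])
  have "((\<lambda>t. lin_exp (\<lambda>x. t *\<^sub>R L x) x \<bullet> b) has_derivative (\<lambda>d. (d *\<^sub>R L (lin_exp (\<lambda>x. t *\<^sub>R L x) x)) \<bullet> b)) (at t)" for b
  proof -
    have d: "diffs (\<lambda>i. (L ^^ i) x \<bullet> b / fact i) i = (L ^^ i) (L x) \<bullet> b / fact i" for i
      by (simp add: diffs_def funpow_Suc_right del: funpow.simps)
    have "((\<lambda>t. \<Sum>i. ((L ^^ i) x \<bullet> b / fact i) * t ^ i) has_field_derivative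
        (\<Sum>i. diffs (\<lambda>i. (L ^^ i) x \<bullet> b / fact i) i * t ^ i)) (at t)"
      by (rule termdiffs_strong_converges_everywhere) (rule coord)
    then show ?thesis
      unfolding coord(1)[symmetric] d L has_field_derivative_def by (simp add: mult.commute[of _ "_ \<bullet> b"])
  qed
  then show ?thesis
    unfolding has_vector_derivative_def by (subst has_derivative_componentwise_within) blast
qed

lemma lin_exp_has_derivative:
  fixes L :: "'a::euclidean_space \<Rightarrow> 'a"
  assumes "linear L"
  shows "((\<lambda>t. lin_exp (\<lambda>x. t *\<^sub>R L x) x) has_derivative (\<lambda>d. d *\<^sub>R L (lin_exp (\<lambda>x. t *\<^sub>R L x) x))) (at t)"
  using lin_exp_has_vector_derivative[OF assms] by (simp add: has_vector_derivative_def)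

lemma lin_exp_neg_has_derivative:
  fixes L :: "'a::euclidean_space \<Rightarrow> 'a"
  assumes "linear L"
  shows "((\<lambda>t. lin_exp (\<lambda>x. - t *\<^sub>R L x) x) has_derivative (\<lambda>d. - d *\<^sub>R L (lin_exp (\<lambda>x. - t *\<^sub>R L x) x))) (at t)"
proof -
  have "((\<lambda>t::real. - t) has_derivative (\<lambda>d. - d)) (at t)" by (intro has_derivative_minus has_derivative_ident)
  from has_derivative_compose[OF this lin_exp_has_derivative[OF assms]] show ?thesis by simp
qed

lemma zero_derivative_const:
  fixes f :: "real \<Rightarrow> 'a::real_normed_vector"
  assumes "\<And>t. (f has_derivative (\<lambda>d. 0)) (at t)"
  shows "f s = f t"
  using has_derivative_zero_unique[of UNIV f] assms by auto

lemma lin_exp_commute: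
  fixes L :: "'a::euclidean_space \<Rightarrow> 'a"
  assumes "linear L"
  shows "L (lin_exp (\<lambda>x. t *\<^sub>R L x) x) = lin_exp (\<lambda>x. t *\<^sub>R L x) (L x)"
  by (rule lin_exp_intertwine[OF linear_scaled[OF assms] assms]) (simp add: linear_scale[OF assms])

text \<open>The left-hand side has derivative 0 in t because L commutes with its exponential.
  Constancy in t, in place of a product of series, is also the device for orthogonality and for the
  automorphism property.\<close>

lemma lin_exp_inverse:
  fixes L :: "'a::euclidean_space \<Rightarrow> 'a"
  assumes L: "linear L"
  shows "lin_exp (\<lambda>x. - t *\<^sub>R L x) (lin_exp (\<lambda>x. t *\<^sub>R L x) x) = x"
proof -
  define e where "e t x = lin_exp (\<lambda>x. t *\<^sub>R L x) x" for t x
  have lin: "linear (e t)" for t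
    unfolding e_def[abs_def] by (rule linear_lin_exp[OF linear_scaled[OF L]])
  have de: "((\<lambda>t. e t x) has_derivative (\<lambda>d. d *\<^sub>R L (e t x))) (at t)"
    "((\<lambda>t. e (- t) x) has_derivative (\<lambda>d. - d *\<^sub>R L (e (- t) x))) (at t)" for t x
    unfolding e_def by (rule lin_exp_has_derivative[OF L] lin_exp_neg_has_derivative[OF L])+
  have com: "L (e t x) = e t (L x)" for t x unfolding e_def by (rule lin_exp_commute[OF L])
  have "((\<lambda>t. e (- t) (e t x)) has_derivative
      (\<lambda>d. - d *\<^sub>R L (e (- t) (e t x)) + e (- t) (d *\<^sub>R L (e t x)))) (at t)" for t
    by (rule has_derivative_linear_family[OF open_UNIV UNIV_I lin de(2) de(1)])
  then have "((\<lambda>t. e (- t) (e t x)) has_derivative (\<lambda>d. 0)) (at t)" for t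
    by (simp add: com linear_scale[OF lin])
  from zero_derivative_const[OF this, of t 0] have "e (- t) (e t x) = x"
    using lin_exp_zero[OF L] by (simp add: e_def)
  then show ?thesis by (simp add: e_def)
qed

lemma lin_exp_inverse':
  fixes L :: "'a::euclidean_space \<Rightarrow> 'a"
  assumes L: "linear L"
  shows "lin_exp (\<lambda>x. t *\<^sub>R L x) (lin_exp (\<lambda>x. - t *\<^sub>R L x) x) = x"
  using lin_exp_inverse[OF L, of "- t" x] by simp

lemma lin_exp_orthogonal:
  fixes A :: "'a::euclidean_space \<Rightarrow> 'a"
  assumes A: "linear A" and skew: "\<And>x y. A x \<bullet> y = - (x \<bullet> A y)"
  shows "lin_exp (\<lambda>x. t *\<^sub>R A x) x \<bullet> lin_exp (\<lambda>x. t *\<^sub>R A x) y = x \<bullet> y"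
proof -
  have "((\<lambda>t. lin_exp (\<lambda>x. t *\<^sub>R A x) x \<bullet> lin_exp (\<lambda>x. t *\<^sub>R A x) y) has_derivative
      (\<lambda>d. lin_exp (\<lambda>x. t *\<^sub>R A x) x \<bullet> (d *\<^sub>R A (lin_exp (\<lambda>x. t *\<^sub>R A x) y))
        + (d *\<^sub>R A (lin_exp (\<lambda>x. t *\<^sub>R A x) x)) \<bullet> lin_exp (\<lambda>x. t *\<^sub>R A x) y)) (at t)" for t
    by (intro has_derivative_inner lin_exp_has_derivative A)
  then have "((\<lambda>t. lin_exp (\<lambda>x. t *\<^sub>R A x) x \<bullet> lin_exp (\<lambda>x. t *\<^sub>R A x) y) has_derivative (\<lambda>d. 0)) (at t)" for t
    by (simp add: skew)
  from zero_derivative_const[OF this, of t 0] show ?thesis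
    using lin_exp_zero[OF A] by simp
qed

text \<open>Apply e^(-tD) to the right-hand side: the derivation rule cancels the two inner
  derivatives against the outer one, so the result is constant in t.\<close>

lemma lin_exp_derivation:
  fixes D :: "'g::euclidean_space \<Rightarrow> 'g" and \<mu> :: "'g bilin_map"
  assumes "D \<in> derivations \<mu>"
  shows "lin_exp (\<lambda>x. t *\<^sub>R D x) (\<mu> x y) = \<mu> (lin_exp (\<lambda>x. t *\<^sub>R D x) x) (lin_exp (\<lambda>x. t *\<^sub>R D x) y)"
proof -
  have D: "linear D" and der: "\<And>x y. D (\<mu> x y) = \<mu> (D x) y + \<mu> x (D y)"
    using assms by (simp_all add: derivations_def)
  define e where "e t x = lin_exp (\<lambda>x. t *\<^sub>R D x) x" for t x
  have lin: "linear (e t)" for t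
    unfolding e_def[abs_def] by (rule linear_lin_exp[OF linear_scaled[OF D]])
  have de: "((\<lambda>t. e t x) has_derivative (\<lambda>d. d *\<^sub>R D (e t x))) (at t)"
    "((\<lambda>t. e (- t) x) has_derivative (\<lambda>d. - d *\<^sub>R D (e (- t) x))) (at t)" for t x
    unfolding e_def by (rule lin_exp_has_derivative[OF D] lin_exp_neg_has_derivative[OF D])+
  have "((\<lambda>t. \<mu> (e t x) (e t y)) has_derivative
      (\<lambda>d. \<mu> (e t x) (d *\<^sub>R D (e t y)) + (blinfun_apply \<mu> (d *\<^sub>R D (e t x))) (e t y))) (at t)" for t
    by (rule bounded_bilinear.FDERIV[OF bounded_bilinear_blinfun_apply
          bounded_linear.has_derivative[OF blinfun.bounded_linear_right de(1)] de(1)])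
  from has_derivative_linear_family[OF open_UNIV UNIV_I lin de(2) this]
  have "((\<lambda>t. e (- t) (\<mu> (e t x) (e t y))) has_derivative
      (\<lambda>d. - d *\<^sub>R D (e (- t) (\<mu> (e t x) (e t y)))
         + e (- t) (\<mu> (e t x) (d *\<^sub>R D (e t y)) + \<mu> (d *\<^sub>R D (e t x)) (e t y)))) (at t)" for t .
  moreover have "- d *\<^sub>R D (e (- t) (\<mu> (e t x) (e t y)))
         + e (- t) (\<mu> (e t x) (d *\<^sub>R D (e t y)) + \<mu> (d *\<^sub>R D (e t x)) (e t y)) = 0" for d t
  proof -
    have "D (e (- t) (\<mu> (e t x) (e t y))) = e (- t) (D (\<mu> (e t x) (e t y)))"
      unfolding e_def by (rule lin_exp_commute[OF D])
    then show ?thesis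
      by (simp add: der linear_add[OF lin] linear_scale[OF lin] blinfun.scaleR_left blinfun.scaleR_right algebra_simps)
  qed
  ultimately have "((\<lambda>t. e (- t) (\<mu> (e t x) (e t y))) has_derivative (\<lambda>d. 0)) (at t)" for t
    by simp
  from zero_derivative_const[OF this, of t 0]
  have "e (- t) (\<mu> (e t x) (e t y)) = \<mu> x y" using lin_exp_zero[OF D] by (simp add: e_def)
  then have "e t (\<mu> x y) = e t (e (- t) (\<mu> (e t x) (e t y)))" by simp
  also have "\<dots> = \<mu> (e t x) (e t y)" unfolding e_def by (rule lin_exp_inverse'[OF D])
  finally show ?thesis by (simp add: e_def)
qed

section \<open>Ordinary differential equations\<close>

text \<open>Works in steps of length \<delta> with L' \<delta> = 1/2: if d vanishes at the left end
  of a step, its maximal norm on the step is at most half of itself.\<close>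

lemma gronwall_zero:
  fixes d :: "real \<Rightarrow> 'a::real_normed_vector"
  assumes d: "\<And>t. t \<in> {0..T} \<Longrightarrow> (d has_vector_derivative d' t) (at t within {0..T})"
    and bound: "\<And>t. t \<in> {0..T} \<Longrightarrow> norm (d' t) \<le> L * norm (d t)"
    and "d 0 = 0" "t \<in> {0..T}"
  shows "d t = 0"
proof -
  \<comment> \<open>L may be zero or negative; this constant is positive and still bounds the
    derivative.\<close>
  define L' where "L' = \<bar>L\<bar> + 1"
  have L': "L' > 0" "\<And>t. t \<in> {0..T} \<Longrightarrow> norm (d' t) \<le> L' * norm (d t)"
  proof -
    show "L' > 0" by (simp add: L'_def)
    show "norm (d' t) \<le> L' * norm (d t)" if "t \<in> {0..T}" for t
    proof -
      have "L * norm (d t) \<le> L' * norm (d t)" by (intro mult_right_mono) (auto simp: L'_def)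
      then show ?thesis using bound[OF that] by linarith
    qed
  qed
  define \<delta> where "\<delta> = 1 / (2 * L')"
  have \<delta>: "\<delta> > 0" using L' by (simp add: \<delta>_def)
  have cont: "continuous_on {0..T} d"
    unfolding continuous_on_eq_continuous_within
    by (intro ballI) (rule has_vector_derivative_continuous[OF d])
  have step: "\<forall>s\<in>{0..T}. s \<le> real n * \<delta> \<longrightarrow> d s = 0" for n
  proof (induction n)
    case 0
    then show ?case using \<open>d 0 = 0\<close> by auto
  next
    case (Suc n)
    show ?case
    proof (intro ballI impI)
      fix s assume s: "s \<in> {0..T}" "s \<le> real (Suc n) * \<delta>"
      define a where "a = real n * \<delta>"
      show "d s = 0"
      proof (cases "s \<le> a")
        case True
        then show ?thesis using Suc s by (simp add: a_def)
      next
        case False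
        have a: "0 \<le> a" "a \<le> s" "a \<in> {0..T}" using False s \<delta> by (auto simp: a_def)
        have da: "d a = 0" using Suc a by (simp add: a_def)
        have sub: "{a..s} \<subseteq> {0..T}" using a s by auto
        obtain m where m: "m \<in> {a..s}" "\<And>y. y \<in> {a..s} \<Longrightarrow> norm (d y) \<le> norm (d m)"
          using continuous_attains_sup[of "{a..s}" "\<lambda>y. norm (d y)"] a
            continuous_on_norm[OF continuous_on_subset[OF cont sub]] by auto
        have "norm (d m - d a) \<le> (L' * norm (d m)) * norm (m - a)"
        proof (rule differentiable_bound[where S="{a..s}" and f'="\<lambda>y h. h *\<^sub>R d' y"])
          show "(d has_derivative (\<lambda>h. h *\<^sub>R d' y)) (at y within {a..s})" if "y \<in> {a..s}" for y
            using has_vector_derivative_within_subset[OF d sub, of y] that sub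
            by (auto simp: has_vector_derivative_def)
          show "onorm (\<lambda>h. h *\<^sub>R d' y) \<le> L' * norm (d m)" if "y \<in> {a..s}" for y
          proof (rule onorm_le)
            have "norm (d' y) \<le> L' * norm (d m)"
              using L'(2)[of y] m(2)[OF that] that sub L'(1)
              by (meson mult_left_mono order_trans subsetD less_imp_le)
            then show "norm (h *\<^sub>R d' y) \<le> L' * norm (d m) * norm h" for h
              using mult_right_mono[of "norm (d' y)" "L' * norm (d m)" "\<bar>h\<bar>"] by (simp add: mult.commute)
          qed
          show "m \<in> {a..s}" "a \<in> {a..s}" using m(1) a by auto
        qed auto
        also have "\<dots> \<le> (L' * norm (d m)) * \<delta>"
          using m(1) s L'(1) by (intro mult_left_mono) (auto simp: a_def algebra_simps)
        also have "\<dots> = norm (d m) / 2" using L'(1) by (simp add: \<delta>_def)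
        finally have "norm (d m) = 0" using da norm_ge_zero[of "d m"] by simp
        then have "norm (d s) \<le> 0" using m(2)[of s] a(2) by (metis atLeastAtMost_iff order_refl)
        then show ?thesis by simp
      qed
    qed
  qed
  obtain n :: nat where "t / \<delta> \<le> real n" using real_arch_simple by blast
  then have "t \<le> real n * \<delta>" using \<delta> by (simp add: field_simps)
  then show ?thesis using step assms(4) by blast
qed

section \<open>Bounded linear maps through their values on a basis\<close>

lemma blinfun_eq_sum_Basis:
  fixes f :: "'a::euclidean_space \<Rightarrow>\<^sub>L 'b::real_normed_vector"
  shows "f = (\<Sum>i\<in>Basis. blinfun_scaleR_left (f i) o\<^sub>L blinfun_inner_left i)"
proof (rule blinfun_eqI)
  fix x
  have "f x = f (\<Sum>i\<in>Basis. (x \<bullet> i) *\<^sub>R i)" by (simp add: euclidean_representation)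
  also have "\<dots> = (\<Sum>i\<in>Basis. (x \<bullet> i) *\<^sub>R f i)" by (simp add: blinfun.sum_right blinfun.scaleR_right)
  finally show "f x = (\<Sum>i\<in>Basis. blinfun_scaleR_left (f i) o\<^sub>L blinfun_inner_left i) x"
    by (simp add: blinfun.sum_left)
qed

text \<open>Applied twice, this reduces differentiating a curve of brackets in norm to
  differentiating its values at fixed pairs of vectors.\<close>

lemma has_vector_derivative_blinfun:
  fixes f :: "real \<Rightarrow> 'a::euclidean_space \<Rightarrow>\<^sub>L 'b::real_normed_vector" and f' :: "'a \<Rightarrow>\<^sub>L 'b"
  assumes "\<And>i. ((\<lambda>t. f t i) has_vector_derivative f' i) (at t within T)"
  shows "(f has_vector_derivative f') (at t within T)"
proof -
  have bl: "bounded_linear (\<lambda>v. blinfun_scaleR_left v o\<^sub>L blinfun_inner_left i)" for i :: 'a and v :: 'b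
    by (rule bounded_linear_compose[OF bounded_bilinear.bounded_linear_left[OF bounded_bilinear_blinfun_compose]
          bounded_linear_blinfun_scaleR_left])
  have "((\<lambda>t. \<Sum>i\<in>Basis. blinfun_scaleR_left (f t i) o\<^sub>L blinfun_inner_left i) has_vector_derivative
      (\<Sum>i\<in>Basis. blinfun_scaleR_left (f' i) o\<^sub>L blinfun_inner_left i)) (at t within T)"
    by (intro has_vector_derivative_sum bounded_linear.has_vector_derivative[OF bl] assms)
  then show ?thesis by (simp flip: blinfun_eq_sum_Basis)
qed

lemma norm_blinfun_le_sum_Basis:
  fixes f :: "'a::euclidean_space \<Rightarrow>\<^sub>L 'b::real_normed_vector"
  shows "norm f \<le> (\<Sum>i\<in>Basis. norm (f i))"
proof (rule norm_blinfun_bound)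
  show "0 \<le> (\<Sum>i\<in>Basis. norm (f i))" by (simp add: sum_nonneg)
  fix x :: 'a
  have "f x = f (\<Sum>i\<in>Basis. (x \<bullet> i) *\<^sub>R i)" by (simp add: euclidean_representation)
  also have "\<dots> = (\<Sum>i\<in>Basis. (x \<bullet> i) *\<^sub>R f i)" by (simp add: blinfun.sum_right blinfun.scaleR_right)
  also have "norm \<dots> \<le> (\<Sum>i\<in>Basis. norm (f i) * norm x)"
  proof (rule order_trans[OF norm_sum], rule sum_mono)
    fix i :: 'a assume "i \<in> Basis"
    then show "norm ((x \<bullet> i) *\<^sub>R f i) \<le> norm (f i) * norm x"
      using mult_right_mono[OF Basis_le_norm[of i x], of "norm (f i)"] by (simp add: mult.commute)
  qed
  finally show "norm (f x) \<le> (\<Sum>i\<in>Basis. norm (f i)) * norm x" by (simp add: sum_distrib_right)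
qed

subsection \<open>Bounded Lipschitz functions\<close>

text \<open>The vector field of the flow is polynomial in the bracket, hence Lipschitz on bounded
  sets. Boundedness is carried along so that the class is closed under bounded bilinear maps and
  membership of a long expression follows by introduction rules.\<close>

definition bounded_lipschitz :: "'a::real_normed_vector set \<Rightarrow> ('a \<Rightarrow> 'b::real_normed_vector) \<Rightarrow> bool" where
  "bounded_lipschitz S f \<longleftrightarrow> (\<exists>C. \<forall>x\<in>S. norm (f x) \<le> C) \<and>
     (\<exists>K. \<forall>x\<in>S. \<forall>y\<in>S. norm (f x - f y) \<le> K * norm (x - y))"

lemma bounded_lipschitzE:
  assumes "bounded_lipschitz S f"
  obtains C K where "C \<ge> 0" "K \<ge> 0" "\<And>x. x \<in> S \<Longrightarrow> norm (f x) \<le> C"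
    "\<And>x y. \<lbrakk>x \<in> S; y \<in> S\<rbrakk> \<Longrightarrow> norm (f x - f y) \<le> K * norm (x - y)"
proof -
  obtain C K where *: "\<And>x. x \<in> S \<Longrightarrow> norm (f x) \<le> C"
    "\<And>x y. \<lbrakk>x \<in> S; y \<in> S\<rbrakk> \<Longrightarrow> norm (f x - f y) \<le> K * norm (x - y)"
    using assms unfolding bounded_lipschitz_def by blast
  show ?thesis
  proof (rule that[of "\<bar>C\<bar>" "\<bar>K\<bar>"])
    show "norm (f x) \<le> \<bar>C\<bar>" if "x \<in> S" for x using *(1)[OF that] by linarith
    show "norm (f x - f y) \<le> \<bar>K\<bar> * norm (x - y)" if "x \<in> S" "y \<in> S" for x y
    proof -
      have "K * norm (x - y) \<le> \<bar>K\<bar> * norm (x - y)" by (intro mult_right_mono) auto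
      then show ?thesis using *(2)[OF that] by linarith
    qed
  qed auto
qed

lemma bounded_lipschitz_const: "bounded_lipschitz S (\<lambda>_. c)"
  unfolding bounded_lipschitz_def by (intro conjI exI[of _ "norm c"] exI[of _ 0]; simp)

lemma bounded_lipschitz_id: "bounded S \<Longrightarrow> bounded_lipschitz S (\<lambda>x. x)"
  unfolding bounded_lipschitz_def bounded_iff by (auto intro!: exI[of _ 1])

lemma bounded_lipschitz_add:
  assumes "bounded_lipschitz S f" "bounded_lipschitz S g"
  shows "bounded_lipschitz S (\<lambda>x. f x + g x)"
proof -
  obtain C K where f: "\<And>x. x \<in> S \<Longrightarrow> norm (f x) \<le> C"
    "\<And>x y. \<lbrakk>x \<in> S; y \<in> S\<rbrakk> \<Longrightarrow> norm (f x - f y) \<le> K * norm (x - y)"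
    using bounded_lipschitzE[OF assms(1)] by metis
  obtain C' K' where g: "\<And>x. x \<in> S \<Longrightarrow> norm (g x) \<le> C'"
    "\<And>x y. \<lbrakk>x \<in> S; y \<in> S\<rbrakk> \<Longrightarrow> norm (g x - g y) \<le> K' * norm (x - y)"
    using bounded_lipschitzE[OF assms(2)] by metis
  have "norm (f x + g x) \<le> C + C'" if "x \<in> S" for x
    using norm_triangle_ineq[of "f x" "g x"] f(1)[OF that] g(1)[OF that] by linarith
  moreover have "norm (f x + g x - (f y + g y)) \<le> (K + K') * norm (x - y)" if "x \<in> S" "y \<in> S" for x y
    using norm_diff_triangle_ineq[of "f x" "g x" "f y" "g y"] f(2)[OF that] g(2)[OF that]
    by (simp add: distrib_right)
  ultimately show ?thesis unfolding bounded_lipschitz_def by blast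
qed

lemma bounded_lipschitz_bilinear:
  assumes "bounded_bilinear b" "bounded_lipschitz S f" "bounded_lipschitz S g"
  shows "bounded_lipschitz S (\<lambda>x. b (f x) (g x))"
proof -
  interpret bounded_bilinear b by fact
  obtain B where B: "B \<ge> 0" "\<And>u v. norm (b u v) \<le> norm u * norm v * B"
    using nonneg_bounded by blast
  obtain C K where f: "C \<ge> 0" "K \<ge> 0" "\<And>x. x \<in> S \<Longrightarrow> norm (f x) \<le> C"
    "\<And>x y. \<lbrakk>x \<in> S; y \<in> S\<rbrakk> \<Longrightarrow> norm (f x - f y) \<le> K * norm (x - y)"
    using bounded_lipschitzE[OF assms(2)] by metis
  obtain C' K' where g: "C' \<ge> 0" "K' \<ge> 0" "\<And>x. x \<in> S \<Longrightarrow> norm (g x) \<le> C'"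
    "\<And>x y. \<lbrakk>x \<in> S; y \<in> S\<rbrakk> \<Longrightarrow> norm (g x - g y) \<le> K' * norm (x - y)"
    using bounded_lipschitzE[OF assms(3)] by metis
  have "norm (b (f x) (g x)) \<le> C * C' * B" if "x \<in> S" for x
  proof -
    have "norm (f x) * norm (g x) * B \<le> C * C' * B"
      using f(1) g(1) f(3)[OF that] g(3)[OF that] B(1) by (intro mult_right_mono mult_mono) auto
    then show ?thesis using B(2)[of "f x" "g x"] by linarith
  qed
  moreover have "norm (b (f x) (g x) - b (f y) (g y)) \<le> ((K * C' + C * K') * B) * norm (x - y)"
    if "x \<in> S" "y \<in> S" for x y
  proof -
    have "b (f x) (g x) - b (f y) (g y) = b (f x - f y) (g x) + b (f y) (g x - g y)"
      by (simp add: diff_left diff_right)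
    also have "norm \<dots> \<le> norm (f x - f y) * norm (g x) * B + norm (f y) * norm (g x - g y) * B"
      using norm_triangle_ineq[of "b (f x - f y) (g x)" "b (f y) (g x - g y)"]
        B(2)[of "f x - f y" "g x"] B(2)[of "f y" "g x - g y"] by linarith
    also have "\<dots> \<le> (K * norm (x - y)) * C' * B + C * (K' * norm (x - y)) * B"
      using f(1,2) g(1,2) f(3)[OF that(2)] f(4)[OF that] g(3)[OF that(1)] g(4)[OF that] B(1)
      by (intro add_mono mult_right_mono mult_mono) auto
    also have "\<dots> = ((K * C' + C * K') * B) * norm (x - y)" by (simp add: algebra_simps)
    finally show ?thesis .
  qed
  ultimately show ?thesis unfolding bounded_lipschitz_def by blast
qed

lemma bounded_lipschitz_linear:
  assumes "bounded_linear L" "bounded_lipschitz S f"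
  shows "bounded_lipschitz S (\<lambda>x. L (f x))"
proof -
  have "bounded_bilinear (\<lambda>v (c::real). c *\<^sub>R L v)"
    using bounded_bilinear.comp1[OF bounded_bilinear.flip[OF bounded_bilinear_scaleR] assms(1)] .
  from bounded_lipschitz_bilinear[OF this assms(2) bounded_lipschitz_const[of S 1]] show ?thesis by simp
qed

lemma bounded_lipschitz_diff:
  assumes "bounded_lipschitz S f" "bounded_lipschitz S g"
  shows "bounded_lipschitz S (\<lambda>x. f x - g x)"
  using bounded_lipschitz_add[OF assms(1) bounded_lipschitz_linear[OF bounded_linear_minus[OF bounded_linear_ident] assms(2)]]
  by simp

lemma bounded_lipschitz_minus: "bounded_lipschitz S f \<Longrightarrow> bounded_lipschitz S (\<lambda>x. - f x)"
  using bounded_lipschitz_diff[OF bounded_lipschitz_const[of S 0]] by simp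

lemma bounded_lipschitz_divide:
  fixes f :: "'a::real_normed_vector \<Rightarrow> real"
  shows "bounded_lipschitz S f \<Longrightarrow> bounded_lipschitz S (\<lambda>x. f x / c)"
  using bounded_lipschitz_linear[OF bounded_linear_divide] .

lemma bounded_lipschitz_sum:
  "(\<And>i. i \<in> I \<Longrightarrow> bounded_lipschitz S (f i)) \<Longrightarrow> bounded_lipschitz S (\<lambda>x. \<Sum>i\<in>I. f i x)"
  by (induction I rule: infinite_finite_induct) (simp_all add: bounded_lipschitz_const bounded_lipschitz_add)

lemmas bounded_lipschitz_intros =
  bounded_lipschitz_const bounded_lipschitz_add bounded_lipschitz_diff bounded_lipschitz_minus
  bounded_lipschitz_divide bounded_lipschitz_sum
  bounded_lipschitz_bilinear[OF bounded_bilinear_mult] bounded_lipschitz_bilinear[OF bounded_bilinear_inner]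
  bounded_lipschitz_bilinear[OF bounded_bilinear_scaleR] bounded_lipschitz_bilinear[OF bounded_bilinear_blinfun_apply]

section \<open>The bracket flow\<close>

context split_space
begin

abbreviation "diag_zero \<equiv> block_diag k j (\<lambda>_. 0)"

text \<open>Here \<open>h'\<close> is the inverse of h, not its derivative. From dh/dt = K h and
  d(h')/dt = -h' K, the product rule for h \<mu>(h' x, h' y) gives the three terms of
  \<open>pi_rep\<close>.\<close>

lemma gl_act_has_vector_derivative:
  fixes h h' :: "real \<Rightarrow> 'p \<Rightarrow> 'p"
  assumes s: "s \<in> T" and lin: "\<And>t. linear (h t)" "\<And>t. linear (h' t)" "linear K"
    and inv: "\<And>t X. t \<in> T \<Longrightarrow> h t (h' t X) = X" "\<And>t X. t \<in> T \<Longrightarrow> h' t (h t X) = X"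
    and h: "\<And>X. ((\<lambda>t. h t X) has_vector_derivative K (h s X)) (at s within T)"
    and h': "\<And>X. ((\<lambda>t. h' t X) has_vector_derivative - h' s (K X)) (at s within T)"
  shows "((\<lambda>t. gl_act (diag_id (h t)) \<mu>) has_vector_derivative
           pi_rep (diag_zero K) (gl_act (diag_id (h s)) \<mu>)) (at s within T)"
proof (intro has_vector_derivative_blinfun)
  fix x y
  let ?H = "\<lambda>t. diag_id (h t)" and ?H' = "\<lambda>t. diag_id (h' t)"
  note act = gl_act_diag_id[OF lin(1,2) inv, where \<mu>=\<mu>]
  have linH: "linear (?H t)" for t by (rule linear_diag_id[OF lin(1)])
  have bj: "bounded_linear j" using linear_j by (simp add: linear_conv_bounded_linear)
  have dH: "((\<lambda>t. ?H t u) has_derivative (\<lambda>d. d *\<^sub>R j (K (h s (pp u))))) (at s within T)" for u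
    using has_derivative_add[OF has_derivative_const bounded_linear.has_derivative[OF bj h[unfolded has_vector_derivative_def]]]
    by (simp add: diag_id_eq[abs_def] linear_scale[OF linear_j])
  have dH': "((\<lambda>t. ?H' t u) has_derivative (\<lambda>d. d *\<^sub>R j (- h' s (K (pp u))))) (at s within T)" for u
    using has_derivative_add[OF has_derivative_const bounded_linear.has_derivative[OF bj h'[unfolded has_vector_derivative_def]]]
    by (simp add: diag_id_eq[abs_def] linear_scale[OF linear_j] linear_neg[OF linear_j])
  have dm: "((\<lambda>t. \<mu> (?H' t x) (?H' t y)) has_derivative
      (\<lambda>d. \<mu> (?H' s x) (d *\<^sub>R j (- h' s (K (pp y)))) + (blinfun_apply \<mu> (d *\<^sub>R j (- h' s (K (pp x))))) (?H' s y)))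
      (at s within T)"
    by (rule bounded_bilinear.FDERIV[OF bounded_bilinear_blinfun_apply
          bounded_linear.has_derivative[OF blinfun.bounded_linear_right dH'] dH'])
  let ?m = "\<mu> (?H' s x) (?H' s y)"
  have "((\<lambda>t. ?H t (\<mu> (?H' t x) (?H' t y))) has_derivative
      (\<lambda>d. d *\<^sub>R j (K (h s (pp ?m)))
        + ?H s (\<mu> (?H' s x) (d *\<^sub>R j (- h' s (K (pp y)))) + (blinfun_apply \<mu> (d *\<^sub>R j (- h' s (K (pp x))))) (?H' s y))))
      (at s within T)"
  proof (rule has_derivative_linear_family_within[OF s linH dH _ dm])
    have "linear (\<lambda>v. j (K (h s (pp v))))"
      using linear_compose[OF linear_compose[OF linear_compose[OF linear_p_part lin(1)] lin(3)] linear_j]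
      by (simp add: comp_def)
    then show "linear (\<lambda>v. d *\<^sub>R j (K (h s (pp v))))" for d by (rule linear_compose_scale_right)
  qed
  moreover have "(\<lambda>d. d *\<^sub>R j (K (h s (pp ?m)))
        + ?H s (\<mu> (?H' s x) (d *\<^sub>R j (- h' s (K (pp y)))) + (blinfun_apply \<mu> (d *\<^sub>R j (- h' s (K (pp x))))) (?H' s y)))
      = (\<lambda>d. d *\<^sub>R pi_rep (diag_zero K) (gl_act (?H s) \<mu>) x y)"
    by (simp add: fun_eq_iff pi_rep_apply[OF linear_diag_zero[OF lin(3)]] act[OF s s] block_diag_def
        p_part_diag_id[unfolded block_diag_def] linear_neg[OF linear_j] blinfun.minus_left blinfun.minus_right
        blinfun.scaleR_left blinfun.scaleR_right split_simps linear_add[OF lin(1)] linear_scale[OF lin(1)]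
        linear_diff[OF lin(1)] linear_neg[OF lin(1)] linear_neg[OF linear_p_part] linear_neg[OF linear_k_part] algebra_simps)
  ultimately have "((\<lambda>t. ?H t (\<mu> (?H' t x) (?H' t y))) has_vector_derivative
      pi_rep (diag_zero K) (gl_act (?H s) \<mu>) x y) (at s within T)"
    by (simp add: has_vector_derivative_def)
  then show "((\<lambda>t. gl_act (diag_id (h t)) \<mu> x y) has_vector_derivative
      pi_rep (diag_zero K) (gl_act (diag_id (h s)) \<mu>) x y) (at s within T)"
    by (rule has_vector_derivative_transform[OF s, rotated]) (simp add: act)
qed

section \<open>The flow as an ordinary differential equation\<close>

definition ricci_op :: "'g bilin_map \<Rightarrow> 'p \<Rightarrow> 'p" where
  "ricci_op \<mu> X = (\<Sum>b\<in>Basis. rform \<mu> X b *\<^sub>R b)"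

lemma ricci_op_eqI:
  assumes "\<And>X Y. R X \<bullet> Y = rform \<mu> X Y"
  shows "ricci_op \<mu> = R"
  by (rule ext) (simp add: ricci_op_def euclidean_representation flip: assms)

text \<open>The part of the infinitesimal action that is free of r, at fixed arguments;
  \<open>field1\<close> is the coefficient of r. Both make sense for every bracket, since
  \<open>ricci_op\<close> is given by the formula and not by a model.\<close>

definition field0 :: "'g bilin_map \<Rightarrow> 'g \<Rightarrow> 'g \<Rightarrow> 'g" where
  "field0 \<mu> x y = j (ricci_op \<mu> (pp (\<mu> x y))) - \<mu> (j (ricci_op \<mu> (pp x))) y - \<mu> x (j (ricci_op \<mu> (pp y)))"

definition field1 :: "'g bilin_map \<Rightarrow> 'g \<Rightarrow> 'g \<Rightarrow> 'g" where
  "field1 \<mu> x y = j (pp (\<mu> x y)) - \<mu> (j (pp x)) y - \<mu> x (j (pp y))"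

lemma pi_rep_ricci_op:
  assumes "linear (ricci_op \<mu>)"
  shows "pi_rep (diag_zero (\<lambda>X. ricci_op \<mu> X + r *\<^sub>R X)) \<mu> x y = field0 \<mu> x y + r *\<^sub>R field1 \<mu> x y"
proof -
  have "linear (\<lambda>X. ricci_op \<mu> X + r *\<^sub>R X)"
    using assms by (intro linear_compose_add linear_scale_self)
  from pi_rep_apply[OF linear_diag_zero[OF this]] show ?thesis
    by (simp add: block_diag_def field0_def field1_def split_simps blinfun.add_left blinfun.add_right
        blinfun.scaleR_left blinfun.scaleR_right algebra_simps)
qed

lemma bounded_lipschitz_field0:
  assumes "bounded S"
  shows "bounded_lipschitz S (\<lambda>\<mu>. field0 \<mu> x y)"
proof -
  have bl: "bounded_linear j" "bounded_linear pp"
    using linear_j linear_p_part by (simp_all add: linear_conv_bounded_linear)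
  note intros = bounded_lipschitz_intros bounded_lipschitz_id[OF assms]
    bounded_lipschitz_linear[OF bl(1)] bounded_lipschitz_linear[OF bl(2)]
  have rf: "bounded_lipschitz S (\<lambda>\<mu>. rform \<mu> (f \<mu>) b)" if "bounded_lipschitz S f" for f b
    unfolding rform_def ricci_form_def koszul_def koszul_deriv_def by (intro intros that)
  have ro: "bounded_lipschitz S (\<lambda>\<mu>. ricci_op \<mu> (f \<mu>))" if "bounded_lipschitz S f" for f
    unfolding ricci_op_def by (intro intros rf that)
  show ?thesis unfolding field0_def by (intro intros ro)
qed

lemma bounded_lipschitz_field1:
  assumes "bounded S"
  shows "bounded_lipschitz S (\<lambda>\<mu>. field1 \<mu> x y)"
proof -
  have bl: "bounded_linear j" "bounded_linear pp"
    using linear_j linear_p_part by (simp_all add: linear_conv_bounded_linear)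
  show ?thesis
    unfolding field1_def by (intro bounded_lipschitz_intros bounded_lipschitz_id[OF assms]
        bounded_lipschitz_linear[OF bl(1)] bounded_lipschitz_linear[OF bl(2)])
qed

text \<open>The common r is a bounded coefficient. On the bounded set swept out by both curves, the
  right-hand side is therefore Lipschitz in the bracket with one constant for all times, and the
  difference satisfies a Gronwall estimate. The factor a admits linear changes of time, including
  reversal.\<close>

lemma bracket_flow_unique:
  fixes \<mu> \<mu>' \<nu> \<nu>' :: "real \<Rightarrow> 'g bilin_map"
  assumes r: "continuous_on {0..T} r"
    and \<mu>: "\<And>s. s \<in> {0..T} \<Longrightarrow> (\<mu> has_vector_derivative \<mu>' s) (at s within {0..T})"
      "\<And>s x y. s \<in> {0..T} \<Longrightarrow> \<mu>' s x y = a *\<^sub>R (field0 (\<mu> s) x y + r s *\<^sub>R field1 (\<mu> s) x y)"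
    and \<nu>: "\<And>s. s \<in> {0..T} \<Longrightarrow> (\<nu> has_vector_derivative \<nu>' s) (at s within {0..T})"
      "\<And>s x y. s \<in> {0..T} \<Longrightarrow> \<nu>' s x y = a *\<^sub>R (field0 (\<nu> s) x y + r s *\<^sub>R field1 (\<nu> s) x y)"
    and init: "\<mu> 0 = \<nu> 0" and s: "s \<in> {0..T}"
  shows "\<mu> s = \<nu> s"
proof -
  define S where "S = \<mu> ` {0..T} \<union> \<nu> ` {0..T}"
  have cont: "continuous_on {0..T} f" if "\<And>s. s \<in> {0..T} \<Longrightarrow> (f has_vector_derivative f' s) (at s within {0..T})"
    for f f' :: "real \<Rightarrow> 'g bilin_map"
    unfolding continuous_on_eq_continuous_within
    by (intro ballI) (rule has_vector_derivative_continuous[OF that])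
  have S: "bounded S"
    unfolding S_def bounded_Un
    by (intro conjI compact_imp_bounded compact_continuous_image[OF cont[OF \<mu>(1)]]
        compact_continuous_image[OF cont[OF \<nu>(1)]] compact_Icc)
  have "\<exists>K\<ge>0. \<forall>u\<in>S. \<forall>v\<in>S. norm (f u - f v) \<le> K * norm (u - v)"
    if "bounded_lipschitz S f" for f :: "'g bilin_map \<Rightarrow> 'g"
    using bounded_lipschitzE[OF that] by metis
  from this[OF bounded_lipschitz_field0[OF S]] this[OF bounded_lipschitz_field1[OF S]]
  obtain K0 K1 where K0: "\<And>x y. K0 x y \<ge> 0"
    "\<And>x y u v. \<lbrakk>u \<in> S; v \<in> S\<rbrakk> \<Longrightarrow> norm (field0 u x y - field0 v x y) \<le> K0 x y * norm (u - v)"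
    and K1: "\<And>x y. K1 x y \<ge> 0"
    "\<And>x y u v. \<lbrakk>u \<in> S; v \<in> S\<rbrakk> \<Longrightarrow> norm (field1 u x y - field1 v x y) \<le> K1 x y * norm (u - v)"
    by metis
  obtain C where "\<forall>v\<in>r ` {0..T}. norm v \<le> C"
    using compact_imp_bounded[OF compact_continuous_image[OF r compact_Icc]]
    unfolding bounded_iff by blast
  then have C: "\<bar>r s\<bar> \<le> C" if "s \<in> {0..T}" for s using that by simp
  define L where "L = (\<Sum>x\<in>Basis. \<Sum>y\<in>Basis. \<bar>a\<bar> * (K0 x y + C * K1 x y) :: real)"
  have "norm (\<mu>' s - \<nu>' s) \<le> L * norm (\<mu> s - \<nu> s)" if s: "s \<in> {0..T}" for s
  proof -
    let ?n = "norm (\<mu> s - \<nu> s)"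
    have mem: "\<mu> s \<in> S" "\<nu> s \<in> S" using s by (auto simp: S_def)
    have xy: "norm ((\<mu>' s - \<nu>' s) x y) \<le> \<bar>a\<bar> * (K0 x y + C * K1 x y) * ?n" for x y
    proof -
      have "(\<mu>' s - \<nu>' s) x y = a *\<^sub>R ((field0 (\<mu> s) x y - field0 (\<nu> s) x y)
          + r s *\<^sub>R (field1 (\<mu> s) x y - field1 (\<nu> s) x y))"
        by (simp add: blinfun.diff_left \<mu>(2)[OF s] \<nu>(2)[OF s] algebra_simps)
      also have "norm \<dots> \<le> \<bar>a\<bar> * (K0 x y * ?n + C * (K1 x y * ?n))"
      proof -
        have "norm (r s *\<^sub>R (field1 (\<mu> s) x y - field1 (\<nu> s) x y)) \<le> C * (K1 x y * ?n)"
          unfolding norm_scaleR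
          using C[OF s] K1(2)[OF mem, of x y] by (intro mult_mono) (auto intro: order_trans[OF abs_ge_zero])
        then have "norm ((field0 (\<mu> s) x y - field0 (\<nu> s) x y) + r s *\<^sub>R (field1 (\<mu> s) x y - field1 (\<nu> s) x y))
            \<le> K0 x y * ?n + C * (K1 x y * ?n)"
          using K0(2)[OF mem, of x y]
            norm_triangle_ineq[of "field0 (\<mu> s) x y - field0 (\<nu> s) x y" "r s *\<^sub>R (field1 (\<mu> s) x y - field1 (\<nu> s) x y)"]
          by linarith
        then show ?thesis unfolding norm_scaleR by (intro mult_left_mono) auto
      qed
      finally show ?thesis by (simp add: algebra_simps)
    qed
    have "norm (\<mu>' s - \<nu>' s) \<le> (\<Sum>x\<in>Basis. norm ((\<mu>' s - \<nu>' s) x))" by (rule norm_blinfun_le_sum_Basis)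
    also have "\<dots> \<le> (\<Sum>x\<in>Basis. \<Sum>y\<in>Basis. norm ((\<mu>' s - \<nu>' s) x y))"
      by (intro sum_mono norm_blinfun_le_sum_Basis)
    also have "\<dots> \<le> (\<Sum>x\<in>Basis. \<Sum>y\<in>Basis. \<bar>a\<bar> * (K0 x y + C * K1 x y) * ?n)"
      by (intro sum_mono xy)
    also have "\<dots> = L * ?n" by (simp add: L_def sum_distrib_right)
    finally show ?thesis .
  qed
  from gronwall_zero[OF has_vector_derivative_diff[OF \<mu>(1) \<nu>(1)] this _ s] init show ?thesis by simp
qed

end

section \<open>The explicit solution attached to a soliton\<close>

locale soliton = split_space k j
  for k :: "'g::euclidean_space set" and j :: "'p::euclidean_space \<Rightarrow> 'g" +
  fixes \<mu>0 :: "'g bilin_map" and c :: real and D :: "'g \<Rightarrow> 'g" and Dp :: "'p \<Rightarrow> 'p"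
  assumes mu0: "\<mu>0 \<in> hom_brackets k j"
    and ricci0: "is_ricci_operator k j \<mu>0 (\<lambda>X. c *\<^sub>R X + (1/2) *\<^sub>R (Dp X + adjoint Dp X))"
    and derivation: "D \<in> derivations \<mu>0"
    and D_k: "z \<in> k \<Longrightarrow> D z = 0" and D_p: "pp (D (j X)) = Dp X"
begin

lemma linear_D: "linear D" and D_mu: "D (\<mu>0 x y) = \<mu>0 (D x) y + \<mu>0 x (D y)"
  using derivation by (simp_all add: derivations_def)

lemma linear_Dp: "linear Dp"
proof -
  have "Dp = (\<lambda>X. pp (D (j X)))" by (simp add: D_p)
  then show ?thesis
    using linear_compose[OF linear_compose[OF linear_j linear_D] linear_p_part] by (simp add: comp_def)
qed

lemma pp_D: "pp (D x) = Dp (pp x)"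
proof -
  have "D x = D (kp x) + D (j (pp x))" using decompose[of x] linear_add[OF linear_D] by metis
  then show ?thesis by (simp add: D_k k_part_in D_p)
qed

definition A :: "'p \<Rightarrow> 'p" where "A X = (1/2) *\<^sub>R (Dp X - adjoint Dp X)"
definition Sy :: "'p \<Rightarrow> 'p" where "Sy X = (1/2) *\<^sub>R (Dp X + adjoint Dp X)"

lemma linear_A: "linear A" and linear_Sy: "linear Sy"
  unfolding A_def[abs_def] Sy_def[abs_def]
  by (intro linear_compose_scale_right linear_compose_sub linear_compose_add linear_Dp adjoint_linear)+

lemma A_minus_Dp: "A X - Dp X = - Sy X"
proof -
  have "(1/2) *\<^sub>R (2 *\<^sub>R Dp X) = Dp X" by simp
  then have "Dp X = (1/2) *\<^sub>R (Dp X + Dp X)" by (simp only: scaleR_2)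
  then show ?thesis unfolding A_def Sy_def by (simp add: algebra_simps)
qed

lemma A_skew: "A X \<bullet> Y = - (X \<bullet> A Y)"
  using adjoint_works[OF linear_Dp, of X Y] adjoint_works[OF linear_Dp, of Y X]
  by (simp add: A_def inner_diff_left inner_diff_right inner_commute algebra_simps)

abbreviation "rep0 \<equiv> isotropy_rep \<mu>0"

lemma linear_rep0: "linear (rep0 z)"
  unfolding isotropy_rep_def by (intro linearI) (simp_all add: split_simps blinfun.add_right blinfun.scaleR_right)

text \<open>Since D z = 0, the derivation rule gives D \<mu>(z, X) = \<mu>(z, D X). The k-component
  of D X contributes an element of \<mu>(k, k), which lies in k and has no p-part.\<close>

lemma rep0_Dp:
  assumes "z \<in> k"
  shows "rep0 z (Dp X) = Dp (rep0 z X)"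
proof -
  note hd = hom_bracketsD[OF mu0]
  have "Dp (rep0 z X) = pp (D (\<mu>0 z (j X)))" by (simp add: hd(4)[OF assms] D_p)
  also have "\<dots> = pp (\<mu>0 z (D (j X)))" by (simp add: D_mu D_k[OF assms] blinfun.zero_left)
  also have "\<mu>0 z (D (j X)) = \<mu>0 z (kp (D (j X))) + \<mu>0 z (j (Dp X))"
    using decompose[of "D (j X)"] by (metis D_p blinfun.add_right)
  also have "pp \<dots> = rep0 z (Dp X)"
    using p_part_k[OF hd(3)[OF assms k_part_in]] by (simp add: split_simps isotropy_rep_def)
  finally show ?thesis by simp
qed

text \<open>Adjoint of the preceding commutation, the isotropy representation being skew.\<close>

lemma rep0_adjoint:
  assumes "z \<in> k"
  shows "rep0 z (adjoint Dp X) = adjoint Dp (rep0 z X)"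
proof (rule vector_eq_rdot[THEN iffD1], rule allI)
  fix Y
  note sk = hom_bracketsD(5)[OF mu0 assms] and ad = adjoint_clauses(1)[OF linear_Dp] adjoint_clauses(2)[OF linear_Dp]
  have "rep0 z (adjoint Dp X) \<bullet> Y = - (X \<bullet> Dp (rep0 z Y))" by (simp add: sk ad)
  also have "\<dots> = - (X \<bullet> rep0 z (Dp Y))" by (simp add: rep0_Dp[OF assms])
  also have "\<dots> = adjoint Dp (rep0 z X) \<bullet> Y" by (simp add: sk ad)
  finally show "rep0 z (adjoint Dp X) \<bullet> Y = adjoint Dp (rep0 z X) \<bullet> Y" .
qed

lemma rep0_A: "z \<in> k \<Longrightarrow> rep0 z (A X) = A (rep0 z X)"
  by (simp add: A_def rep0_Dp rep0_adjoint linear_diff[OF linear_rep0] linear_scale[OF linear_rep0])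

definition eA :: "real \<Rightarrow> 'p \<Rightarrow> 'p" where "eA t = lin_exp (\<lambda>X. t *\<^sub>R A X)"
definition eD :: "real \<Rightarrow> 'p \<Rightarrow> 'p" where "eD t = lin_exp (\<lambda>X. t *\<^sub>R Dp X)"
definition E :: "real \<Rightarrow> 'p \<Rightarrow> 'p" where "E t X = eA t (eD (- t) X)"
definition E' :: "real \<Rightarrow> 'p \<Rightarrow> 'p" where "E' t X = eD t (eA (- t) X)"

lemma linear_eA: "linear (eA t)" and linear_eD: "linear (eD t)"
  unfolding eA_def eD_def by (intro linear_lin_exp linear_scaled linear_A linear_Dp)+

lemma linear_E: "linear (E t)" and linear_E': "linear (E' t)"
  using linear_compose[OF linear_eD linear_eA] linear_compose[OF linear_eA linear_eD]
  by (simp_all add: E_def[abs_def] E'_def[abs_def] comp_def)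

lemma eA_inverse [simp]: "eA t (eA (- t) X) = X" "eA (- t) (eA t X) = X"
  using lin_exp_inverse[OF linear_A, of t X] lin_exp_inverse'[OF linear_A, of t X] by (simp_all add: eA_def)

lemma eD_inverse [simp]: "eD t (eD (- t) X) = X" "eD (- t) (eD t X) = X"
  using lin_exp_inverse[OF linear_Dp, of t X] lin_exp_inverse'[OF linear_Dp, of t X] by (simp_all add: eD_def)

lemma E_inverse [simp]: "E t (E' t X) = X" "E' t (E t X) = X"
  by (simp_all add: E_def E'_def)

lemma E_zero: "E 0 X = X"
  using lin_exp_zero[OF linear_A] lin_exp_zero[OF linear_Dp] by (simp add: E_def eA_def eD_def)

lemma eA_commute: "A (eA t X) = eA t (A X)" and eD_commute: "Dp (eD t X) = eD t (Dp X)"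
  unfolding eA_def eD_def by (rule lin_exp_commute linear_A linear_Dp)+

lemma rep0_E:
  assumes "z \<in> k"
  shows "rep0 z (E t X) = E t (rep0 z X)"
proof -
  have "rep0 z (eA t X) = eA t (rep0 z X)" for t X
    unfolding eA_def by (rule lin_exp_intertwine[OF linear_scaled[OF linear_A] linear_rep0])
      (simp add: rep0_A[OF assms] linear_scale[OF linear_rep0])
  moreover have "rep0 z (eD t X) = eD t (rep0 z X)" for t X
    unfolding eD_def by (rule lin_exp_intertwine[OF linear_scaled[OF linear_Dp] linear_rep0])
      (simp add: rep0_Dp[OF assms] linear_scale[OF linear_rep0])
  ultimately show ?thesis by (simp add: E_def)
qed

definition \<mu> :: "real \<Rightarrow> 'g bilin_map" where "\<mu> t = gl_act (diag_id (E t)) \<mu>0"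

lemma mu_apply: "\<mu> t x y = diag_id (E t) (\<mu>0 (diag_id (E' t) x) (diag_id (E' t) y))"
  unfolding \<mu>_def by (rule gl_act_diag_id[OF linear_E linear_E' E_inverse])

lemma mu_hom: "\<mu> t \<in> hom_brackets k j"
  unfolding \<mu>_def by (rule gl_act_in_hom_brackets[OF mu0 linear_E linear_E' E_inverse rep0_E])

lemma mu_zero: "\<mu> 0 = \<mu>0"
proof -
  have "E' 0 X = X" for X using E_inverse(2)[of 0 X] by (simp add: E_zero)
  then show ?thesis
    by (intro blinfun_eqI) (simp add: mu_apply diag_id_eq E_zero flip: decompose)
qed

definition ric :: "real \<Rightarrow> 'p \<Rightarrow> 'p" where
  "ric t X = eA t (c *\<^sub>R eA (- t) X + Sy (eA (- t) X))"

text \<open>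
  \<open>\<mu>(t)\<close> is also the image of \<open>\<mu>\<^sub>0\<close> under \<open>diag(I, e\<^bsup>tA\<^esup> e\<^bsup>-tD\<^sub>p\<^esup>) e\<^bsup>tD\<^esup>\<close>, because \<open>e\<^bsup>tD\<^esup>\<close> is an automorphism of \<open>\<mu>\<^sub>0\<close>. This map is the
  identity on \<open>\<kk>\<close> and induces the orthogonal map \<open>e\<^bsup>tA\<^esup>\<close> on \<open>\<gg>/\<kk>\<close>.
\<close>

lemma mu_ricci: "is_ricci_operator k j (\<mu> t) (ric t)"
  and mu_isometric: "isometric_brackets k j \<mu>0 (\<mu> t)"
proof -
  define e where "e t = lin_exp (\<lambda>x. t *\<^sub>R D x)" for t
  define P where "P x = diag_id (E t) (e t x)" for x
  define P' where "P' x = e (- t) (diag_id (E' t) x)" for x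
  have e_inv: "e t (e (- t) x) = x" "e (- t) (e t x) = x" for x
    using lin_exp_inverse[OF linear_D, of t x] lin_exp_inverse'[OF linear_D, of t x] by (simp_all add: e_def)
  have inv: "P (P' x) = x" "P' (P x) = x" for x
    by (simp_all add: P_def P'_def e_inv diag_id_inverse)
  have lin: "linear P'"
  proof -
    have "linear (e (- t))" unfolding e_def by (rule linear_lin_exp[OF linear_scaled[OF linear_D]])
    from linear_compose[OF linear_diag_id[OF linear_E'[of t]] this] show ?thesis
      by (simp add: P'_def[abs_def] comp_def)
  qed
  have ppe: "pp (e t x) = eD t (pp x)" for x
    unfolding e_def eD_def
    by (rule lin_exp_intertwine[OF linear_scaled[OF linear_D] linear_p_part]) (simp add: pp_D split_simps)
  have ek: "e t z = z" if "z \<in> k" for z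
  proof -
    have "linear (\<lambda>r::real. r *\<^sub>R z)" by (intro linearI) (simp_all add: algebra_simps)
    \<comment> \<open>The map r |-> r z intertwines the zero map of the reals with tD because D z =
      0, so e^(tD) z is the image of e^0 1 = 1.\<close>
    from lin_exp_intertwine[OF linear_scaled[OF linear_id, of 0] this, of "\<lambda>x. t *\<^sub>R D x" 1]
    show ?thesis using lin_exp_zero[OF linear_id, where 'a=real] that
      by (simp add: e_def linear_scale[OF linear_D] D_k)
  qed
  have Pk: "P z = z" if "z \<in> k" for z using that by (simp add: P_def ek diag_id_k linear_E)
  have hom: "P (\<mu>0 x y) = \<mu> t (P x) (P y)" for x y
    using lin_exp_derivation[OF derivation, of t x y]
    by (simp add: P_def mu_apply e_def diag_id_inverse)
  have ppP: "pp (P x) = eA t (pp x)" for x by (simp add: P_def ppe E_def)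
  have orth: "eA t X \<bullet> eA t Y = X \<bullet> Y" for X Y
    unfolding eA_def by (rule lin_exp_orthogonal[OF linear_A A_skew])
  note tr = ricci_operator_transport[OF ricci0 lin inv Pk hom ppP linear_eA linear_eA eA_inverse orth]
  show "is_ricci_operator k j (\<mu> t) (ric t)"
    using tr(1) by (simp add: ric_def[abs_def] Sy_def)
  show "isometric_brackets k j \<mu>0 (\<mu> t)" by (rule tr(2))
qed

text \<open>The velocity of E in the sense dE/dt = K E: since \<open>A\<close> minus
  \<open>Dp\<close> is minus the symmetric part of \<open>Dp\<close>, it is the conjugate of the
  latter by e^(tA), up to sign. By \<open>ric_eq\<close> it equals cI - Ric along \<mu>(t), which is
  the flow equation for r = -c.\<close>

definition K :: "real \<Rightarrow> 'p \<Rightarrow> 'p" where "K t X = - eA t (Sy (eA (- t) X))"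

lemma linear_K: "linear (K t)"
  using linear_compose_neg[OF linear_compose[OF linear_compose[OF linear_eA[of "- t"] linear_Sy] linear_eA[of t]]]
  by (simp add: K_def[abs_def] comp_def)

lemma ric_eq: "ric t X = c *\<^sub>R X - K t X"
  by (simp add: ric_def K_def linear_add[OF linear_eA] linear_scale[OF linear_eA])

lemma eA_derivative: "((\<lambda>t. eA t X) has_derivative (\<lambda>d. d *\<^sub>R A (eA t X))) (at t)"
  and eA_neg_derivative: "((\<lambda>t. eA (- t) X) has_derivative (\<lambda>d. - d *\<^sub>R A (eA (- t) X))) (at t)"
  and eD_derivative: "((\<lambda>t. eD t X) has_derivative (\<lambda>d. d *\<^sub>R Dp (eD t X))) (at t)"
  and eD_neg_derivative: "((\<lambda>t. eD (- t) X) has_derivative (\<lambda>d. - d *\<^sub>R Dp (eD (- t) X))) (at t)"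
  unfolding eA_def eD_def
  by (rule lin_exp_has_derivative lin_exp_neg_has_derivative linear_A linear_Dp)+

lemma E_has_vector_derivative: "((\<lambda>t. E t X) has_vector_derivative K t (E t X)) (at t)"
proof -
  have "((\<lambda>t. eA t (eD (- t) X)) has_derivative
      (\<lambda>d. d *\<^sub>R A (eA t (eD (- t) X)) + eA t (- d *\<^sub>R Dp (eD (- t) X)))) (at t)"
    by (rule has_derivative_linear_family[OF open_UNIV UNIV_I linear_eA eA_derivative eD_neg_derivative])
  moreover have "d *\<^sub>R A (eA t Y) + eA t (- d *\<^sub>R Dp Y) = d *\<^sub>R K t (eA t Y)" for d Y
  proof -
    have "d *\<^sub>R A (eA t Y) + eA t (- d *\<^sub>R Dp Y) = d *\<^sub>R eA t (A Y - Dp Y)"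
      by (simp add: eA_commute linear_diff[OF linear_eA] linear_scale[OF linear_eA] linear_neg[OF linear_eA]
          scaleR_diff_right)
    then show ?thesis by (simp add: A_minus_Dp K_def linear_neg[OF linear_eA])
  qed
  ultimately show ?thesis by (simp add: has_vector_derivative_def E_def[abs_def])
qed

lemma E'_has_vector_derivative: "((\<lambda>t. E' t X) has_vector_derivative - E' t (K t X)) (at t)"
proof -
  have "((\<lambda>t. eD t (eA (- t) X)) has_derivative
      (\<lambda>d. d *\<^sub>R Dp (eD t (eA (- t) X)) + eD t (- d *\<^sub>R A (eA (- t) X)))) (at t)"
    by (rule has_derivative_linear_family[OF open_UNIV UNIV_I linear_eD eD_derivative eA_neg_derivative])
  moreover have "d *\<^sub>R Dp (eD t Y) + eD t (- d *\<^sub>R A Y) = d *\<^sub>R eD t (Sy Y)" for d Y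
  proof -
    have "d *\<^sub>R Dp (eD t Y) + eD t (- d *\<^sub>R A Y) = d *\<^sub>R eD t (- (A Y - Dp Y))"
      by (simp add: eD_commute linear_diff[OF linear_eD] linear_scale[OF linear_eD] linear_neg[OF linear_eD]
          scaleR_diff_right)
    then show ?thesis by (simp add: A_minus_Dp)
  qed
  ultimately show ?thesis
    by (simp add: has_vector_derivative_def E'_def[abs_def] K_def linear_neg[OF linear_eA] linear_neg[OF linear_eD])
qed

lemma mu_flow: "normalized_bracket_flow k j UNIV (\<lambda>_. - c) \<mu>0 \<mu>"
  unfolding normalized_bracket_flow_def
proof (intro conjI ballI)
  fix t :: real
  show "\<mu> t \<in> hom_brackets k j" by (rule mu_hom)
  have "(\<mu> has_vector_derivative pi_rep (diag_zero (K t)) (\<mu> t)) (at t)"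
    unfolding \<mu>_def[abs_def]
    by (rule gl_act_has_vector_derivative[where h=E and h'=E'])
       (simp_all add: linear_E linear_E' linear_K E_has_vector_derivative E'_has_vector_derivative)
  moreover have "pi_rep (diag_zero (K t)) (\<mu> t)
      = - pi_rep (diag_zero (\<lambda>X. ric t X + - c *\<^sub>R X)) (\<mu> t)"
  proof (intro blinfun_eqI)
    fix x y
    have "linear (\<lambda>X. ric t X + - c *\<^sub>R X)"
      using linear_compose_neg[OF linear_K] by (simp add: ric_eq)
    from pi_rep_apply[OF linear_diag_zero[OF this]]
    show "pi_rep (diag_zero (K t)) (\<mu> t) x y
      = (- pi_rep (diag_zero (\<lambda>X. ric t X + - c *\<^sub>R X)) (\<mu> t)) x y"
      by (simp add: pi_rep_apply[OF linear_diag_zero[OF linear_K]] blinfun.minus_left block_diag_def ric_eq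
          linear_neg[OF linear_j] blinfun.minus_right)
  qed
  ultimately show "\<exists>R. is_ricci_operator k j (\<mu> t) R \<and>
      (\<mu> has_vector_derivative - pi_rep (diag_zero (\<lambda>X. R X + - c *\<^sub>R X)) (\<mu> t)) (at t)"
    using mu_ricci by auto
qed (auto simp: mu_zero)

lemma mu_invariant: "isometry_invariant k j F \<Longrightarrow> F (\<mu> t) = F \<mu>0"
  using mu_isometric mu0 mu_hom unfolding isometry_invariant_def by metis

end

context soliton
begin

text \<open>Multiplying \<open>E t\<close> by sqrt w is a geometric rescaling by 1 / sqrt w, under
  which the Ricci operator is multiplied by 1 / w.\<close>

lemma scaled_ricci_op:
  assumes "w > 0"
  shows "ricci_op (gl_act (diag_id (\<lambda>X. sqrt w *\<^sub>R E t X)) \<mu>0) = (\<lambda>X. (1 / w) *\<^sub>R ric t X)"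
proof (rule ricci_op_eqI)
  fix X Y
  have "gl_act (diag_id (\<lambda>X. sqrt w *\<^sub>R E t X)) \<mu>0 x y = diag_id (\<lambda>X. (1 / (1 / sqrt w)) *\<^sub>R X)
      (\<mu> t (diag_id (\<lambda>X. (1 / sqrt w) *\<^sub>R X) x) (diag_id (\<lambda>X. (1 / sqrt w) *\<^sub>R X) y))" for x y
    using gl_act_scale[OF linear_E linear_E' E_inverse, of "1 / sqrt w" t \<mu>0 x y] assms
    by (simp add: \<mu>_def)
  from rform_scale[OF _ this] have "rform (gl_act (diag_id (\<lambda>X. sqrt w *\<^sub>R E t X)) \<mu>0) X Y = (1 / sqrt w)\<^sup>2 * rform (\<mu> t) X Y"
    using assms by simp
  then show "(1 / w) *\<^sub>R ric t X \<bullet> Y = rform (gl_act (diag_id (\<lambda>X. sqrt w *\<^sub>R E t X)) \<mu>0) X Y"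
    using assms is_ricci_operator_rform[OF mu_ricci, of t X Y] by (simp add: power_divide)
qed

text \<open>
  A normalized flow is a rescaling and time change of \<open>\<mu>(t)\<close>. Bernoulli's equation for the scaling factor
  becomes linear in terms of \<open>w\<close>, the inverse square of this factor.
\<close>

lemma flow_eq_scaled:
  fixes \<nu> \<nu>' :: "real \<Rightarrow> 'g bilin_map" and r w \<sigma> :: "real \<Rightarrow> real"
  assumes r: "continuous_on {0..T} r"
    and w: "\<And>s. s \<in> {0..T} \<Longrightarrow> w s > 0" "w 0 = 1"
      "\<And>s. s \<in> {0..T} \<Longrightarrow> (w has_real_derivative - 2 * a * (r s * w s + c)) (at s within {0..T})"
    and \<sigma>: "\<sigma> 0 = 0" "\<And>s. s \<in> {0..T} \<Longrightarrow> (\<sigma> has_real_derivative a / w s) (at s within {0..T})"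
    and \<nu>: "\<And>s. s \<in> {0..T} \<Longrightarrow> (\<nu> has_vector_derivative \<nu>' s) (at s within {0..T})"
      "\<And>s x y. s \<in> {0..T} \<Longrightarrow> \<nu>' s x y = (- a) *\<^sub>R (field0 (\<nu> s) x y + r s *\<^sub>R field1 (\<nu> s) x y)"
    and init: "\<nu> 0 = \<mu>0" and s: "s \<in> {0..T}"
  shows "\<nu> s = gl_act (diag_id (\<lambda>X. sqrt (w s) *\<^sub>R E (\<sigma> s) X)) \<mu>0"
proof -
  define h where "h s X = sqrt (w s) *\<^sub>R E (\<sigma> s) X" for s X
  define h' where "h' s X = inverse (sqrt (w s)) *\<^sub>R E' (\<sigma> s) X" for s X
  \<comment> \<open>The velocity of h: the scalar part is the logarithmic derivative of sqrt w, the
    other part comes from running E at speed a / w. By \<open>ric_eq\<close> it equals -a (Ric/w +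
    r) with Ric taken at \<mu>(\<sigma> s), which is what the flow with time factor a
    demands.\<close>
  define Kn where "Kn s X = (- a * (r s + c / w s)) *\<^sub>R X + (a / w s) *\<^sub>R K (\<sigma> s) X" for s X
  define N where "N s = gl_act (diag_id (h s)) \<mu>0" for s
  define N' where "N' s = pi_rep (diag_zero (Kn s)) (N s)" for s
  have linh: "linear (h s)" "linear (h' s)" for s
    unfolding h_def[abs_def] h'_def[abs_def] by (intro linear_compose_scale_right linear_E linear_E')+
  have linK: "linear (Kn s)" for s
    unfolding Kn_def[abs_def]
    by (intro linear_compose_add linear_scale_self linear_compose_scale_right linear_K)
  have inv: "h s (h' s X) = X" "h' s (h s X) = X" if "s \<in> {0..T}" for s X
    using w(1)[OF that]
    by (simp_all add: h_def h'_def linear_scale[OF linear_E] linear_scale[OF linear_E'])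
  have dN: "(N has_vector_derivative N' s) (at s within {0..T})" if s: "s \<in> {0..T}" for s
  proof -
    define q where "q = sqrt (w s)"
    have q: "q > 0" "w s = q\<^sup>2" using w(1)[OF s] by (simp_all add: q_def)
    have dq: "((\<lambda>s. sqrt (w s)) has_real_derivative - a * (r s + c / w s) * q) (at s within {0..T})"
    proof -
      have "((\<lambda>s. sqrt (w s)) has_real_derivative inverse (sqrt (w s)) / 2 * (- 2 * a * (r s * w s + c))) (at s within {0..T})"
        by (rule DERIV_chain2[OF DERIV_real_sqrt[OF w(1)[OF s]] w(3)[OF s]])
      moreover have "inverse (sqrt (w s)) / 2 * (- 2 * a * (r s * w s + c)) = - a * (r s + c / w s) * q"
        unfolding q_def[symmetric] q(2) using q(1) by (simp add: field_simps power2_eq_square)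
      ultimately show ?thesis by (simp only:)
    qed
    have dqi: "((\<lambda>s. inverse (sqrt (w s))) has_real_derivative a * (r s + c / w s) * inverse q) (at s within {0..T})"
    proof -
      have "((\<lambda>s. inverse (sqrt (w s))) has_real_derivative
          - (inverse (sqrt (w s)) * (- a * (r s + c / w s) * q) * inverse (sqrt (w s)))) (at s within {0..T})"
        by (rule DERIV_inverse'[OF dq]) (use w(1)[OF s] in simp)
      moreover have "- (inverse q * (- a * v * q) * inverse q) = a * v * inverse q" for v
        using q(1) by simp
      ultimately show ?thesis unfolding q_def[symmetric] by (simp only:)
    qed
    have d\<sigma>: "(\<sigma> has_vector_derivative a / w s) (at s within {0..T})"
      using \<sigma>(2)[OF s] by (simp add: has_real_derivative_iff_has_vector_derivative)
    have dE: "((\<lambda>s. E (\<sigma> s) X) has_vector_derivative (a / w s) *\<^sub>R K (\<sigma> s) (E (\<sigma> s) X)) (at s within {0..T})" for X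
      using vector_diff_chain_within[OF d\<sigma> has_vector_derivative_at_within[OF E_has_vector_derivative]]
      by (simp add: comp_def)
    have dE': "((\<lambda>s. E' (\<sigma> s) X) has_vector_derivative (a / w s) *\<^sub>R (- E' (\<sigma> s) (K (\<sigma> s) X))) (at s within {0..T})" for X
      using vector_diff_chain_within[OF d\<sigma> has_vector_derivative_at_within[OF E'_has_vector_derivative]]
      by (simp add: comp_def)
    have dh: "((\<lambda>s. h s X) has_vector_derivative Kn s (h s X)) (at s within {0..T})" for X
      using has_vector_derivative_scaleR[OF dq dE, of X]
      by (simp add: h_def Kn_def linear_scale[OF linear_K] q_def algebra_simps)
    have dh': "((\<lambda>s. h' s X) has_vector_derivative - h' s (Kn s X)) (at s within {0..T})" for X
      using has_vector_derivative_scaleR[OF dqi dE', of X]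
      by (simp add: h'_def Kn_def linear_add[OF linear_E'] linear_diff[OF linear_E'] linear_scale[OF linear_E']
          linear_neg[OF linear_E'] q_def algebra_simps)
    show ?thesis
      unfolding N_def[abs_def] N'_def
      by (rule gl_act_has_vector_derivative[where h=h and h'=h'])
         (simp_all add: s linh linK inv dh dh' del: atLeastAtMost_iff)
  qed
  have eN: "N' s x y = (- a) *\<^sub>R (field0 (N s) x y + r s *\<^sub>R field1 (N s) x y)" if s: "s \<in> {0..T}" for s x y
  proof -
    have ro: "ricci_op (N s) = (\<lambda>X. (1 / w s) *\<^sub>R ric (\<sigma> s) X)"
      unfolding N_def h_def[abs_def] by (rule scaled_ricci_op[OF w(1)[OF s]])
    have lin: "linear (ricci_op (N s))"
      unfolding ro ric_eq[abs_def]
      by (intro linear_compose_scale_right linear_compose_sub linear_scale_self linear_K)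
    define G where "G X = ricci_op (N s) X + r s *\<^sub>R X" for X
    have "linear G" unfolding G_def[abs_def] by (intro linear_compose_add lin linear_scale_self)
    note p = pi_rep_apply[OF linear_diag_zero[OF this]] pi_rep_apply[OF linear_diag_zero[OF linK]]
    have "Kn s X = (- a) *\<^sub>R G X" for X
      by (simp add: G_def Kn_def ro ric_eq algebra_simps)
    then have "j (Kn s X) = (- a) *\<^sub>R j (G X)" for X by (simp only: linear_scale[OF linear_j])
    then have "N' s x y = (- a) *\<^sub>R pi_rep (diag_zero G) (N s) x y"
      unfolding N'_def p block_diag_def by (simp add: blinfun.bilinear_simps algebra_simps)
    then show ?thesis unfolding G_def[abs_def] by (simp only: pi_rep_ricci_op[OF lin])
  qed
  have "N 0 = \<mu>0"
  proof -
    have "h 0 = E 0" by (simp add: fun_eq_iff h_def w(2) \<sigma>(1))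
    then show ?thesis using mu_zero by (simp add: N_def \<mu>_def)
  qed
  then have "\<nu> s = N s"
    by (intro bracket_flow_unique[OF r \<nu> dN eN _ s]) (simp_all add: init)
  then show ?thesis by (simp add: N_def h_def[abs_def])
qed

text \<open>The segment from 0 to t is parametrized by s in [0, 1], which treats both signs of t
  together. As long as w has stayed positive, constancy of F gives w = 1; a continuity argument then
  shows that w cannot leave this value.\<close>

lemma flow_eq_mu:
  assumes flow: "normalized_bracket_flow k j J r \<mu>0 \<nu>"
    and F: "isometry_invariant k j F" "scaling_invariant k j F" "F \<mu>0 \<noteq> 0"
    and const: "\<And>t. t \<in> J \<Longrightarrow> F (\<nu> t) = F \<mu>0"
    and t: "t \<in> J"
  shows "\<nu> t = \<mu> t"
proof -
  have J: "is_interval J" "0 \<in> J" "continuous_on J r" "\<nu> 0 = \<mu>0"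
    using flow by (simp_all add: normalized_bracket_flow_def)
  have stJ: "s * t \<in> J" if "s \<in> {0..1}" for s
    using convexD_alt[OF is_interval_convex[OF J(1)] J(2) t, of s] that by simp
  define N where "N s = \<nu> (s * t)" for s
  define q where "q s = r (s * t)" for s
  define N' where "N' s = t *\<^sub>R - pi_rep (diag_zero (\<lambda>X. ricci_op (N s) X + q s *\<^sub>R X)) (N s)" for s
  have q: "continuous_on {0..1} q"
    unfolding q_def
    by (rule continuous_on_compose2[OF J(3)]) (use stJ in \<open>auto intro!: continuous_on_mult_right continuous_on_id\<close>)
  have ricN: "\<exists>R. is_ricci_operator k j (N s) R \<and> ricci_op (N s) = R \<and>
      (\<nu> has_vector_derivative - pi_rep (diag_zero (\<lambda>X. R X + q s *\<^sub>R X)) (N s)) (at (s * t) within J)"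
    if s: "s \<in> {0..1}" for s
  proof -
    obtain R where R: "is_ricci_operator k j (N s) R"
      "(\<nu> has_vector_derivative - pi_rep (diag_zero (\<lambda>X. R X + q s *\<^sub>R X)) (N s)) (at (s * t) within J)"
      using flow stJ[OF s] unfolding normalized_bracket_flow_def N_def q_def by blast
    moreover have "ricci_op (N s) = R"
      by (rule ricci_op_eqI) (rule is_ricci_operator_rform[OF R(1)])
    ultimately show ?thesis by blast
  qed
  have dN: "(N has_vector_derivative N' s) (at s within {0..1})" if s: "s \<in> {0..1}" for s
  proof -
    have 1: "((\<lambda>s. s * t) has_vector_derivative t) (at s within {0..1})"
      by (auto intro!: derivative_eq_intros simp: has_real_derivative_iff_has_vector_derivative[symmetric])
    have "(\<nu> has_vector_derivative - pi_rep (diag_zero (\<lambda>X. ricci_op (N s) X + q s *\<^sub>R X)) (N s))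
        (at (s * t) within (\<lambda>s. s * t) ` {0..1})"
      using ricN[OF s] stJ by (auto intro: has_vector_derivative_within_subset)
    from vector_diff_chain_within[OF 1 this] show ?thesis by (simp add: comp_def N_def[abs_def] N'_def)
  qed
  have eN: "N' s x y = (- t) *\<^sub>R (field0 (N s) x y + q s *\<^sub>R field1 (N s) x y)" if s: "s \<in> {0..1}" for s x y
  proof -
    have "linear (ricci_op (N s))" using ricN[OF s] by (auto simp: is_ricci_operator_def)
    from pi_rep_ricci_op[OF this] show ?thesis
      by (simp add: N'_def blinfun.scaleR_left blinfun.minus_left)
  qed
  have N0: "N 0 = \<mu>0" by (simp add: N_def J)
  define \<rho> where "\<rho> s = integral {0..s} q" for s
  define I where "I s = integral {0..s} (\<lambda>u. exp (2 * t * \<rho> u))" for s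
  \<comment> \<open>Solution of w' = -2 t (q w + c), w(0) = 1, by variation of constants, with
    \<rho> the integral of q and exp (2 t \<rho>) the integrating factor. It is defined on all of
    [0, 1], but its positivity is not yet known.\<close>
  define w where "w s = exp (- 2 * t * \<rho> s) * (1 - 2 * t * c * I s)" for s
  have d\<rho>: "(\<rho> has_real_derivative q s) (at s within {0..1})" if "s \<in> {0..1}" for s
    unfolding \<rho>_def[abs_def] by (rule integral_has_real_derivative[OF q that])
  have "continuous_on {0..1} \<rho>"
    using d\<rho> by (meson DERIV_continuous continuous_on_eq_continuous_within)
  then have "continuous_on {0..1} (\<lambda>u. exp (2 * t * \<rho> u))" by (intro continuous_intros)
  from integral_has_real_derivative[OF this]
  have dI: "(I has_real_derivative exp (2 * t * \<rho> s)) (at s within {0..1})" if "s \<in> {0..1}" for s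
    using that unfolding I_def[abs_def] by simp
  have dw: "(w has_real_derivative - 2 * t * (q s * w s + c)) (at s within {0..1})" if s: "s \<in> {0..1}" for s
  proof -
    have "(w has_real_derivative exp (- 2 * t * \<rho> s) * (- 2 * t * q s) * (1 - 2 * t * c * I s)
        + (- (2 * t * c * exp (2 * t * \<rho> s))) * exp (- 2 * t * \<rho> s)) (at s within {0..1})"
      unfolding w_def[abs_def]
      by (rule derivative_eq_intros d\<rho>[OF s] dI[OF s] refl)+ simp
    moreover have "exp (2 * t * \<rho> s) * exp (- 2 * t * \<rho> s) = 1" by (simp flip: exp_add)
    then have "exp (- 2 * t * \<rho> s) * (- 2 * t * q s) * (1 - 2 * t * c * I s)
        + (- (2 * t * c * exp (2 * t * \<rho> s))) * exp (- 2 * t * \<rho> s) = - 2 * t * (q s * w s + c)"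
      unfolding w_def by (simp add: algebra_simps)
    ultimately show ?thesis by simp
  qed
  have w0: "w 0 = 1" by (simp add: w_def \<rho>_def I_def)
  have contw: "continuous_on {0..1} w"
    using dw by (meson DERIV_continuous continuous_on_eq_continuous_within)
  \<comment> \<open>Positivity of w up to T makes the clock \<sigma> and the comparison available: N
    is \<mu>(\<sigma> s) rescaled by 1 / sqrt w, so F gets the factor (1 / sqrt w)^d. This factor is
    1 because F does not vanish, and d is nonzero.\<close>
  have step: "w s = 1" if T: "T \<in> {0..1}" and pos: "\<And>s. s \<in> {0..T} \<Longrightarrow> w s > 0" and s: "s \<in> {0..T}" for T s
  proof -
    have sub: "{0..T} \<subseteq> {0..1}" using T by auto
    define \<sigma> where "\<sigma> s = integral {0..s} (\<lambda>u. t / w u)" for s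
    have "continuous_on {0..T} (\<lambda>u. t / w u)"
      using pos by (intro continuous_intros continuous_on_subset[OF contw sub]) force
    then have d\<sigma>: "(\<sigma> has_real_derivative t / w s) (at s within {0..T})" if "s \<in> {0..T}" for s
      unfolding \<sigma>_def[abs_def] using that by (rule integral_has_real_derivative)
    have "N s = gl_act (diag_id (\<lambda>X. sqrt (w s) *\<^sub>R E (\<sigma> s) X)) \<mu>0"
    proof (rule flow_eq_scaled[where T=T and r=q and a=t and \<nu>=N and \<nu>'=N' and w=w and \<sigma>=\<sigma>])
      show "continuous_on {0..T} q" by (rule continuous_on_subset[OF q sub])
      show "(w has_real_derivative - 2 * t * (q s * w s + c)) (at s within {0..T})" if "s \<in> {0..T}" for s
        using DERIV_subset[OF dw sub] that sub by blast
      show "(N has_vector_derivative N' s) (at s within {0..T})" if "s \<in> {0..T}" for s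
        using has_vector_derivative_within_subset[OF dN sub] that sub by blast
      show "N' s x y = (- t) *\<^sub>R (field0 (N s) x y + q s *\<^sub>R field1 (N s) x y)" if "s \<in> {0..T}" for s x y
        using eN that sub by blast
      show "\<sigma> 0 = 0" by (simp add: \<sigma>_def)
    qed (use pos w0 d\<sigma> N0 s in auto)
    also have "\<dots> = rescale k j (1 / sqrt (w s)) (\<mu> (\<sigma> s))"
      using rescale_gl_act[OF mu0 linear_E linear_E' E_inverse rep0_E, of "1 / sqrt (w s)" "\<sigma> s"] pos[OF s]
      by (simp add: \<mu>_def)
    finally have Ns: "N s = rescale k j (1 / sqrt (w s)) (\<mu> (\<sigma> s))" .
    obtain d :: real where d: "d \<noteq> 0"
      "\<And>a \<mu>. \<lbrakk>a > 0; \<mu> \<in> hom_brackets k j\<rbrakk> \<Longrightarrow> F (rescale k j a \<mu>) = a powr d * F \<mu>"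
      using F(2) unfolding scaling_invariant_def by blast
    have "F (N s) = (1 / sqrt (w s)) powr d * F \<mu>0"
      unfolding Ns using d(2)[OF _ mu_hom] pos[OF s] mu_invariant[OF F(1)] by simp
    moreover have "F (N s) = F \<mu>0" unfolding N_def using s sub by (intro const stJ) auto
    ultimately have "(1 / sqrt (w s)) powr d = 1" using F(3) by simp
    then have "ln (1 / sqrt (w s)) = 0"
      using d(1) pos[OF s] by (simp add: powr_def split: if_splits)
    then have "1 / sqrt (w s) = 1" using pos[OF s] by (subst (asm) ln_eq_zero_iff) auto
    then show ?thesis using pos[OF s] by simp
  qed
  \<comment> \<open>Any threshold strictly between 0 and 1 would do. At the first time z with w z at
    most 1/2, the intermediate value theorem gives w z = 1/2; so w is positive on the closed
    interval [0, z], and \<open>step\<close> yields w z = 1.\<close>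
  have pos: "w s > 1/2" if s: "s \<in> {0..1}" for s
  proof (rule ccontr)
    assume "\<not> w s > 1/2"
    define Z where "Z = {s \<in> {0..1}. w s \<le> 1/2}"
    have "s \<in> Z" using s \<open>\<not> w s > 1/2\<close> by (simp add: Z_def)
    moreover have "compact Z"
    proof -
      have "closed Z"
        unfolding Z_def by (intro continuous_on_closed_Collect_le contw continuous_on_const closed_atLeastAtMost)
      moreover have "bounded Z" by (rule bounded_subset[OF bounded_closed_interval[of 0 1]]) (auto simp: Z_def)
      ultimately show ?thesis by (simp add: compact_eq_bounded_closed)
    qed
    ultimately obtain z where z: "z \<in> Z" "\<And>y. y \<in> Z \<Longrightarrow> z \<le> y"
      using compact_attains_inf[of Z] by blast
    have z01: "z \<in> {0..1}" "w z \<le> 1/2" using z(1) by (auto simp: Z_def)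
    obtain x where x: "0 \<le> x" "x \<le> z" "w x = 1/2"
      using IVT2'[of w z "1/2" 0] z01 w0 continuous_on_subset[OF contw, of "{0..z}"] by auto
    have "x \<in> Z" using x z01 by (auto simp: Z_def)
    then have "x = z" using z(2) x by force
    have "w y > 0" if "y \<in> {0..z}" for y
    proof (cases "y = z")
      case False
      then have "y \<notin> Z" using z(2)[of y] that by auto
      then show ?thesis using that z01 by (auto simp: Z_def)
    qed (use x \<open>x = z\<close> in auto)
    from step[OF z01(1) this, of z] show False using z01 by simp
  qed
  have w1: "w s = 1" if "s \<in> {0..1}" for s
    using step[of 1 s] pos that by (smt (verit) atLeastAtMost_iff half_gt_zero_iff zero_less_one)
  \<comment> \<open>With w = 1 the clock is \<sigma> s = t s, so the comparison solution at s = 1 is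
    \<mu>(t).\<close>
  have "N 1 = gl_act (diag_id (\<lambda>X. sqrt (w 1) *\<^sub>R E (t * 1) X)) \<mu>0"
  proof (rule flow_eq_scaled[where T=1 and r=q and a=t and \<nu>=N and \<nu>'=N' and w=w and \<sigma>="\<lambda>s. t * s"])
    show "((\<lambda>s. t * s) has_real_derivative t / w s) (at s within {0..1})" if "s \<in> {0..1}" for s
      using that by (auto intro!: derivative_eq_intros simp: w1)
    show "w s > 0" if "s \<in> {0..1}" for s using w1[OF that] by simp
  qed (use q w0 dw dN eN N0 in auto)
  then show ?thesis by (simp add: w1 N_def \<mu>_def)
qed

end

text \<open>Uniqueness over every interval through 0 and every normalizing function is what
  justifies speaking of the solution that keeps F constant.\<close>

theorem proposition4p5:
  fixes k :: "'g::euclidean_space set" and j :: "'p::euclidean_space \<Rightarrow> 'g"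
    and \<mu>\<^sub>0 :: "'g bilin_map" and F :: "'g bilin_map \<Rightarrow> real"
    and c :: real and D :: "'g \<Rightarrow> 'g" and D\<^sub>p :: "'p \<Rightarrow> 'p"
  assumes "splitting k j"
    and "\<mu>\<^sub>0 \<in> hom_brackets k j"
    and "\<exists>M. is_hom_space_of k j \<mu>\<^sub>0 M \<and> semi_algebraic_soliton M"
    and "is_ricci_operator k j \<mu>\<^sub>0 (\<lambda>X. c *\<^sub>R X + (1/2) *\<^sub>R (D\<^sub>p X + adjoint D\<^sub>p X))"
    and "D \<in> derivations \<mu>\<^sub>0"
    and "\<forall>z\<in>k. D z = 0" and "\<forall>X. p_part k j (D (j X)) = D\<^sub>p X"
    and "F differentiable_on hom_brackets k j"
    and "isometry_invariant k j F" and "scaling_invariant k j F"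
    and "F \<mu>\<^sub>0 \<noteq> 0"
  shows "let A = (\<lambda>X. (1/2) *\<^sub>R (D\<^sub>p X - adjoint D\<^sub>p X));
         \<mu> = (\<lambda>t. gl_act
           (block_diag k j id (lin_exp (\<lambda>X. t *\<^sub>R A X) \<circ> lin_exp (\<lambda>X. - t *\<^sub>R D\<^sub>p X))) \<mu>\<^sub>0)
    in (\<exists>r. normalized_bracket_flow k j UNIV r \<mu>\<^sub>0 \<mu>) \<and> (\<forall>t. F (\<mu> t) = F \<mu>\<^sub>0) \<and>
    (\<forall>J r \<nu>. normalized_bracket_flow k j J r \<mu>\<^sub>0 \<nu> \<and> (\<forall>t\<in>J. F (\<nu> t) = F \<mu>\<^sub>0) \<longrightarrow>
       (\<forall>t\<in>J. \<nu> t = \<mu> t))"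
proof -
  interpret soliton k j \<mu>\<^sub>0 c D D\<^sub>p
    using assms by unfold_locales auto
  have \<mu>: "gl_act (block_diag k j id (lin_exp (\<lambda>X. t *\<^sub>R ((1/2) *\<^sub>R (D\<^sub>p X - adjoint D\<^sub>p X))) \<circ> lin_exp (\<lambda>X. - t *\<^sub>R D\<^sub>p X))) \<mu>\<^sub>0
      = \<mu> t" for t
    by (simp add: \<mu>_def E_def[abs_def] eA_def eD_def A_def comp_def)
  show ?thesis
    unfolding Let_def \<mu>
    using mu_flow mu_invariant[OF assms(9)] flow_eq_mu[OF _ assms(9-11)] by blast
qed

end
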